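(* Let $f$ be an even entire function of order less than $2$ which is real on the real line and has only real roots, with series $$f(z)=\sum_{k=0}^\infty\gamma_{2k}\frac{z^{2k}}{(2k)!}=\sum_{k=0}^\infty\eta_k\frac{z^{2k}}{k!}.$$ For $r>0$ let $n_+(r)$ be the number of real roots of $f$ in $[0,r]$, and assume that there exists $\alpha\in(0,2)$ such that for every $x>0$, $\lim_{r\to\infty}n_+(xr)/n_+(r)=x^\alpha$. Let $d\in\mathbb{N}$, and let $$J_{d,n}(z)=\sum_{k=0}^d\binom dk\eta_{k+n}z^k$$ be the degree $d$ even Jensen polynomial with shift $n$ of $f$. Define $$b_n=-2\bigl(2(n+d)-1\bigr)\frac{\gamma_{2(n+d-1)}}{\gamma_{2(n+d)}}$$ and $$c_n=4\bigl(2(n+d)-1\bigr)^2\left[\left(\frac{\gamma_{2(n+d)-2}}{\gamma_{2(n+d)}}\right)^2-\frac{2(n+d)-3}{2(n+d)-1}\,\frac{\gamma_{2(n+d)-4}}{\gamma_{2(n+d)}}\right].$$ Then, uniformly on compact subsets of the complex plane, $$\lim_{n\to\infty}\frac{c_n^{-d/2}}{\eta_{n+d}}\,J_{d,n}\bigl(\sqrt{c_n}\,z+b_n\bigr)=\operatorname{He}_d(z).$$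
   Context: Roots are counted with multiplicity. The two coefficient sequences are related by $\eta_k=\gamma_{2k}\frac{k!}{(2k)!}$; these coefficients are nonzero for all sufficiently large index, so the expressions are meaningful for large $n$. The degree $d$ Hermite polynomial is $\operatorname{He}_d(z)=\sum_{k=0}^{\lfloor d/2\rfloor}\frac{d!\,(-1)^k}{k!\,(d-2k)!}\frac{z^{d-2k}}{2^k}$ (monic). *)

theory Defs
  imports "HOL-Complex_Analysis.Complex_Analysis"
begin

definition max_modulus :: "(complex \<Rightarrow> complex) \<Rightarrow> real \<Rightarrow> real" where
  "max_modulus f r = (SUP z\<in>cball 0 r. norm (f z))"

(* The order of growth: the infimum of the exponents k > 0 with M(r) \<le> exp (r^k) for all
   large r. For nonconstant f this is limsup log (log M(r)) / log r; the infimum form needs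
   no convention for constants. It is \<infinity> if there is no such k. *)
definition entire_order :: "(complex \<Rightarrow> complex) \<Rightarrow> ereal" where
  "entire_order f =
     Inf {ereal k | k. 0 < k \<and> (\<forall>\<^sub>F r in at_top. max_modulus f r \<le> exp (r powr k))}"

(* Roots in [0, r] with multiplicity. For f entire and not identically zero the index set is
   finite and zorder is the (positive) multiplicity. *)
definition n_plus :: "(complex \<Rightarrow> complex) \<Rightarrow> real \<Rightarrow> nat" where
  "n_plus f r = (\<Sum>x\<in>{x. 0 \<le> x \<and> x \<le> r \<and> f (complex_of_real x) = 0}.
                    nat (zorder f (complex_of_real x)))"

definition even_jensen :: "(nat \<Rightarrow> complex) \<Rightarrow> nat \<Rightarrow> nat \<Rightarrow> complex \<Rightarrow> complex" where
  "even_jensen \<eta> d n z = (\<Sum>k\<le>d. of_nat (d choose k) * \<eta> (k + n) * z ^ k)"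

definition He :: "nat \<Rightarrow> complex \<Rightarrow> complex" where
  "He d z = (\<Sum>k\<le>d div 2. fact d * (-1) ^ k / (fact k * fact (d - 2 * k)) * (z ^ (d - 2 * k) / 2 ^ k))"

(* The indices of \<gamma> below use truncated subtraction, which only matters for n + d < 2;
   the scalar factors are computed in the complex numbers. *)
definition b_shift :: "(nat \<Rightarrow> complex) \<Rightarrow> nat \<Rightarrow> nat \<Rightarrow> complex" where
  "b_shift \<gamma> d n =
     - 2 * (2 * of_nat (n + d) - 1) * (\<gamma> (2 * (n + d - 1)) / \<gamma> (2 * (n + d)))"

definition c_scale :: "(nat \<Rightarrow> complex) \<Rightarrow> nat \<Rightarrow> nat \<Rightarrow> complex" where
  "c_scale \<gamma> d n =
     4 * (2 * of_nat (n + d) - 1) ^ 2 *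
       ((\<gamma> (2 * (n + d) - 2) / \<gamma> (2 * (n + d))) ^ 2
        - (2 * of_nat (n + d) - 3) / (2 * of_nat (n + d) - 1)
          * (\<gamma> (2 * (n + d) - 4) / \<gamma> (2 * (n + d))))"

end

theory Submission
  imports Defs "HOL-Computational_Algebra.Fundamental_Theorem_Algebra"
begin

text \<open>Because \<open>f\<close> is even, \<open>f(z) = F(z\<^sup>2)\<close> with \<open>F(w) = (\<Sum>k. \<eta> k * w^k / k!)\<close>. The function \<open>F\<close> has
order less than 1 and its zeros are nonnegative reals. By Borel and Caratheodory's inequality
(\<open>borel_caratheodory_0\<close>) such a function is, up to its zero at the origin and a constant, the locally
uniform limit of the partial products over its zeros (\<open>partial_prod_tendsto\<close>), so every closed inequality
between Taylor coefficients may be checked on polynomials with nonpositive roots, after \<open>w\<close> has been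
replaced by \<open>-w\<close>. For these, \<open>\<bar>\<eta> n\<bar>\<close> becomes, up to a constant factor, the sequence \<open>g n\<close> of
derivatives at 0.

Fix \<open>n\<close> and let \<open>x\<^sub>j > 0\<close> be the reciprocal moduli of the roots of the \<open>n\<close>-th derivative, with power sums
\<open>p\<^sub>k\<close> and \<open>\<sigma> = sqrt p\<^sub>2\<close>. The polynomial \<open>\<Sum>k\<le>d. (d choose k) * \<eta> (n+k) / \<eta> n * \<zeta>^(d-k)\<close> is \<open>d!\<close> times
the coefficient of \<open>t^d\<close> in \<open>exp (\<zeta> t) * (\<Prod>j. 1 - x\<^sub>j t) = exp ((\<zeta> - p\<^sub>1) t - p\<^sub>2 t\<^sup>2/2 - p\<^sub>3 t^3/3 - \<dots>)\<close>. For
\<open>\<zeta> = p\<^sub>1 + \<sigma> y\<close> and \<open>t\<close> measured in units of \<open>1/\<sigma>\<close> this is close to the Hermite generating function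
\<open>exp (y t - t\<^sup>2/2)\<close> as soon as \<open>p\<^sub>k / \<sigma>^k\<close> is small for all \<open>k \<ge> 3\<close>. Since \<open>p\<^sub>k\<^sup>3 \<le> p\<^sub>3^k\<close>, the single condition
\<open>p\<^sub>3\<^sup>2 / p\<^sub>2^3 \<longlonglongrightarrow> 0\<close> suffices (\<open>appell_tendsto_He\<close>, \<open>p_over_\<sigma>\<close>); it expresses that many roots of the
derivative have a modulus comparable to the smallest one. The Jensen polynomial at \<open>z\<close> is \<open>z^d\<close> times this
polynomial at \<open>\<zeta> = 1/z\<close>, and for \<open>z = sqrt c\<^sub>n * w + b\<^sub>n\<close> the relations between consecutive derivatives show
that \<open>1/z = p\<^sub>1 + \<sigma> y\<close> with \<open>y\<close> tending to \<open>-w\<close> (\<open>jensen_tendsto_He\<close>); the parity of the Hermite polynomials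
removes the sign.

It remains to see why \<open>p\<^sub>3\<^sup>2 / p\<^sub>2^3\<close> tends to 0. With \<open>h n = g (n+1) / g n = p\<^sub>1\<close> Newton's identities give
\<open>p\<^sub>2 = h n * (h n - h (n+1))\<close> and, with the Cauchy-Schwarz inequality \<open>p\<^sub>2\<^sup>2 \<le> p\<^sub>1 * p\<^sub>3\<close>, also
\<open>p\<^sub>3 \<le> h n * (p\<^sub>2 n - p\<^sub>2 (n+1))\<close>; moreover \<open>p\<^sub>1, p\<^sub>2, p\<^sub>3\<close> all decrease with \<open>n\<close>. So bounds for \<open>p\<^sub>2\<close> and
\<open>p\<^sub>3\<close> follow from two-sided bounds for \<open>h\<close> by telescoping over blocks of indices. The bounds for \<open>h\<close> come
from double counting in elementary symmetric functions (\<open>Suc_esym_Suc_ge\<close>, \<open>Suc_esym_Suc_le\<close>): if \<open>N\<close> of the zeros lie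
below a level \<open>r\<close>, then for \<open>n\<close> of size \<open>N\<close> the quotient \<open>h n\<close> is comparable to the sum of the reciprocals
of the zeros beyond \<open>r\<close>. Regular variation of the zero counting function, applied along \<open>r = 4^i\<close>, makes
this sum comparable to \<open>\<rho> = N/r\<close>. Altogether \<open>p\<^sub>2\<close> has size \<open>\<rho>\<^sup>2/N\<close> and \<open>p\<^sub>3\<close> at most \<open>\<rho>^3/N\<^sup>2\<close>, whence
\<open>p\<^sub>3\<^sup>2 / p\<^sub>2^3\<close> is at most a constant times \<open>1/N\<close>.\<close>

section \<open>Elementary symmetric functions\<close>

definition esym :: "'i set \<Rightarrow> ('i \<Rightarrow> 'a::comm_semiring_1) \<Rightarrow> nat \<Rightarrow> 'a" where
  "esym I x k = (\<Sum>S | S \<subseteq> I \<and> card S = k. \<Prod>j\<in>S. x j)"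

lemma esym_0 [simp]: "finite I \<Longrightarrow> esym I x 0 = 1"
proof -
  assume I: "finite I"
  have "{S. S \<subseteq> I \<and> card S = 0} = {{}}"
    using I by (auto dest: finite_subset)
  thus ?thesis by (simp add: esym_def)
qed

text \<open>Used to pass from coefficients of partial products, and of polynomials with prescribed roots, to
elementary symmetric functions of the reciprocal roots.\<close>
lemma fps_nth_prod_linear:
  fixes x :: "'i \<Rightarrow> 'a::comm_ring_1"
  assumes "finite I"
  shows "fps_nth (\<Prod>j\<in>I. 1 + fps_const (x j) * fps_X) k = esym I x k"
proof -
  have const: "(\<Prod>j\<in>S. fps_const (x j)) = fps_const (\<Prod>j\<in>S. x j)" for S
    by (induction S rule: infinite_finite_induct) auto
  have "(\<Prod>j\<in>I. 1 + fps_const (x j) * fps_X) =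
        (\<Sum>S\<in>Pow I. fps_const (\<Prod>j\<in>S. x j) * fps_X ^ card S)"
    using prod_add[OF assms, of "\<lambda>j. fps_const (x j) * fps_X" "\<lambda>_. 1"]
    by (simp add: add.commute prod.distrib const)
  hence "fps_nth (\<Prod>j\<in>I. 1 + fps_const (x j) * fps_X) k =
         (\<Sum>S\<in>Pow I. if k = card S then (\<Prod>j\<in>S. x j) else 0)"
    by (simp add: fps_sum_nth fps_X_power_nth if_distrib cong: if_cong)
  also have "\<dots> = (\<Sum>S | S \<subseteq> I \<and> card S = k. \<Prod>j\<in>S. x j)"
    using assms by (intro sum.mono_neutral_cong_right) auto
  finally show ?thesis by (simp add: esym_def)
qed

lemma esym_nonneg:
  fixes x :: "'i \<Rightarrow> real"
  assumes "\<And>j. j \<in> I \<Longrightarrow> x j \<ge> 0"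
  shows "esym I x k \<ge> 0"
  unfolding esym_def using assms by (auto intro!: sum_nonneg prod_nonneg)

lemma esym_mono:
  fixes x :: "'i \<Rightarrow> real"
  assumes "finite J" "I \<subseteq> J" "\<And>j. j \<in> J \<Longrightarrow> x j \<ge> 0"
  shows "esym I x k \<le> esym J x k"
  unfolding esym_def using assms by (intro sum_mono2) (auto intro!: prod_nonneg)

lemma esym_pos:
  fixes x :: "'i \<Rightarrow> real"
  assumes "finite I" "\<And>j. j \<in> I \<Longrightarrow> x j > 0" "k \<le> card I"
  shows "esym I x k > 0"
proof -
  obtain S where "S \<subseteq> I" "card S = k"
    using assms(3) by (meson obtain_subset_with_card_n)
  thus ?thesis
    unfolding esym_def using assms
    by (intro sum_pos2[of _ S]) (auto intro!: prod_pos prod_nonneg less_imp_le)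
qed

text \<open>Both sides count the pairs of a \<open>(k+1)\<close>-element subset and a marked element of it: either the subset is chosen
first, or the complement of the marked element is.\<close>
lemma Suc_esym_Suc:
  fixes x :: "'i \<Rightarrow> real"
  assumes "finite I"
  shows "Suc k * esym I x (Suc k) =
    (\<Sum>S | S \<subseteq> I \<and> card S = k. (\<Prod>j\<in>S. x j) * (\<Sum>i\<in>I - S. x i))"
proof -
  let ?A = "Sigma {S. S \<subseteq> I \<and> card S = Suc k} (\<lambda>S. S)"
  let ?B = "Sigma {S. S \<subseteq> I \<and> card S = k} (\<lambda>S. I - S)"
  have fin: "finite {S. S \<subseteq> I \<and> card S = l}" for l
    using assms by simp
  have finS: "finite S" if "S \<subseteq> I" for S
    using that assms finite_subset by blast
  have "Suc k * esym I x (Suc k) = (\<Sum>S | S \<subseteq> I \<and> card S = Suc k. \<Sum>i\<in>S. \<Prod>j\<in>S. x j)"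
    unfolding esym_def by (simp add: sum_distrib_left)
  also have "\<dots> = (\<Sum>(S,i)\<in>?A. \<Prod>j\<in>S. x j)"
    using fin finS by (subst sum.Sigma) auto
  also have "\<dots> = (\<Sum>(S,i)\<in>?B. (\<Prod>j\<in>S. x j) * x i)"
    by (rule sum.reindex_bij_witness[of _ "\<lambda>(S,i). (insert i S, i)" "\<lambda>(S,i). (S - {i}, i)"])
       (use finS in \<open>auto simp: insert_absorb card_Diff_singleton prod.remove mult.commute\<close>)
  also have "\<dots> = (\<Sum>S | S \<subseteq> I \<and> card S = k. \<Sum>i\<in>I - S. (\<Prod>j\<in>S. x j) * x i)"
    using fin assms by (subst sum.Sigma) auto
  finally show ?thesis by (simp add: sum_distrib_left)
qed

text \<open>A \<open>k\<close>-element set \<open>S\<close> removes at most as much weight from \<open>I\<close> as the \<open>k \<le> card H\<close> largest elements do, so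
the inner sum in \<open>Suc_esym_Suc\<close> is at least the total weight outside \<open>H\<close>.\<close>
lemma Suc_esym_Suc_ge:
  fixes x :: "'i \<Rightarrow> real"
  assumes I: "finite I" and pos: "\<And>j. j \<in> I \<Longrightarrow> x j \<ge> 0" and H: "H \<subseteq> I" "k \<le> card H"
    and largest: "\<And>i j. i \<in> H \<Longrightarrow> j \<in> I - H \<Longrightarrow> x j \<le> x i"
  shows "(\<Sum>i\<in>I - H. x i) * esym I x k \<le> Suc k * esym I x (Suc k)"
proof -
  have "(\<Sum>i\<in>I - H. x i) \<le> (\<Sum>i\<in>I - S. x i)" if S: "S \<subseteq> I" "card S = k" for S
  proof -
    have fin: "finite S" "finite H" using S H I finite_subset by blast+
    \<comment> \<open>the elements of \<open>S\<close> outside \<open>H\<close> are exchanged injectively for larger elements of \<open>H\<close> outside \<open>S\<close>\<close>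
    have "card (S - H) \<le> card (H - S)"
      using S H fin by (metis Int_commute card_Diff_subset_Int diff_le_mono finite_Int)
    then obtain f where f: "inj_on f (S - H)" "f ` (S - H) \<subseteq> H - S"
      using fin by (meson card_le_inj finite_Diff)
    have "(\<Sum>i\<in>S - H. x i) \<le> (\<Sum>i\<in>S - H. x (f i))"
      using f largest S by (intro sum_mono) blast
    also have "\<dots> = (\<Sum>i\<in>f ` (S - H). x i)"
      using f by (simp add: sum.reindex)
    also have "\<dots> \<le> (\<Sum>i\<in>H - S. x i)"
      using f fin H pos by (intro sum_mono2) auto
    finally have le: "(\<Sum>i\<in>S - H. x i) \<le> (\<Sum>i\<in>H - S. x i)" .
    have "(\<Sum>i\<in>I - H. x i) = (\<Sum>i\<in>I - H - S. x i) + (\<Sum>i\<in>S - H. x i)"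
      using I S by (subst sum.union_disjoint[symmetric]) (auto intro!: sum.cong finite_Diff fin)
    moreover have "(\<Sum>i\<in>I - S. x i) = (\<Sum>i\<in>I - H - S. x i) + (\<Sum>i\<in>H - S. x i)"
      using I H by (subst sum.union_disjoint[symmetric]) (auto intro!: sum.cong finite_Diff fin)
    ultimately show ?thesis using le by simp
  qed
  hence "(\<Sum>S | S \<subseteq> I \<and> card S = k. (\<Prod>j\<in>S. x j) * (\<Sum>i\<in>I - H. x i)) \<le> Suc k * esym I x (Suc k)"
    unfolding Suc_esym_Suc[OF I] using pos
    by (intro sum_mono mult_left_mono prod_nonneg) auto
  thus ?thesis by (simp add: esym_def sum_distrib_left mult.commute)
qed

text \<open>A \<open>(k+1)\<close>-element set has at least \<open>k + 1 - card H\<close> elements outside \<open>H\<close>. Marking only such elements in the double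
count bounds the symmetric function from above by the weight outside \<open>H\<close>. Together with \<open>Suc_esym_Suc_ge\<close> this
locates the quotient of consecutive symmetric functions without any asymptotic analysis.\<close>
lemma Suc_esym_Suc_le:
  fixes x :: "'i \<Rightarrow> real"
  assumes I: "finite I" and pos: "\<And>j. j \<in> I \<Longrightarrow> x j \<ge> 0" and H: "H \<subseteq> I"
  shows "(real (Suc k) - card H) * esym I x (Suc k) \<le> (\<Sum>i\<in>I - H. x i) * esym I x k"
proof -
  let ?A = "Sigma {S. S \<subseteq> I \<and> card S = Suc k} (\<lambda>S. S - H)"
  let ?B = "Sigma {S. S \<subseteq> I \<and> card S = k} (\<lambda>S. I - H - S)"
  have fin: "finite {S. S \<subseteq> I \<and> card S = l}" for l
    using I by simp
  have finS: "finite S" if "S \<subseteq> I" for S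
    using that I finite_subset by blast
  have "(real (Suc k) - card H) * esym I x (Suc k) =
        (\<Sum>S | S \<subseteq> I \<and> card S = Suc k. (real (card S) - card H) * (\<Prod>j\<in>S. x j))"
    by (simp add: esym_def sum_distrib_left)
  also have "\<dots> \<le> (\<Sum>S | S \<subseteq> I \<and> card S = Suc k. real (card (S - H)) * (\<Prod>j\<in>S. x j))"
  proof (intro sum_mono mult_right_mono prod_nonneg)
    fix S assume S: "S \<in> {S. S \<subseteq> I \<and> card S = Suc k}"
    have "card S - card H \<le> card (S - H)"
      using finS[OF H] by (rule diff_card_le_card_Diff)
    thus "real (card S) - real (card H) \<le> real (card (S - H))" by linarith
  qed (use pos in auto)
  also have "\<dots> = (\<Sum>(S,i)\<in>?A. \<Prod>j\<in>S. x j)"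
    using fin finS by (subst sum.Sigma[symmetric]) auto
  also have "\<dots> = (\<Sum>(S,i)\<in>?B. (\<Prod>j\<in>S. x j) * x i)"
    by (rule sum.reindex_bij_witness[of _ "\<lambda>(S,i). (insert i S, i)" "\<lambda>(S,i). (S - {i}, i)"])
       (use finS in \<open>auto simp: insert_absorb card_Diff_singleton prod.remove mult.commute\<close>)
  also have "\<dots> = (\<Sum>S | S \<subseteq> I \<and> card S = k. \<Sum>i\<in>I - H - S. (\<Prod>j\<in>S. x j) * x i)"
    using fin I by (subst sum.Sigma) auto
  also have "\<dots> \<le> (\<Sum>S | S \<subseteq> I \<and> card S = k. (\<Prod>j\<in>S. x j) * (\<Sum>i\<in>I - H. x i))"
    unfolding sum_distrib_left[symmetric] using pos I
    by (intro sum_mono mult_left_mono prod_nonneg sum_mono2) auto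
  finally show ?thesis by (simp add: esym_def sum_distrib_left mult.commute)
qed

section \<open>Newton's identities\<close>

text \<open>The formal identity \<open>A' = A * (\<Sum>i. (-1)^i * p (i+1) * t^i)\<close> for \<open>A = (\<Sum>k. a k * t^k)\<close>.\<close>
definition newton_identities :: "(nat \<Rightarrow> real) \<Rightarrow> (nat \<Rightarrow> real) \<Rightarrow> bool" where
  "newton_identities a p \<longleftrightarrow> a 0 = 1 \<and>
     (\<forall>k. real (Suc k) * a (Suc k) = (\<Sum>i\<le>k. (-1) ^ i * p (Suc i) * a (k - i)))"

text \<open>The logarithmic derivative of \<open>\<Prod>j\<in>I. 1 + x j * t\<close> is a sum of geometric series.\<close>
lemma newton_identities_esym:
  assumes "finite I"
  shows "newton_identities (esym I x) (\<lambda>k. \<Sum>j\<in>I. x j ^ k)"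
proof -
  define P where "P I = (Abs_fps (\<lambda>i. (-1) ^ i * (\<Sum>j\<in>I. x j ^ Suc i)) :: real fps)" for I
  define S where "S I = (\<Prod>j\<in>I. 1 + fps_const (x j) * fps_X :: real fps)" for I
  have geo: "(1 + fps_const y * fps_X) * Abs_fps (\<lambda>i. (-1) ^ i * y ^ Suc i) = fps_const y" for y :: real
  proof (rule fps_ext)
    fix n show "fps_nth ((1 + fps_const y * fps_X) * Abs_fps (\<lambda>i. (-1) ^ i * y ^ Suc i)) n
        = fps_nth (fps_const y) n"
      by (cases n) (simp_all add: distrib_right mult.assoc)
  qed
  have "fps_deriv (S I) = P I * S I"
    using assms
  proof (induction I rule: finite_induct)
    case empty
    thus ?case by (simp add: P_def S_def fps_eq_iff)
  next
    case (insert y I)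
    have S: "S (insert y I) = (1 + fps_const (x y) * fps_X) * S I"
      using insert.hyps by (simp add: S_def)
    have P: "P (insert y I) = Abs_fps (\<lambda>i. (-1) ^ i * x y ^ Suc i) + P I"
      using insert.hyps by (simp add: P_def fps_eq_iff algebra_simps)
    have "fps_deriv (S (insert y I)) =
          fps_const (x y) * S I + (1 + fps_const (x y) * fps_X) * (P I * S I)"
      unfolding S by (simp add: insert.IH)
    also have "\<dots> = (1 + fps_const (x y) * fps_X) * Abs_fps (\<lambda>i. (-1) ^ i * x y ^ Suc i) * S I
        + (1 + fps_const (x y) * fps_X) * (P I * S I)"
      by (simp only: geo)
    also have "\<dots> = P (insert y I) * S (insert y I)"
      unfolding S P by (simp only: algebra_simps)
    finally show ?case .
  qed
  hence "fps_nth (fps_deriv (S I)) k = fps_nth (P I * S I) k" for k by simp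
  moreover have "fps_nth (S I) k = esym I x k" for k
    unfolding S_def by (rule fps_nth_prod_linear[OF assms])
  ultimately have "real (Suc k) * esym I x (Suc k) =
      (\<Sum>i\<le>k. (-1) ^ i * (\<Sum>j\<in>I. x j ^ Suc i) * esym I x (k - i))" for k
    by (simp add: fps_mult_nth P_def atLeast0AtMost)
  thus ?thesis using assms by (simp add: newton_identities_def)
qed

text \<open>Newton's identities determine the power sums as polynomials in the coefficients, so convergence of the coefficients
carries over to the power sums. This transfers statements about polynomials to entire functions.\<close>
lemma newton_identities_limit:
  fixes a :: "nat \<Rightarrow> real"
  assumes N: "\<And>R. newton_identities (A R) (P R)"
    and lim: "\<And>k. ((\<lambda>R. A R k) \<longlongrightarrow> a k) sequentially"
  shows "\<exists>p. newton_identities a p \<and> (\<forall>k>0. (\<lambda>R. P R k) \<longlonglongrightarrow> p k)"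
proof -
  have A0: "A R 0 = 1" for R
    using N by (simp add: newton_identities_def)
  have "convergent (\<lambda>R. P R (Suc k))" for k
  proof (induction k rule: less_induct)
    case (less k)
    have eq: "P R (Suc k) = (-1) ^ k * (Suc k * A R (Suc k) - (\<Sum>i<k. (-1) ^ i * P R (Suc i) * A R (k - i)))" for R
    proof -
      have "Suc k * A R (Suc k) = (\<Sum>i\<le>k. (-1) ^ i * P R (Suc i) * A R (k - i))"
        using N by (auto simp: newton_identities_def)
      also have "\<dots> = (\<Sum>i<k. (-1) ^ i * P R (Suc i) * A R (k - i)) + (-1) ^ k * P R (Suc k)"
        by (simp add: lessThan_Suc_atMost[symmetric] A0)
      finally have e: "Suc k * A R (Suc k) - (\<Sum>i<k. (-1) ^ i * P R (Suc i) * A R (k - i)) = (-1) ^ k * P R (Suc k)"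
        by simp
      show ?thesis unfolding e by (simp add: mult.assoc[symmetric] power_mult_distrib[symmetric])
    qed
    have cA: "convergent (\<lambda>R. A R i)" for i
      using lim convergentI by blast
    show ?case
      unfolding eq using less cA
      by (intro convergent_mult convergent_diff convergent_sum convergent_const) auto
  qed
  then obtain p' where p': "\<And>k. (\<lambda>R. P R (Suc k)) \<longlonglongrightarrow> p' k"
    unfolding convergent_def by metis
  define p where "p k = p' (k - 1)" for k
  have p: "(\<lambda>R. P R k) \<longlonglongrightarrow> p k" if "k > 0" for k
    using p'[of "k - 1"] that by (simp add: p_def)
  have "real (Suc k) * a (Suc k) = (\<Sum>i\<le>k. (-1) ^ i * p (Suc i) * a (k - i))" for k
  proof (rule LIMSEQ_unique)
    show "(\<lambda>R. real (Suc k) * A R (Suc k)) \<longlonglongrightarrow> real (Suc k) * a (Suc k)"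
      by (intro tendsto_intros lim)
    have "(\<lambda>R. \<Sum>i\<le>k. (-1) ^ i * P R (Suc i) * A R (k - i)) \<longlonglongrightarrow> (\<Sum>i\<le>k. (-1) ^ i * p (Suc i) * a (k - i))"
      by (intro tendsto_intros lim p) auto
    thus "(\<lambda>R. real (Suc k) * A R (Suc k)) \<longlonglongrightarrow> (\<Sum>i\<le>k. (-1) ^ i * p (Suc i) * a (k - i))"
      using N by (simp add: newton_identities_def)
  qed
  moreover have "a 0 = 1"
    using lim[of 0] by (simp add: A0 LIMSEQ_const_iff)
  ultimately show ?thesis
    using p by (auto simp: newton_identities_def)
qed

section \<open>Inequalities for power sums\<close>

text \<open>The closed conditions on power sums of nonnegative numbers that survive a passage to the limit: two inequalities
of Cauchy-Schwarz type, and a bound for all higher power sums by the third one.\<close>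
definition moment_inequalities :: "(nat \<Rightarrow> real) \<Rightarrow> bool" where
  "moment_inequalities p \<longleftrightarrow> (\<forall>k>0. p k \<ge> 0) \<and> p 2 ^ 2 \<le> p 1 * p 3 \<and>
     p 2 * p 3 \<le> p 1 * p 4 \<and> (\<forall>k\<ge>3. p k ^ 3 \<le> p 3 ^ k)"

lemma moment_inequalities_power_sums:
  fixes x :: "'i \<Rightarrow> real"
  assumes I: "finite I" and pos: "\<And>j. j \<in> I \<Longrightarrow> x j \<ge> 0"
  shows "moment_inequalities (\<lambda>k. \<Sum>j\<in>I. x j ^ k)"
proof -
  define p where "p k = (\<Sum>j\<in>I. x j ^ k)" for k
  have nonneg: "p k \<ge> 0" for k
    using pos by (auto simp: p_def intro: sum_nonneg)
  have CS: "(\<Sum>j\<in>I. u j * v j)\<^sup>2 \<le> (\<Sum>j\<in>I. (u j)\<^sup>2) * (\<Sum>j\<in>I. (v j)\<^sup>2)" for u v :: "'i \<Rightarrow> real"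
    by (rule Cauchy_Schwarz_ineq_sum)
  have "(\<Sum>j\<in>I. sqrt (x j) * (sqrt (x j) * x j)) = p 2"
    unfolding p_def using pos
    by (intro sum.cong) (auto simp: mult.assoc[symmetric] power2_eq_square)
  moreover have "(\<Sum>j\<in>I. (sqrt (x j) * x j)\<^sup>2) = p 3"
    unfolding p_def using pos by (intro sum.cong) (auto simp: power_mult_distrib eval_nat_numeral)
  moreover have "(\<Sum>j\<in>I. (sqrt (x j))\<^sup>2) = p 1"
    unfolding p_def using pos by (intro sum.cong) auto
  ultimately have 2: "p 2 ^ 2 \<le> p 1 * p 3"
    using CS[of "\<lambda>j. sqrt (x j)" "\<lambda>j. sqrt (x j) * x j"] by simp
  have 3: "p 3 ^ 2 \<le> p 2 * p 4"
    using CS[of x "\<lambda>j. x j ^ 2"] by (simp add: p_def eval_nat_numeral mult.assoc)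
  have 4: "p 2 * p 3 \<le> p 1 * p 4"
  proof (cases "p 2 * p 3 = 0")
    case False
    hence "p 2 * p 3 > 0" using nonneg[of 2] nonneg[of 3] by (simp add: less_le)
    moreover have "(p 2 * p 3) * (p 2 * p 3) \<le> (p 1 * p 4) * (p 2 * p 3)"
      using mult_mono[OF 2 3] nonneg by (simp add: power2_eq_square mult_ac)
    ultimately show ?thesis by (meson mult_right_le_imp_le)
  qed (use nonneg in auto)
  have 5: "p k ^ 3 \<le> p 3 ^ k" if "k \<ge> 3" for k
  proof -
    \<comment> \<open>the cube root of the third power sum dominates every single \<open>x j\<close>\<close>
    define M where "M = root 3 (p 3)"
    have M: "M ^ 3 = p 3" "M \<ge> 0"
      using nonneg[of 3] by (auto simp: M_def)
    have xM: "x j \<le> M" if "j \<in> I" for j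
    proof -
      have "x j ^ 3 \<le> p 3"
        unfolding p_def using that I pos by (intro member_le_sum) auto
      thus ?thesis
        using M pos[OF that] power_mono_iff[of "x j" M 3] by simp
    qed
    have "p k \<le> (\<Sum>j\<in>I. M ^ (k - 3) * x j ^ 3)"
      unfolding p_def
    proof (intro sum_mono)
      fix j assume j: "j \<in> I"
      have "x j ^ k = x j ^ (k - 3) * x j ^ 3"
        using that by (simp add: power_add[symmetric])
      thus "x j ^ k \<le> M ^ (k - 3) * x j ^ 3"
        using xM[OF j] pos[OF j] by (auto intro!: mult_right_mono power_mono)
    qed
    also have "\<dots> = M ^ k"
      using that by (simp add: sum_distrib_left[symmetric] p_def[symmetric] M(1)[symmetric] power_add[symmetric])
    finally have "p k ^ 3 \<le> (M ^ k) ^ 3"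
      using nonneg by (intro power_mono) auto
    thus ?thesis by (simp add: M(1)[symmetric] power_mult[symmetric] mult.commute)
  qed
  show ?thesis
    unfolding moment_inequalities_def p_def[symmetric] using nonneg 2 4 5 by auto
qed

lemma moment_inequalities_limit:
  assumes "\<And>R. moment_inequalities (P R)" and lim: "\<And>k. k > 0 \<Longrightarrow> (\<lambda>R. P R k) \<longlonglongrightarrow> p k"
  shows "moment_inequalities p"
proof -
  note * = assms(1)[unfolded moment_inequalities_def]
  have "p k \<ge> 0" if "k > 0" for k
    using lim[OF that] by (rule tendsto_lowerbound) (use * that in auto)
  moreover have "p 2 ^ 2 \<le> p 1 * p 3"
  proof (rule LIMSEQ_le)
    show "(\<lambda>R. P R 2 ^ 2) \<longlonglongrightarrow> p 2 ^ 2" "(\<lambda>R. P R 1 * P R 3) \<longlonglongrightarrow> p 1 * p 3"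
      by (intro tendsto_intros lim; simp)+
  qed (use * in auto)
  moreover have "p 2 * p 3 \<le> p 1 * p 4"
  proof (rule LIMSEQ_le)
    show "(\<lambda>R. P R 2 * P R 3) \<longlonglongrightarrow> p 2 * p 3" "(\<lambda>R. P R 1 * P R 4) \<longlonglongrightarrow> p 1 * p 4"
      by (intro tendsto_intros lim; simp)+
  qed (use * in auto)
  moreover have "p k ^ 3 \<le> p 3 ^ k" if "k \<ge> 3" for k
  proof (rule LIMSEQ_le)
    show "(\<lambda>R. P R k ^ 3) \<longlonglongrightarrow> p k ^ 3" "(\<lambda>R. P R 3 ^ k) \<longlonglongrightarrow> p 3 ^ k"
      by (intro tendsto_power lim; use that in simp)+
  qed (use that * in auto)
  ultimately show ?thesis
    by (simp add: moment_inequalities_def)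
qed

section \<open>Roots of derivatives\<close>

definition nonpos_real_roots :: "complex poly \<Rightarrow> bool" where
  "nonpos_real_roots p \<longleftrightarrow> (\<forall>z. poly p z = 0 \<longrightarrow> Im z = 0 \<and> Re z \<le> 0)"

text \<open>A half-plane argument as for the Gauss-Lucas theorem: at a root \<open>z\<close> of the derivative that is not a root of
\<open>p\<close> the sum of \<open>1 / (z - r i)\<close> over the roots vanishes. If \<open>Im z \<noteq> 0\<close>, all imaginary parts have the same strict
sign; if \<open>Re z > 0\<close>, all real parts are positive.\<close>
lemma nonpos_real_roots_pderiv:
  assumes p: "nonpos_real_roots p" and nz: "pderiv p \<noteq> 0"
  shows "nonpos_real_roots (pderiv p)"
  unfolding nonpos_real_roots_def
proof safe
  have p0: "p \<noteq> 0" using nz by auto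
  obtain r where r: "smult (lead_coeff p) (\<Prod>i<degree p. [:-r i, 1:]) = p"
    using complex_poly_decompose' by blast
  define n where "n = degree p"
  have n: "n > 0"
    using nz by (metis gr0I n_def pderiv_eq_0_iff)
  have pz: "poly p z = lead_coeff p * (\<Prod>i<n. z - r i)" for z
    by (subst r[symmetric]) (simp add: poly_prod n_def)
  have rr: "Im (r i) = 0 \<and> Re (r i) \<le> 0" if "i < n" for i
  proof -
    have "poly p (r i) = 0" using that by (auto simp: pz)
    thus ?thesis using p by (simp add: nonpos_real_roots_def)
  qed
  fix z assume z: "poly (pderiv p) z = 0"
  have eq: "(\<Sum>i<n. 1 / (z - r i)) = 0" if "poly p z \<noteq> 0"
  proof -
    have ne: "z - r i \<noteq> 0" if "i < n" for i
      using \<open>poly p z \<noteq> 0\<close> that by (auto simp: pz)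
    have "((\<lambda>z. \<Prod>i<n. z - r i) has_field_derivative
        (\<Prod>i<n. z - r i) * (\<Sum>i<n. 1 / (z - r i))) (at z)"
    proof (rule has_field_derivative_prod'[where f = "\<lambda>i z. z - r i" and f' = "\<lambda>_. 1"])
      show "((\<lambda>z. z - r i) has_field_derivative 1) (at z)" for i
        by (auto intro!: derivative_eq_intros)
    qed (use ne in auto)
    hence "((\<lambda>z. lead_coeff p * (\<Prod>i<n. z - r i)) has_field_derivative
        lead_coeff p * ((\<Prod>i<n. z - r i) * (\<Sum>i<n. 1 / (z - r i)))) (at z)"
      by (rule DERIV_cmult)
    moreover have "(\<lambda>z. lead_coeff p * (\<Prod>i<n. z - r i)) = poly p"
      by (rule ext) (simp add: pz)
    ultimately have "(poly p has_field_derivative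
        lead_coeff p * ((\<Prod>i<n. z - r i) * (\<Sum>i<n. 1 / (z - r i)))) (at z)"
      by (simp only:)
    hence "poly (pderiv p) z = lead_coeff p * ((\<Prod>i<n. z - r i) * (\<Sum>i<n. 1 / (z - r i)))"
      by (rule DERIV_unique[OF poly_DERIV])
    hence "poly p z * (\<Sum>i<n. 1 / (z - r i)) = 0"
      by (simp only: z pz mult.assoc)
    thus ?thesis using that by simp
  qed
  have ne: "z - r i \<noteq> 0" if "i < n" "poly p z \<noteq> 0" for i
    using that by (auto simp: pz)
  show im: "Im z = 0"
  proof (cases "poly p z = 0")
    case False
    have "(\<Sum>i<n. Im (1 / (z - r i))) = 0"
      using eq[OF False] by (metis Im_sum zero_complex.sel(2))
    moreover have "Im (1 / (z - r i)) = - Im z / (norm (z - r i))\<^sup>2" if "i < n" for i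
      using rr[OF that] by (simp add: Im_divide cmod_def)
    ultimately have "Im z * (\<Sum>i<n. 1 / (norm (z - r i))\<^sup>2) = 0"
      by (simp add: sum_distrib_left sum_negf)
    moreover have "(\<Sum>i<n. 1 / (norm (z - r i))\<^sup>2) > 0"
      using n ne False by (intro sum_pos) auto
    ultimately show ?thesis by simp
  qed (use p in \<open>auto simp: nonpos_real_roots_def\<close>)
  show "Re z \<le> 0"
  proof (rule ccontr)
    assume *: "\<not> Re z \<le> 0"
    hence False: "poly p z \<noteq> 0"
      using p by (auto simp: nonpos_real_roots_def)
    have "(\<Sum>i<n. Re (1 / (z - r i))) = 0"
      using eq[OF False] by (metis Re_sum zero_complex.sel(1))
    moreover have "Re (1 / (z - r i)) > 0" if "i < n" for i
    proof -
      have "Re (z - r i) > 0" using rr[OF that] * by simp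
      thus ?thesis
        using ne[OF that False] by (simp add: Re_divide cmod_def complex_eq_iff add_nonneg_pos field_simps sum_power2_gt_zero_iff)
    qed
    ultimately show False
      using sum_pos[of "{..<n}" "\<lambda>i. Re (1 / (z - r i))"] n by auto
  qed
qed

lemma higher_pderiv_coeff:
  "coeff ((pderiv ^^ n) p) k = fact (n + k) / fact k * coeff (p :: complex poly) (n + k)"
proof (induction n arbitrary: k)
  case (Suc n)
  have "fact (Suc k) = (of_nat (Suc k) * fact k :: complex)"
    by simp
  thus ?case
    by (simp add: coeff_pderiv Suc del: of_nat_Suc fact_Suc)
qed auto

lemma esym_of_real: "esym I (\<lambda>i. of_real (x i)) k = (of_real (esym I x k) :: complex)"
  by (simp add: esym_def)

lemma coeff_prod_linear:
  fixes x :: "'i \<Rightarrow> 'a::comm_ring_1"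
  assumes "finite I"
  shows "coeff (\<Prod>j\<in>I. [:1, x j:]) k = esym I x k"
proof -
  have "fps_of_poly (\<Prod>j\<in>I. [:1, x j:]) = (\<Prod>j\<in>I. 1 + fps_const (x j) * fps_X)"
    unfolding fps_of_poly_prod by (simp add: fps_of_poly_pCons)
  thus ?thesis
    using fps_nth_prod_linear[OF assms, of x k] by (metis fps_of_poly_nth)
qed

lemma nonpos_real_roots_factorization:
  assumes p: "nonpos_real_roots p" and p0: "poly p 0 \<noteq> 0"
  shows "\<exists>(x :: nat \<Rightarrow> real) n. (\<forall>i<n. x i > 0) \<and>
    (\<forall>k. coeff p k = coeff p 0 * of_real (esym {..<n} x k))"
proof -
  obtain r where r: "smult (lead_coeff p) (\<Prod>i<degree p. [:-r i, 1:]) = p"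
    using complex_poly_decompose' by blast
  define n where "n = degree p"
  have pz: "poly p z = lead_coeff p * (\<Prod>i<n. z - r i)" for z
    by (subst r[symmetric]) (simp add: poly_prod n_def)
  have rr: "Im (r i) = 0 \<and> Re (r i) < 0" if "i < n" for i
  proof -
    have "poly p (r i) = 0" using that by (auto simp: pz)
    hence "Im (r i) = 0 \<and> Re (r i) \<le> 0" using p by (simp add: nonpos_real_roots_def)
    moreover have "r i \<noteq> 0" using p0 that by (auto simp: pz)
    ultimately show ?thesis by (auto simp: complex_eq_iff)
  qed
  define x where "x i = - 1 / Re (r i)" for i
  have x: "x i > 0" if "i < n" for i using rr[OF that] by (simp add: x_def)
  have xr: "of_real (x i) = - 1 / r i" if "i < n" for i
    using rr[OF that] by (simp add: x_def complex_eq_iff Re_divide Im_divide power2_eq_square)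
  have factor: "z - r i = - r i * (1 + of_real (x i) * z)" if "i < n" for i z
  proof -
    have "r i \<noteq> 0" using rr[OF that] by force
    thus ?thesis by (simp add: xr[OF that] field_simps)
  qed
  define c where "c = lead_coeff p * (\<Prod>i<n. - r i)"
  have "poly p z = c * (\<Prod>i<n. 1 + of_real (x i) * z)" for z
  proof -
    have "(\<Prod>i<n. z - r i) = (\<Prod>i<n. - r i * (1 + of_real (x i) * z))"
      by (rule prod.cong) (use factor in auto)
    thus ?thesis
      unfolding pz c_def by (simp only: prod.distrib mult.assoc)
  qed
  hence "poly p = poly (smult c (\<Prod>i<n. [:1, of_real (x i):]))"
    by (intro ext) (simp add: poly_prod mult.commute)
  hence p_eq: "p = smult c (\<Prod>i<n. [:1, of_real (x i):])"
    by (simp only: poly_eq_poly_eq_iff)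
  have eq: "coeff p k = c * esym {..<n} (\<lambda>i. of_real (x i)) k" for k
    unfolding p_eq by (simp add: coeff_prod_linear)
  have "coeff p k = coeff p 0 * of_real (esym {..<n} x k)" for k
    using eq[of k] eq[of 0] by (simp add: esym_of_real)
  thus ?thesis using x by blast
qed

text \<open>The \<open>n\<close>-th derivative still has nonpositive real roots, so its Taylor coefficients, normalised to start with 1, are
elementary symmetric functions of positive numbers.\<close>
lemma newton_identities_derivative:
  assumes p: "nonpos_real_roots p" and nz: "coeff p n \<noteq> 0"
    and g: "\<And>k. coeff p k = of_real (a k)"
  shows "\<exists>q. newton_identities (\<lambda>k. fact (n + k) / (fact n * fact k) * a (n + k) / a n) q \<and>
    moment_inequalities q"
proof -
  define P where "P = (pderiv ^^ n) p"
  have cP: "coeff P k = fact (n + k) / fact k * coeff p (n + k)" for k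
    unfolding P_def by (rule higher_pderiv_coeff)
  have "nonpos_real_roots ((pderiv ^^ l) p)" if "l \<le> n" for l
    using that
  proof (induction l)
    case (Suc l)
    have "coeff ((pderiv ^^ Suc l) p) (n - Suc l) \<noteq> 0"
      unfolding higher_pderiv_coeff using nz Suc.prems by simp
    hence "(pderiv ^^ Suc l) p \<noteq> 0" by (metis coeff_0)
    thus ?case using Suc nonpos_real_roots_pderiv by simp
  qed (use p in auto)
  hence rP: "nonpos_real_roots P" by (simp add: P_def)
  have P0: "poly P 0 \<noteq> 0" using nz by (simp add: poly_0_coeff_0 cP)
  obtain x :: "nat \<Rightarrow> real" and N where x: "\<And>i. i < N \<Longrightarrow> x i > 0"
    and c: "\<And>k. coeff P k = coeff P 0 * of_real (esym {..<N} x k)"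
    using nonpos_real_roots_factorization[OF rP P0] by auto
  have "fact (n + k) / (fact n * fact k) * a (n + k) / a n = esym {..<N} x k" for k
  proof -
    have "of_real (fact (n + k) / fact k * a (n + k)) = (of_real (fact n * a n * esym {..<N} x k) :: complex)"
      using c[of k] by (simp add: cP g)
    hence "fact (n + k) / fact k * a (n + k) = fact n * a n * esym {..<N} x k"
      by (rule of_real_eq_iff[THEN iffD1])
    moreover have "a n \<noteq> 0" using nz g by auto
    moreover have "fact (n + k) / (fact n * fact k) * a (n + k) / a n =
        fact (n + k) / fact k * a (n + k) / (fact n * a n)"
      by simp
    ultimately show ?thesis by (simp only: nonzero_mult_div_cancel_left mult_eq_0_iff fact_nonzero simp_thms)
  qed
  hence "(\<lambda>k. fact (n + k) / (fact n * fact k) * a (n + k) / a n) = esym {..<N} x" by (rule ext)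
  moreover have "moment_inequalities (\<lambda>k. \<Sum>i<N. x i ^ k)"
    by (rule moment_inequalities_power_sums) (use x in \<open>auto simp: less_imp_le\<close>)
  ultimately show ?thesis
    using newton_identities_esym[of "{..<N}" x] by auto
qed

section \<open>Power sums along successive derivatives\<close>

lemma newton_identities_1:
  assumes "newton_identities a q"
  shows "q 1 = a 1"
proof -
  have "real (Suc 0) * a (Suc 0) = (\<Sum>i\<le>0. (-1) ^ i * q (Suc i) * a (0 - i))" "a 0 = 1"
    using assms unfolding newton_identities_def by blast+
  thus ?thesis by simp
qed

text \<open>Here \<open>b\<close> is the normalised coefficient sequence of the derivative of the series with coefficients \<open>a\<close>. Eliminating the
coefficients expresses the first power sums of the derivative by those of the original series.\<close>
lemma newton_identities_shift:
  assumes N: "newton_identities a q" and N': "newton_identities b r"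
    and b: "\<And>k. b k = real (Suc k) * a (Suc k) / a 1" and a1: "a 1 > 0"
  shows "q 1 = a 1" "r 1 = q 1 - q 2 / q 1" "r 2 = q 2 - 2 * q 3 / q 1 + (q 2 / q 1)\<^sup>2"
    "r 3 = q 3 - (3 * (q 1 * q 4 - q 2 * q 3) + (q 2) ^ 3 / q 1) / (q 1)\<^sup>2"
proof -
  have a0: "a 0 = 1" "b 0 = 1"
    and Na: "real (Suc k) * a (Suc k) = (\<Sum>i\<le>k. (-1) ^ i * q (Suc i) * a (k - i))"
    and Nb: "real (Suc k) * b (Suc k) = (\<Sum>i\<le>k. (-1) ^ i * r (Suc i) * b (k - i))" for k
    using N N' by (auto simp: newton_identities_def)
  note q1 = newton_identities_1[OF N]
  have a2: "2 * a 2 = q 1 * a 1 - q 2"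
    using Na[of 1] a0 by (simp add: eval_nat_numeral)
  have a3: "3 * a 3 = q 1 * a 2 - q 2 * a 1 + q 3"
    using Na[of 2] a0 by (simp add: eval_nat_numeral)
  have a4: "4 * a 4 = q 1 * a 3 - q 2 * a 2 + q 3 * a 1 - q 4"
    using Na[of 3] a0 by (simp add: eval_nat_numeral)
  note r1 = newton_identities_1[OF N']
  have b2: "2 * b 2 = r 1 * b 1 - r 2"
    using Nb[of 1] a0 by (simp add: eval_nat_numeral)
  have b3: "3 * b 3 = r 1 * b 2 - r 2 * b 1 + r 3"
    using Nb[of 2] a0 by (simp add: eval_nat_numeral)
  have ba: "b 1 = 2 * a 2 / a 1" "b 2 = 3 * a 3 / a 1" "b 3 = 4 * a 4 / a 1"
    using b[of 1] b[of 2] b[of 3] by (simp_all add: eval_nat_numeral)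
  show "q 1 = a 1" by (rule q1)
  have nz: "q 1 \<noteq> 0" using a1 q1 by simp
  have a2': "a 2 = (q 1 * q 1 - q 2) / 2" using a2 q1 by simp
  have a3': "a 3 = (q 1 * a 2 - q 2 * q 1 + q 3) / 3" using a3 q1 by simp
  show r1': "r 1 = q 1 - q 2 / q 1"
    unfolding r1 ba a2' q1[symmetric] using nz by (simp add: field_simps del: One_nat_def)
  have b2': "b 2 = (q 1 ^ 2 - 3 * q 2) / 2 + q 3 / q 1"
    unfolding ba a3' a2' q1[symmetric] using nz
    by (simp add: field_simps power2_eq_square del: One_nat_def)
  have "r 2 = r 1 * r 1 - 2 * b 2" using b2 r1 by simp
  also have "\<dots> = q 2 - 2 * q 3 / q 1 + (q 2 / q 1)\<^sup>2"
    unfolding r1' b2' using nz by (simp add: field_simps power2_eq_square)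
  finally show r2': "r 2 = q 2 - 2 * q 3 / q 1 + (q 2 / q 1)\<^sup>2" .
  have b3': "b 3 = (q 1 * a 3 - q 2 * a 2 + q 3 * q 1 - q 4) / q 1"
    using a4 q1 by (simp add: ba)
  have "r 3 = 3 * b 3 - r 1 * b 2 + r 2 * r 1" using b3 r1 by simp
  also have "\<dots> = q 3 - (3 * (q 1 * q 4 - q 2 * q 3) + (q 2) ^ 3 / q 1) / (q 1)\<^sup>2"
    unfolding r1' r2' b3' b2' a3' a2' using nz
    by (simp add: field_simps) (simp add: algebra_simps eval_nat_numeral)
  finally show "r 3 = q 3 - (3 * (q 1 * q 4 - q 2 * q 3) + (q 2) ^ 3 / q 1) / (q 1)\<^sup>2" .
qed

text \<open>In the application \<open>g n\<close> is, up to sign and a constant, the \<open>n\<close>-th derivative of \<open>F\<close> at 0, and \<open>p n k\<close> is the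
sum of the \<open>k\<close>-th powers of the reciprocal zeros of that derivative. The number \<open>m\<close> is the order of the zero of \<open>F\<close> at
the origin; before it the derivatives vanish.\<close>
locale root_power_sums =
  fixes g :: "nat \<Rightarrow> real" and p :: "nat \<Rightarrow> nat \<Rightarrow> real" and m :: nat
  assumes g_pos: "n \<ge> m \<Longrightarrow> g n > 0"
    and newton: "n \<ge> m \<Longrightarrow> newton_identities (\<lambda>k. g (n + k) / (g n * fact k)) (p n)"
    and moments: "n \<ge> m \<Longrightarrow> moment_inequalities (p n)"
begin

definition h :: "nat \<Rightarrow> real" where "h n = g (Suc n) / g n"

lemma h_pos: "n \<ge> m \<Longrightarrow> h n > 0"
  by (simp add: h_def g_pos)

lemma p_nonneg: "n \<ge> m \<Longrightarrow> k > 0 \<Longrightarrow> p n k \<ge> 0"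
  using moments[of n] by (auto simp: moment_inequalities_def)

lemma Suc_relations:
  assumes n: "n \<ge> m"
  shows "p n 1 = h n" "h (Suc n) = h n - p n 2 / h n"
    "p (Suc n) 2 = p n 2 - 2 * p n 3 / h n + (p n 2 / h n)\<^sup>2"
    "p (Suc n) 3 = p n 3 - (3 * (h n * p n 4 - p n 2 * p n 3) + (p n 2) ^ 3 / h n) / (h n)\<^sup>2"
proof -
  let ?a = "\<lambda>k. g (n + k) / (g n * fact k)" and ?b = "\<lambda>k. g (Suc n + k) / (g (Suc n) * fact k)"
  have b: "?b k = real (Suc k) * ?a (Suc k) / ?a 1" for k
    using g_pos[of n] g_pos[of "Suc n"] n by (simp add: field_simps del: of_nat_Suc)
  have a1: "?a 1 > 0" using g_pos[of n] g_pos[of "Suc n"] n by simp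
  have n': "Suc n \<ge> m" using n by simp
  note * = newton_identities_shift[OF newton[OF n] newton[OF n'] b a1]
  show p1: "p n 1 = h n" using *(1) by (simp add: h_def)
  have "p (Suc n) 1 = h (Suc n)"
    using newton_identities_1[OF newton[OF n']] by (simp add: h_def)
  thus "h (Suc n) = h n - p n 2 / h n"
    using *(2) p1 by simp
  show "p (Suc n) 2 = p n 2 - 2 * p n 3 / h n + (p n 2 / h n)\<^sup>2"
    using *(3) p1 by simp
  show "p (Suc n) 3 = p n 3 - (3 * (h n * p n 4 - p n 2 * p n 3) + (p n 2) ^ 3 / h n) / (h n)\<^sup>2"
    using *(4) p1 by simp
qed

lemma p_2_eq: "n \<ge> m \<Longrightarrow> p n 2 = h n * (h n - h (Suc n))"
  using Suc_relations(2)[of n] h_pos[of n] by (simp add: field_simps)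

lemma h_Suc_le: "n \<ge> m \<Longrightarrow> h (Suc n) \<le> h n"
  using Suc_relations(2)[of n] h_pos[of n] p_nonneg[of n 2] by simp

text \<open>The power sums of the derivative differ from the old ones by \<open>2 * p\<^sub>3/p\<^sub>1 - (p\<^sub>2/p\<^sub>1)\<^sup>2\<close>, and \<open>p\<^sub>2\<^sup>2 \<le> p\<^sub>1 * p\<^sub>3\<close>.
Hence \<open>p\<^sub>3\<close> is controlled by a difference that telescopes.\<close>
lemma p_3_le: "n \<ge> m \<Longrightarrow> p n 3 \<le> h n * (p n 2 - p (Suc n) 2)"
proof -
  assume n: "n \<ge> m"
  have "p n 2 ^ 2 \<le> h n * p n 3"
    using moments[OF n] Suc_relations(1)[OF n] by (simp add: moment_inequalities_def)
  hence "(p n 2 / h n)\<^sup>2 \<le> p n 3 / h n"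
    using h_pos[OF n] by (simp add: field_simps power2_eq_square)
  hence "p n 3 / h n \<le> p n 2 - p (Suc n) 2"
    using Suc_relations(3)[OF n] by simp
  thus ?thesis using h_pos[OF n] by (simp add: field_simps)
qed

lemma p_2_Suc_le: "n \<ge> m \<Longrightarrow> p (Suc n) 2 \<le> p n 2"
  using p_3_le[of n] p_nonneg[of n 3] h_pos[of n] by (smt (verit) mult_pos_neg zero_less_numeral)

text \<open>Geometrically the zeros move outwards under differentiation; algebraically this is the inequality \<open>p\<^sub>2 * p\<^sub>3 \<le> p\<^sub>1 * p\<^sub>4\<close>.\<close>
lemma p_3_Suc_le: "n \<ge> m \<Longrightarrow> p (Suc n) 3 \<le> p n 3"
proof -
  assume n: "n \<ge> m"
  have "p n 2 * p n 3 \<le> h n * p n 4"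
    using moments[OF n] Suc_relations(1)[OF n] by (simp add: moment_inequalities_def)
  thus ?thesis
    using Suc_relations(4)[OF n] h_pos[OF n] p_nonneg[OF n, of 2] by simp
qed

lemma decreasing_from:
  assumes "\<And>n. n \<ge> m \<Longrightarrow> u (Suc n) \<le> (u n :: real)" "m \<le> a" "a \<le> b"
  shows "u b \<le> u a"
  using assms(3)
proof (induction b rule: dec_induct)
  case (step n)
  have "u (Suc n) \<le> u n" using step.hyps assms(2) by (intro assms(1)) simp
  thus ?case using step.IH by simp
qed simp

lemmas h_antimono = decreasing_from[of h, OF h_Suc_le]
lemmas p_2_antimono = decreasing_from[of "\<lambda>n. p n 2", OF p_2_Suc_le]
lemmas p_3_antimono = decreasing_from[of "\<lambda>n. p n 3", OF p_3_Suc_le]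

text \<open>Monotonicity turns an average over a block of indices into a bound at the end of the block, and the average
telescopes. The next two lemmas use the same device.\<close>
lemma p_2_upper:
  assumes "m \<le> a" "a \<le> b"
  shows "real (b - a) * p b 2 \<le> (h a)\<^sup>2"
proof -
  have "real (b - a) * p b 2 = (\<Sum>n=a..<b. p b 2)" by simp
  also have "\<dots> \<le> (\<Sum>n=a..<b. h a * (h n - h (Suc n)))"
  proof (rule sum_mono)
    fix n assume n: "n \<in> {a..<b}"
    have "p b 2 \<le> p n 2" using n assms by (intro p_2_antimono) auto
    also have "\<dots> = h n * (h n - h (Suc n))" using n assms by (intro p_2_eq) auto
    also have "\<dots> \<le> h a * (h n - h (Suc n))"
      using n assms h_Suc_le[of n] by (intro mult_right_mono h_antimono) auto
    finally show "p b 2 \<le> h a * (h n - h (Suc n))" .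
  qed
  also have "\<dots> = h a * (h a - h b)"
    using sum_Suc_diff'[OF assms(2), of "\<lambda>n. - h n"] by (simp add: sum_distrib_left[symmetric])
  also have "\<dots> \<le> h a * h a"
    using assms h_pos[of a] h_pos[of b] by (intro mult_left_mono) auto
  finally show ?thesis by (simp add: power2_eq_square)
qed

lemma p_2_lower:
  assumes "m \<le> a" "a \<le> b"
  shows "h b * (h a - h b) \<le> real (b - a) * p a 2"
proof -
  have "h b * (h a - h b) = (\<Sum>n=a..<b. h b * (h n - h (Suc n)))"
    using sum_Suc_diff'[OF assms(2), of "\<lambda>n. - h n"] by (simp add: sum_distrib_left[symmetric])
  also have "\<dots> \<le> (\<Sum>n=a..<b. p a 2)"
  proof (rule sum_mono)
    fix n assume n: "n \<in> {a..<b}"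
    have "h b * (h n - h (Suc n)) \<le> h n * (h n - h (Suc n))"
      using n assms h_Suc_le[of n] by (intro mult_right_mono h_antimono) auto
    also have "\<dots> = p n 2" using n assms by (intro p_2_eq[symmetric]) auto
    also have "\<dots> \<le> p a 2" using n assms by (intro p_2_antimono) auto
    finally show "h b * (h n - h (Suc n)) \<le> p a 2" .
  qed
  finally show ?thesis by simp
qed

lemma p_3_upper:
  assumes "m \<le> a" "a \<le> b"
  shows "real (b - a) * p b 3 \<le> h a * p a 2"
proof -
  have "real (b - a) * p b 3 = (\<Sum>n=a..<b. p b 3)" by simp
  also have "\<dots> \<le> (\<Sum>n=a..<b. h a * (p n 2 - p (Suc n) 2))"
  proof (rule sum_mono)
    fix n assume n: "n \<in> {a..<b}"
    have "p b 3 \<le> p n 3" using n assms by (intro p_3_antimono) auto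
    also have "\<dots> \<le> h n * (p n 2 - p (Suc n) 2)" using n assms by (intro p_3_le) auto
    also have "\<dots> \<le> h a * (p n 2 - p (Suc n) 2)"
      using n assms p_2_Suc_le[of n] by (intro mult_right_mono h_antimono) auto
    finally show "p b 3 \<le> h a * (p n 2 - p (Suc n) 2)" .
  qed
  also have "\<dots> = h a * (p a 2 - p b 2)"
    using sum_Suc_diff'[OF assms(2), of "\<lambda>n. - p n 2"] by (simp add: sum_distrib_left[symmetric])
  also have "\<dots> \<le> h a * p a 2"
    using assms h_pos[of a] p_nonneg[of b 2] by (intro mult_left_mono) auto
  finally show ?thesis .
qed

text \<open>Let \<open>\<rho> i = N i / 4^i\<close>. The hypotheses say that \<open>h\<close> has size \<open>\<rho> i\<close> near the index \<open>\<nu> i = 2 * N i + 2 * m\<close>. Telescoping over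
blocks between such indices yields \<open>p\<^sub>2\<close> of exact size \<open>(\<rho> i)\<^sup>2 / N i\<close> and \<open>p\<^sub>3 \<le> const * (\<rho> i)^3 / (N i)\<^sup>2\<close>. The
condition \<open>\<beta>\<^sub>2 < 4\<close> makes \<open>\<rho>\<close> decay geometrically, so that \<open>h\<close> really drops over a bounded number of blocks; this is
what bounds \<open>p\<^sub>2\<close> from below.\<close>
lemma p_3_over_p_2_tendsto_0:
  fixes N :: "nat \<Rightarrow> nat" and \<beta>\<^sub>1 \<beta>\<^sub>2 c C :: real
  assumes \<beta>: "1 < \<beta>\<^sub>1" "\<beta>\<^sub>2 < 4" and c: "c > 0"
    and growth: "\<And>i. \<beta>\<^sub>1 * N i \<le> N (Suc i)" "\<And>i. N (Suc i) \<le> \<beta>\<^sub>2 * N i"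
    and N0: "N 0 > 0" "2 * m \<le> N 0"
    and lower: "\<And>i n. m \<le> n \<Longrightarrow> n \<le> N i + m \<Longrightarrow> c * (N i / 4 ^ i) \<le> h n"
    and upper: "\<And>i n. n \<ge> 2 * N i + 2 * m \<Longrightarrow> h n \<le> C * (N i / 4 ^ i)"
  shows "(\<lambda>n. (p n 3)\<^sup>2 / (p n 2) ^ 3) \<longlonglongrightarrow> 0" "\<forall>\<^sub>F n in sequentially. p n 2 > 0"
proof -
  define \<rho> where "\<rho> i = N i / 4 ^ i" for i
  define \<nu> where "\<nu> i = 2 * N i + 2 * m" for i
  have N_le_Suc: "N i \<le> N (Suc i)" for i
  proof -
    have "1 * real (N i) \<le> \<beta>\<^sub>1 * N i" using \<beta> by (intro mult_right_mono) auto
    thus ?thesis using growth(1)[of i] by linarith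
  qed
  have N_mono: "N i \<le> N j" if "i \<le> j" for i j
    using that N_le_Suc by (rule lift_Suc_mono_le[rotated])
  have N_pos: "N i > 0" for i using N_mono[of 0 i] N0 by simp
  have m_le: "2 * m \<le> N i" for i using N_mono[of 0 i] N0 by simp
  have \<rho>_pos: "\<rho> i > 0" for i using N_pos by (simp add: \<rho>_def)
  have \<beta>1_pow: "\<beta>\<^sub>1 ^ s * N i \<le> N (i + s)" for i s
  proof (induction s)
    case (Suc s)
    have "\<beta>\<^sub>1 * (\<beta>\<^sub>1 ^ s * N i) \<le> \<beta>\<^sub>1 * N (i + s)"
      using \<beta> Suc by (intro mult_left_mono) auto
    thus ?case using growth(1)[of "i + s"] by (simp add: mult.assoc)
  qed simp
  have \<beta>2_pos: "\<beta>\<^sub>2 > 0"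
  proof (rule ccontr)
    assume "\<not> \<beta>\<^sub>2 > 0"
    hence "\<beta>\<^sub>2 * N 0 \<le> 0" by (simp add: mult_nonpos_nonneg)
    thus False using growth(2)[of 0] N_pos[of 1] by simp
  qed
  have \<beta>2_pow: "N (i + s) \<le> \<beta>\<^sub>2 ^ s * N i" for i s
  proof (induction s)
    case (Suc s)
    have "\<beta>\<^sub>2 * N (i + s) \<le> \<beta>\<^sub>2 * (\<beta>\<^sub>2 ^ s * N i)"
      using \<beta>2_pos Suc by (intro mult_left_mono) auto
    thus ?case using growth(2)[of "i + s"] by (simp add: mult.assoc)
  qed simp
  have N_le: "real (N (i + s)) \<le> 4 ^ s * real (N i)" for i s
  proof -
    have "\<beta>\<^sub>2 ^ s \<le> 4 ^ s" using \<beta> \<beta>2_pos by (intro power_mono) auto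
    hence "\<beta>\<^sub>2 ^ s * N i \<le> 4 ^ s * real (N i)" by (intro mult_right_mono) auto
    thus ?thesis using \<beta>2_pow[of i s] by linarith
  qed
  have \<rho>_upper: "\<rho> (i + s) \<le> (\<beta>\<^sub>2 / 4) ^ s * \<rho> i" for i s
    using \<beta>2_pow[of i s] by (simp add: \<rho>_def field_simps power_add)
  have \<rho>_antimono: "\<rho> (i + s) \<le> \<rho> i" for i s
    using N_le[of i s] by (simp add: \<rho>_def field_simps power_add)
  have \<rho>_lower: "\<rho> i / 4 ^ s \<le> \<rho> (i + s)" for i s
    using N_mono[of i "i + s"] by (simp add: \<rho>_def field_simps power_add)
  have \<nu>_ge: "m \<le> \<nu> i" for i by (simp add: \<nu>_def)
  have \<nu>_mono: "\<nu> i \<le> \<nu> j" if "i \<le> j" for i j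
    using N_mono[OF that] by (simp add: \<nu>_def)
  have up: "h (\<nu> i) \<le> C * \<rho> i" for i
    using upper[of i "\<nu> i"] by (simp add: \<nu>_def \<rho>_def)
  have C_pos: "C > 0"
  proof -
    have "0 < C * \<rho> 0" using up[of 0] h_pos[OF \<nu>_ge[of 0]] by simp
    thus ?thesis using \<rho>_pos[of 0] by (simp add: zero_less_mult_iff)
  qed
  \<comment> \<open>\<open>s\<close> levels multiply the count by 3, so that \<open>N (i + s) + m\<close> reaches \<open>\<nu> i\<close>\<close>
  obtain s where s: "\<beta>\<^sub>1 ^ s > 3" using \<beta>(1) real_arch_pow by blast
  define c2 where "c2 = c / 4 ^ s"
  have c2: "c2 > 0" using c by (simp add: c2_def)
  have low: "c2 * \<rho> i \<le> h (\<nu> i)" for i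
  proof -
    have "3 * real (N i) \<le> N (i + s)"
    proof -
      have "3 * real (N i) \<le> \<beta>\<^sub>1 ^ s * N i" using s by (intro mult_right_mono) auto
      thus ?thesis using \<beta>1_pow[of s i] by linarith
    qed
    hence "3 * N i \<le> N (i + s)" by linarith
    hence "\<nu> i \<le> N (i + s) + m" using m_le[of i] by (simp add: \<nu>_def)
    hence "c * \<rho> (i + s) \<le> h (\<nu> i)"
      using lower[of "\<nu> i" "i + s"] \<nu>_ge by (simp add: \<rho>_def)
    moreover have "c * (\<rho> i / 4 ^ s) \<le> c * \<rho> (i + s)"
      using c \<rho>_lower by (intro mult_left_mono) auto
    ultimately show ?thesis by (simp add: c2_def)
  qed
  \<comment> \<open>after \<open>t\<close> further levels the upper bound for \<open>h\<close> is at most half of the lower bound at level \<open>i\<close>\<close>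
  have "(\<lambda>t. (\<beta>\<^sub>2 / 4) ^ t) \<longlonglongrightarrow> 0"
    using \<beta> \<beta>2_pos by (intro LIMSEQ_realpow_zero) auto
  hence "\<forall>\<^sub>F t in sequentially. (\<beta>\<^sub>2 / 4) ^ t < c2 / (2 * C)"
    using c2 C_pos by (intro order_tendstoD) auto
  then obtain t where t: "(\<beta>\<^sub>2 / 4) ^ t < c2 / (2 * C)"
    using eventually_sequentially by auto
  define c3 where "c3 = c2\<^sup>2 / (6 * 16 ^ t)"
  have c3: "c3 > 0" using c2 by (simp add: c3_def)
  have low2: "c3 * ((\<rho> i)\<^sup>2 / N i) \<le> p (\<nu> i) 2" for i
  proof -
    have "C * \<rho> (i + t) \<le> C * ((\<beta>\<^sub>2 / 4) ^ t * \<rho> i)"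
      using C_pos \<rho>_upper by (intro mult_left_mono) auto
    also have "\<dots> \<le> C * (c2 / (2 * C) * \<rho> i)"
      using C_pos t \<rho>_pos[of i] by (intro mult_left_mono mult_right_mono) auto
    finally have *: "h (\<nu> (i + t)) \<le> c2 / 2 * \<rho> i"
      using up[of "i + t"] C_pos by simp
    have "c2 * (\<rho> i / 4 ^ t) \<le> c2 * \<rho> (i + t)"
      using c2 \<rho>_lower by (intro mult_left_mono) auto
    hence **: "c2 / 4 ^ t * \<rho> i \<le> h (\<nu> (i + t))"
      using low[of "i + t"] by simp
    have "(c2 / 4 ^ t * \<rho> i) * (c2 / 2 * \<rho> i) \<le> h (\<nu> (i + t)) * (h (\<nu> i) - h (\<nu> (i + t)))"
      using * ** low[of i] c2 \<rho>_pos[of i] h_pos[OF \<nu>_ge[of "i + t"]]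
      by (intro mult_mono) auto
    also have "\<dots> \<le> real (\<nu> (i + t) - \<nu> i) * p (\<nu> i) 2"
      by (intro p_2_lower \<nu>_ge \<nu>_mono) simp
    also have "\<dots> \<le> (3 * 4 ^ t * real (N i)) * p (\<nu> i) 2"
    proof (intro mult_right_mono p_nonneg \<nu>_ge)
      have "\<nu> (i + t) - \<nu> i \<le> 3 * N (i + t)" using m_le[of "i + t"] by (simp add: \<nu>_def)
      hence "real (\<nu> (i + t) - \<nu> i) \<le> 3 * N (i + t)" by linarith
      thus "real (\<nu> (i + t) - \<nu> i) \<le> 3 * 4 ^ t * real (N i)" using N_le[of i t] by simp
    qed simp
    finally have "c2\<^sup>2 * (\<rho> i)\<^sup>2 \<le> 6 * (4 ^ t * 4 ^ t) * N i * p (\<nu> i) 2"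
      by (simp add: field_simps power2_eq_square)
    moreover have "(4 ^ t * 4 ^ t :: real) = 16 ^ t" by (simp flip: power_mult_distrib)
    ultimately have "c2\<^sup>2 * (\<rho> i)\<^sup>2 \<le> 6 * 16 ^ t * N i * p (\<nu> i) 2" by simp
    thus ?thesis using N_pos[of i] by (simp add: c3_def field_simps)
  qed
  have \<nu>_diff: "2 * (\<beta>\<^sub>1 - 1) * N i \<le> real (\<nu> (Suc i) - \<nu> i)" for i
    using growth(1)[of i] N_le_Suc[of i] by (simp add: \<nu>_def algebra_simps of_nat_diff)
  define C2 where "C2 = C\<^sup>2 / (2 * (\<beta>\<^sub>1 - 1))"
  have C2: "C2 > 0" using C_pos \<beta> by (simp add: C2_def)
  have up2: "p (\<nu> (Suc i)) 2 \<le> C2 * ((\<rho> i)\<^sup>2 / N i)" for i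
  proof -
    have "2 * (\<beta>\<^sub>1 - 1) * N i * p (\<nu> (Suc i)) 2 \<le> real (\<nu> (Suc i) - \<nu> i) * p (\<nu> (Suc i)) 2"
      by (intro mult_right_mono p_nonneg \<nu>_ge \<nu>_diff) simp
    also have "\<dots> \<le> (h (\<nu> i))\<^sup>2"
      by (intro p_2_upper \<nu>_ge \<nu>_mono) simp
    also have "\<dots> \<le> (C * \<rho> i)\<^sup>2"
      using up h_pos[OF \<nu>_ge[of i]] by (intro power_mono) auto
    finally show ?thesis using N_pos[of i] \<beta>
      by (simp add: C2_def field_simps power2_eq_square)
  qed
  define C3 where "C3 = C * C2 / (2 * (\<beta>\<^sub>1 - 1))"
  have C3: "C3 > 0" using C_pos C2 \<beta> by (simp add: C3_def)
  have up3: "p (\<nu> (Suc (Suc i))) 3 \<le> C3 * ((\<rho> i) ^ 3 / (real (N i))\<^sup>2)" for i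
  proof -
    have "2 * (\<beta>\<^sub>1 - 1) * N i * p (\<nu> (Suc (Suc i))) 3
        \<le> 2 * (\<beta>\<^sub>1 - 1) * N (Suc i) * p (\<nu> (Suc (Suc i))) 3"
      using \<beta> N_le_Suc[of i] by (intro mult_right_mono mult_left_mono p_nonneg \<nu>_ge) auto
    also have "\<dots> \<le> real (\<nu> (Suc (Suc i)) - \<nu> (Suc i)) * p (\<nu> (Suc (Suc i))) 3"
      by (intro mult_right_mono p_nonneg \<nu>_ge \<nu>_diff) simp
    also have "\<dots> \<le> h (\<nu> (Suc i)) * p (\<nu> (Suc i)) 2"
      by (intro p_3_upper \<nu>_ge \<nu>_mono) simp
    also have "\<dots> \<le> (C * \<rho> i) * (C2 * ((\<rho> i)\<^sup>2 / N i))"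
    proof (intro mult_mono up2 p_nonneg \<nu>_ge)
      have "C * \<rho> (Suc i) \<le> C * \<rho> i"
        using C_pos \<rho>_antimono[of i 1] by (intro mult_left_mono) auto
      thus "h (\<nu> (Suc i)) \<le> C * \<rho> i" using up[of "Suc i"] by simp
    qed (use C_pos \<rho>_pos[of i] in auto)
    finally show ?thesis using N_pos[of i] \<beta>
      by (simp add: C3_def field_simps power2_eq_square power3_eq_cube)
  qed
  define c4 where "c4 = c3 / 4 ^ 9"
  have c4: "c4 > 0" using c3 by (simp add: c4_def)
  have block: "p n 2 > 0 \<and> (p n 3)\<^sup>2 / (p n 2) ^ 3 \<le> C3\<^sup>2 / c4 ^ 3 / N i"
    if n: "\<nu> (i + 2) \<le> n" "n \<le> \<nu> (i + 3)" for n i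
  proof -
    have mn: "m \<le> n" using n \<nu>_ge le_trans by blast
    have "\<rho> i / 4 ^ 3 \<le> \<rho> (i + 3)" by (rule \<rho>_lower)
    hence "(\<rho> i / 4 ^ 3)\<^sup>2 \<le> (\<rho> (i + 3))\<^sup>2" using \<rho>_pos[of i] by (intro power_mono) auto
    hence "(\<rho> i / 4 ^ 3)\<^sup>2 / (4 ^ 3 * N i) \<le> (\<rho> (i + 3))\<^sup>2 / N (i + 3)"
      using N_le[of i 3] N_pos[of "i + 3"] by (intro frac_le) auto
    hence "c3 * ((\<rho> i / 4 ^ 3)\<^sup>2 / (4 ^ 3 * N i)) \<le> c3 * ((\<rho> (i + 3))\<^sup>2 / N (i + 3))"
      using c3 by (intro mult_left_mono) auto
    also have "\<dots> \<le> p (\<nu> (i + 3)) 2" by (rule low2)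
    also have "\<dots> \<le> p n 2" using mn n by (intro p_2_antimono)
    finally have p2: "c4 * ((\<rho> i)\<^sup>2 / N i) \<le> p n 2"
      by (simp add: c4_def power2_eq_square field_simps)
    have pos: "0 < c4 * ((\<rho> i)\<^sup>2 / N i)" using c4 \<rho>_pos[of i] N_pos[of i] by simp
    have "p n 3 \<le> p (\<nu> (i + 2)) 3" using n \<nu>_ge by (intro p_3_antimono)
    also have "\<dots> \<le> C3 * ((\<rho> i) ^ 3 / (real (N i))\<^sup>2)" using up3[of i] by simp
    finally have p3: "p n 3 \<le> C3 * ((\<rho> i) ^ 3 / (real (N i))\<^sup>2)" .
    have "(p n 3)\<^sup>2 / (p n 2) ^ 3 \<le>
        (C3 * ((\<rho> i) ^ 3 / (real (N i))\<^sup>2))\<^sup>2 / (c4 * ((\<rho> i)\<^sup>2 / N i)) ^ 3"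
      using p2 p3 pos p_nonneg[OF mn] by (intro frac_le power_mono zero_less_power) auto
    also have "\<dots> = C3\<^sup>2 / c4 ^ 3 / N i"
      using \<rho>_pos[of i] N_pos[of i] c4
      by (simp add: field_simps power2_eq_square power3_eq_cube)
    finally show ?thesis using p2 pos by linarith
  qed
  have N_at_top: "filterlim (\<lambda>i. real (N i)) at_top sequentially"
  proof (rule filterlim_at_top_mono)
    show "filterlim (\<lambda>i. real i) at_top sequentially" by (rule filterlim_real_sequentially)
    have "i \<le> N i" for i
    proof (induction i)
      case (Suc i)
      have "1 * real (N i) < \<beta>\<^sub>1 * N i" using \<beta> N_pos by (intro mult_strict_right_mono) auto
      hence "N i < N (Suc i)" using growth(1)[of i] by linarith
      thus ?case using Suc by simp
    qed simp
    thus "\<forall>\<^sub>F i in sequentially. real i \<le> real (N i)" by simp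
  qed
  \<comment> \<open>every large index lies between two consecutive values of \<open>\<nu>\<close>\<close>
  have cover: "\<exists>i\<ge>I. \<nu> (i + 2) \<le> n \<and> n \<le> \<nu> (i + 3)" if "n \<ge> \<nu> (I + 2)" for n I
  proof -
    have "\<forall>\<^sub>F i in sequentially. real n \<le> real (N i)"
      using N_at_top unfolding filterlim_at_top by blast
    then obtain j where j: "\<And>i. i \<ge> j \<Longrightarrow> n \<le> N i"
      unfolding eventually_sequentially of_nat_le_iff by blast
    let ?P = "\<lambda>i. I \<le> i \<and> n \<le> \<nu> (i + 3)"
    define i where "i = (LEAST i. ?P i)"
    have "n \<le> N (max I j + 3)" by (rule j) simp
    hence "?P (max I j)" by (simp add: \<nu>_def)
    hence i: "?P i" unfolding i_def by (rule LeastI)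
    have "\<nu> (i + 2) \<le> n"
    proof (cases "i = I")
      case False
      hence "I \<le> i - 1" "i - 1 < i" using i by auto
      hence "\<not> ?P (i - 1)" unfolding i_def using not_less_Least by blast
      hence "\<nu> (i - 1 + 3) < n" using \<open>I \<le> i - 1\<close> by simp
      moreover have "i - 1 + 3 = i + 2" using \<open>i - 1 < i\<close> by simp
      ultimately show ?thesis by simp
    qed (use that in simp)
    thus ?thesis using i by blast
  qed
  show "\<forall>\<^sub>F n in sequentially. p n 2 > 0"
    unfolding eventually_sequentially using cover[of 0] block by blast
  have lim: "(\<lambda>i. C3\<^sup>2 / c4 ^ 3 / N i) \<longlonglongrightarrow> 0"
    by (rule real_tendsto_divide_at_top[OF tendsto_const N_at_top])
  show "(\<lambda>n. (p n 3)\<^sup>2 / (p n 2) ^ 3) \<longlonglongrightarrow> 0"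
  proof (rule tendstoI)
    fix e :: real assume "e > 0"
    hence "\<forall>\<^sub>F i in sequentially. C3\<^sup>2 / c4 ^ 3 / N i < e"
      using lim by (intro order_tendstoD) auto
    then obtain I where I: "\<And>i. i \<ge> I \<Longrightarrow> C3\<^sup>2 / c4 ^ 3 / N i < e"
      by (auto simp: eventually_sequentially)
    have "dist ((p n 3)\<^sup>2 / (p n 2) ^ 3) 0 < e" if n: "n \<ge> \<nu> (I + 2)" for n
    proof -
      obtain i where i: "i \<ge> I" "\<nu> (i + 2) \<le> n" "n \<le> \<nu> (i + 3)" using cover[OF n] by blast
      have "(p n 3)\<^sup>2 / (p n 2) ^ 3 < e" "p n 2 > 0"
        using block[OF i(2,3)] I[OF i(1)] by auto
      thus ?thesis by simp
    qed
    thus "\<forall>\<^sub>F n in sequentially. dist ((p n 3)\<^sup>2 / (p n 2) ^ 3) 0 < e"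
      by (auto simp: eventually_sequentially)
  qed
qed

end

section \<open>Hermite polynomials as limits of Appell polynomials\<close>

text \<open>The coefficient of \<open>t^d\<close> in \<open>exp (\<zeta> * t) * (\<Sum>k. a k * (-t)^k)\<close>.\<close>
definition appell :: "(nat \<Rightarrow> real) \<Rightarrow> nat \<Rightarrow> complex \<Rightarrow> complex" where
  "appell a d \<zeta> = (\<Sum>k\<le>d. (-1) ^ k * of_real (a k) * \<zeta> ^ (d - k) / fact (d - k))"

text \<open>The logarithmic derivative of the generating function is \<open>\<zeta> - (\<Sum>i. q (i+1) * t^i)\<close> by Newton's identities.\<close>
lemma appell_Suc:
  assumes "newton_identities a q"
  shows "of_nat (Suc d) * appell a (Suc d) \<zeta> =
    (\<zeta> - of_real (q 1)) * appell a d \<zeta> - (\<Sum>i=1..d. of_real (q (Suc i)) * appell a (d - i) \<zeta>)"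
proof -
  define B where "B = (Abs_fps (\<lambda>k. (-1) ^ k * of_real (a k)) :: complex fps)"
  define P where "P = (Abs_fps (\<lambda>i. of_real (q (Suc i))) :: complex fps)"
  have dB: "fps_deriv B = - (P * B)"
  proof (rule fps_ext)
    fix k
    have "(\<Sum>i\<le>k. of_real (q (Suc i)) * ((-1) ^ (k - i) * of_real (a (k - i)))) =
        (-1) ^ k * (of_real (\<Sum>i\<le>k. (-1) ^ i * q (Suc i) * a (k - i)) :: complex)"
      unfolding of_real_sum sum_distrib_left
    proof (intro sum.cong refl)
      fix i assume "i \<in> {..k}"
      hence "(-1) ^ k = ((-1) ^ (k - i) * (-1) ^ i :: complex)"
        by (simp flip: power_add)
      moreover have "(-1) ^ i * (-1) ^ i = (1 :: complex)"
        by (simp flip: power_mult_distrib)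
      ultimately show "of_real (q (Suc i)) * ((-1) ^ (k - i) * of_real (a (k - i))) =
          (-1) ^ k * (of_real ((-1) ^ i * q (Suc i) * a (k - i)) :: complex)"
        by (simp add: mult_ac)
    qed
    also have "(\<Sum>i\<le>k. (-1) ^ i * q (Suc i) * a (k - i)) = real (Suc k) * a (Suc k)"
      using assms unfolding newton_identities_def by metis
    finally show "fps_nth (fps_deriv B) k = fps_nth (- (P * B)) k"
      by (simp add: B_def P_def fps_mult_nth atLeast0AtMost algebra_simps)
  qed
  define W where "W = B * fps_exp \<zeta>"
  have W: "fps_nth W d = appell a d \<zeta>" for d
    by (simp add: W_def B_def fps_mult_nth appell_def atLeast0AtMost)
  have "fps_deriv W = fps_const \<zeta> * W - P * W"
    unfolding W_def by (simp add: dB algebra_simps)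
  hence "fps_nth (fps_deriv W) d = \<zeta> * fps_nth W d - fps_nth (P * W) d"
    by simp
  also have "fps_nth (P * W) d = (\<Sum>i=0..d. of_real (q (Suc i)) * fps_nth W (d - i))"
    by (simp add: fps_mult_nth P_def)
  also have "(\<Sum>i=0..d. of_real (q (Suc i)) * fps_nth W (d - i)) =
      of_real (q 1) * appell a d \<zeta> + (\<Sum>i=1..d. of_real (q (Suc i)) * appell a (d - i) \<zeta>)"
    by (simp add: W sum.atLeast_Suc_atMost)
  finally show ?thesis by (simp add: W algebra_simps)
qed

text \<open>The Taylor coefficients of \<open>exp (- t\<^sup>2 / 2)\<close>.\<close>
definition hermite_moment :: "nat \<Rightarrow> real" where
  "hermite_moment k = (if even k then (-1) ^ (k div 2) / (fact (k div 2) * 2 ^ (k div 2)) else 0)"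

text \<open>The Gaussian is the limiting case in which the second power sum is 1 and all others vanish.\<close>
lemma newton_identities_hermite:
  "newton_identities hermite_moment (\<lambda>k. if k = 2 then 1 else 0)"
  unfolding newton_identities_def
proof (intro conjI allI)
  fix k
  have "real (Suc k) * hermite_moment (Suc k) = (if k = 0 then 0 else - hermite_moment (k - 1))"
  proof (cases "even k")
    case True
    thus ?thesis by (cases "k = 0") (auto simp: hermite_moment_def)
  next
    case False
    then obtain j where k: "k = 2 * j + 1" by (elim oddE)
    have "hermite_moment (Suc k) = (-1) ^ Suc j / (fact (Suc j) * 2 ^ Suc j)"
      by (simp add: hermite_moment_def k)
    moreover have "hermite_moment (k - 1) = (-1) ^ j / (fact j * 2 ^ j)"
      by (simp add: hermite_moment_def k)
    moreover have "real (Suc k) * ((-1) ^ Suc j / (fact (Suc j) * 2 ^ Suc j)) = - ((-1) ^ j / (fact j * 2 ^ j))"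
    proof -
      have "fact (Suc j) * 2 ^ Suc j = real (Suc k) * (fact j * 2 ^ j)"
        by (simp add: k algebra_simps)
      thus ?thesis by (simp del: of_nat_Suc power_Suc fact_Suc) simp
    qed
    ultimately show ?thesis using k by simp
  qed
  also have "\<dots> = (\<Sum>i\<le>k. if i = 1 then - hermite_moment (k - 1) else 0)"
    by (auto simp: sum.delta)
  also have "\<dots> = (\<Sum>i\<le>k. (-1) ^ i * (if Suc i = 2 then 1 else 0) * hermite_moment (k - i))"
    by (intro sum.cong) auto
  finally show "real (Suc k) * hermite_moment (Suc k) =
    (\<Sum>i\<le>k. (-1) ^ i * (if Suc i = 2 then 1 else 0) * hermite_moment (k - i))" .
qed (simp add: hermite_moment_def)

lemma He_eq_appell: "He d z = fact d * appell hermite_moment d z"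
proof -
  have "appell hermite_moment d z =
      (\<Sum>k | k \<le> d \<and> even k. (-1) ^ k * of_real (hermite_moment k) * z ^ (d - k) / fact (d - k))"
    unfolding appell_def by (rule sum.mono_neutral_right) (auto simp: hermite_moment_def)
  also have "\<dots> = (\<Sum>k\<le>d div 2. (-1) ^ k / (fact k * 2 ^ k) * z ^ (d - 2 * k) / fact (d - 2 * k))"
    by (rule sum.reindex_bij_witness[of _ "\<lambda>k. 2 * k" "\<lambda>k. k div 2"])
       (auto simp: hermite_moment_def elim!: evenE)
  finally show ?thesis
    unfolding He_def by (simp add: sum_distrib_left mult_ac)
qed

text \<open>Centring at the first power sum and scaling by \<open>\<sigma>\<close> turns the recursion \<open>appell_Suc\<close> into one whose coefficients
\<open>Q x k / \<sigma> x ^ k\<close> converge to those of the Gaussian; the claim follows by induction on the degree. An arbitrary filter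
is used so that the point \<open>Y\<close> may vary together with the index.\<close>
lemma appell_tendsto_He:
  fixes A Q :: "'x \<Rightarrow> nat \<Rightarrow> real" and \<sigma> :: "'x \<Rightarrow> real" and Y :: "'x \<Rightarrow> complex"
  assumes newton: "\<forall>\<^sub>F x in F. newton_identities (A x) (Q x)"
    and \<sigma>: "\<forall>\<^sub>F x in F. \<sigma> x > 0" "\<forall>\<^sub>F x in F. Q x 2 = (\<sigma> x)\<^sup>2"
    and Q: "\<And>k. k \<ge> 3 \<Longrightarrow> ((\<lambda>x. Q x k / \<sigma> x ^ k) \<longlongrightarrow> 0) F"
    and Y: "(Y \<longlongrightarrow> y) F"
  shows "((\<lambda>x. fact d * appell (A x) d (of_real (Q x 1) + of_real (\<sigma> x) * Y x) / of_real (\<sigma> x) ^ d)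
           \<longlongrightarrow> He d y) F"
proof -
  define \<omega> where "\<omega> d x = appell (A x) d (of_real (Q x 1) + of_real (\<sigma> x) * Y x) / of_real (\<sigma> x) ^ d" for d x
  have Q': "((\<lambda>x. of_real (Q x (Suc i) / \<sigma> x ^ Suc i) :: complex) \<longlongrightarrow> of_real (if Suc i = 2 then 1 else 0)) F"
    if "i \<ge> 1" for i
  proof (cases "i = 1")
    case True
    have "\<forall>\<^sub>F x in F. Q x 2 / \<sigma> x ^ 2 = 1"
      using \<sigma> by eventually_elim simp
    hence "((\<lambda>x. Q x 2 / \<sigma> x ^ 2) \<longlongrightarrow> 1) F" by (rule tendsto_eventually)
    from tendsto_of_real[OF this] have
      "((\<lambda>x. of_real (Q x 2 / \<sigma> x ^ 2) :: complex) \<longlongrightarrow> of_real 1) F" .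
    moreover have "Suc i = 2" using True by simp
    ultimately show ?thesis by (simp only: if_True simp_thms)
  qed (use that in \<open>intro tendsto_of_real, simp add: Q del: power_Suc\<close>)
  have "(\<omega> d \<longlongrightarrow> appell hermite_moment d y) F"
  proof (induction d rule: less_induct)
    case (less d)
    show ?case
    proof (cases d)
      case 0
      have "\<forall>\<^sub>F x in F. \<omega> d x = appell hermite_moment d y"
        using newton by eventually_elim
          (simp add: 0 \<omega>_def appell_def newton_identities_def hermite_moment_def)
      thus ?thesis by (rule tendsto_eventually)
    next
      case (Suc e)
      let ?R = "\<lambda>x. (Y x * \<omega> e x -
          (\<Sum>i=1..e. of_real (Q x (Suc i) / \<sigma> x ^ Suc i) * \<omega> (e - i) x)) / of_nat (Suc e)"
      have "\<forall>\<^sub>F x in F. ?R x = \<omega> d x"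
        using newton \<sigma>(1)
      proof eventually_elim
        case (elim x)
        let ?\<zeta> = "of_real (Q x 1) + of_real (\<sigma> x) * Y x" and ?s = "of_real (\<sigma> x) :: complex"
        have s: "?s \<noteq> 0" using elim by simp
        have "of_nat (Suc e) * \<omega> d x = (of_nat (Suc e) * appell (A x) (Suc e) ?\<zeta>) / ?s ^ Suc e"
          by (simp add: \<omega>_def Suc)
        also have "\<dots> = (?s * Y x * appell (A x) e ?\<zeta>) / ?s ^ Suc e -
            (\<Sum>i=1..e. of_real (Q x (Suc i)) * appell (A x) (e - i) ?\<zeta> / ?s ^ Suc e)"
          unfolding appell_Suc[OF elim(1)] by (simp add: diff_divide_distrib sum_divide_distrib)
        also have "(?s * Y x * appell (A x) e ?\<zeta>) / ?s ^ Suc e = Y x * \<omega> e x"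
          using s by (simp add: \<omega>_def)
        also have "(\<Sum>i=1..e. of_real (Q x (Suc i)) * appell (A x) (e - i) ?\<zeta> / ?s ^ Suc e) =
            (\<Sum>i=1..e. of_real (Q x (Suc i) / \<sigma> x ^ Suc i) * \<omega> (e - i) x)"
        proof (intro sum.cong refl)
          fix i assume "i \<in> {1..e}"
          hence "Suc e = Suc i + (e - i)" by simp
          hence "?s ^ Suc e = ?s ^ Suc i * ?s ^ (e - i)" by (metis power_add)
          thus "of_real (Q x (Suc i)) * appell (A x) (e - i) ?\<zeta> / ?s ^ Suc e =
              of_real (Q x (Suc i) / \<sigma> x ^ Suc i) * \<omega> (e - i) x"
            by (simp add: \<omega>_def)
        qed
        finally show ?case by (simp add: field_simps del: of_nat_Suc)
      qed
      moreover have "(?R \<longlongrightarrow> (y * appell hermite_moment e y -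
          (\<Sum>i=1..e. of_real (if Suc i = 2 then 1 else 0) * appell hermite_moment (e - i) y)) / of_nat (Suc e)) F"
        using Suc by (intro tendsto_intros Y less Q') (auto simp del: of_nat_Suc)
      moreover have "(y * appell hermite_moment e y -
          (\<Sum>i=1..e. of_real (if Suc i = 2 then 1 else 0) * appell hermite_moment (e - i) y)) / of_nat (Suc e)
          = appell hermite_moment d y"
        using appell_Suc[OF newton_identities_hermite, of e y] by (simp add: Suc field_simps del: of_nat_Suc)
      ultimately show ?thesis by (simp add: filterlim_cong)
    qed
  qed
  hence "((\<lambda>x. fact d * \<omega> d x) \<longlongrightarrow> fact d * appell hermite_moment d y) F"
    by (intro tendsto_intros)
  thus ?thesis by (simp add: \<omega>_def He_eq_appell)
qed

section \<open>Clustering zeros\<close>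

text \<open>Joint convergence in the index and the point is locally uniform convergence, so it suffices to evaluate limits along
the product filter.\<close>
lemma uniform_limit_compactI:
  fixes f :: "'n \<Rightarrow> 'a::topological_space \<Rightarrow> 'b::metric_space"
  assumes K: "compact K" and l: "\<And>w. w \<in> K \<Longrightarrow> (l \<longlongrightarrow> l w) (nhds w)"
    and lim: "\<And>w. w \<in> K \<Longrightarrow> ((\<lambda>(n, z). f n z) \<longlongrightarrow> l w) (F \<times>\<^sub>F nhds w)"
  shows "uniform_limit K f l F"
proof (rule uniform_limitI)
  fix e :: real assume e: "e > 0"
  have "\<exists>P U. eventually P F \<and> open U \<and> w \<in> U \<and> (\<forall>n z. P n \<longrightarrow> z \<in> U \<longrightarrow> dist (f n z) (l z) < e)"
    if w: "w \<in> K" for w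
  proof -
    have "\<forall>\<^sub>F (n, z) in F \<times>\<^sub>F nhds w. dist (f n z) (l w) < e / 2"
      using tendstoD[OF lim[OF w], of "e / 2"] e by (simp add: case_prod_unfold)
    then obtain P Q where PQ: "eventually P F" "eventually Q (nhds w)"
      "\<And>n z. P n \<Longrightarrow> Q z \<Longrightarrow> dist (f n z) (l w) < e / 2"
      unfolding eventually_prod_filter by auto
    have "\<forall>\<^sub>F z in nhds w. Q z \<and> dist (l z) (l w) < e / 2"
      using PQ(2) tendstoD[OF l[OF w], of "e / 2"] e by (auto simp: eventually_conj_iff)
    then obtain U where U: "open U" "w \<in> U" "\<And>z. z \<in> U \<Longrightarrow> Q z \<and> dist (l z) (l w) < e / 2"
      unfolding eventually_nhds by blast
    have "dist (f n z) (l z) < e" if "P n" "z \<in> U" for n z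
      using PQ(3)[of n z] U(3)[of z] that dist_triangle_half_l[of "f n z" "l w" e "l z"]
      by auto
    thus ?thesis using PQ(1) U(1,2) by blast
  qed
  then obtain P U where PU: "\<And>w. w \<in> K \<Longrightarrow> eventually (P w) F" "\<And>w. w \<in> K \<Longrightarrow> open (U w)"
    "\<And>w. w \<in> K \<Longrightarrow> w \<in> U w"
    "\<And>w n z. w \<in> K \<Longrightarrow> P w n \<Longrightarrow> z \<in> U w \<Longrightarrow> dist (f n z) (l z) < e"
    by metis
  obtain D where D: "D \<subseteq> K" "finite D" "K \<subseteq> (\<Union>w\<in>D. U w)"
    using compactE_image[OF K, of K U] PU(2,3) by blast
  have "\<forall>\<^sub>F n in F. \<forall>w\<in>D. P w n"
    using D PU(1) by (intro eventually_ball_finite) auto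
  thus "\<forall>\<^sub>F n in F. \<forall>z\<in>K. dist (f n z) (l z) < e"
    by eventually_elim (use D PU(4) in blast)
qed

lemma He_minus: "He d (- z) = (-1) ^ d * He d z"
proof -
  have "(- z) ^ (d - 2 * k) = (-1) ^ d * z ^ (d - 2 * k)" if "k \<le> d div 2" for k
  proof -
    have "(- 1 :: complex) ^ d = (-1) ^ (d - 2 * k + 2 * k)" using that by (intro arg_cong[where f = "power (-1)"]) auto
    also have "\<dots> = (-1) ^ (d - 2 * k)" by (simp add: power_add power_mult)
    finally show ?thesis by (subst power_minus) simp
  qed
  thus ?thesis unfolding He_def sum_distrib_left by (intro sum.cong) auto
qed

text \<open>The condition on \<open>p\<^sub>3\<^sup>2 / p\<^sub>2^3\<close> holds when many zeros have a modulus comparable to the smallest one: with \<open>M\<close> equal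
positive numbers the quotient is \<open>1/M\<close>.\<close>
locale clustering_power_sums = root_power_sums +
  assumes p_3_small: "(\<lambda>n. (p n 3)\<^sup>2 / (p n 2) ^ 3) \<longlonglongrightarrow> 0"
    and p_2_pos: "\<forall>\<^sub>F n in sequentially. p n 2 > 0"
begin

definition \<sigma> :: "nat \<Rightarrow> real" where "\<sigma> n = sqrt (p n 2)"

lemma eventually_ge_m: "\<forall>\<^sub>F n in sequentially. n \<ge> m \<and> p n 2 > 0 \<and> h n > 0"
  using eventually_ge_at_top[of m] p_2_pos by eventually_elim (simp add: h_pos)

lemma \<sigma>_sq: "n \<ge> m \<Longrightarrow> (\<sigma> n)\<^sup>2 = p n 2"
  by (simp add: \<sigma>_def p_nonneg)

text \<open>From \<open>p\<^sub>2\<^sup>2 \<le> p\<^sub>1 * p\<^sub>3\<close> one gets \<open>p\<^sub>2 / p\<^sub>1\<^sup>2 \<le> p\<^sub>3\<^sup>2 / p\<^sub>2^3\<close>.\<close>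
lemma p_2_over_h: "(\<lambda>n. p n 2 / (h n)\<^sup>2) \<longlonglongrightarrow> 0"
proof (rule tendsto_sandwich[OF _ _ tendsto_const p_3_small])
  show "\<forall>\<^sub>F n in sequentially. 0 \<le> p n 2 / (h n)\<^sup>2"
    using eventually_ge_m by eventually_elim simp
  show "\<forall>\<^sub>F n in sequentially. p n 2 / (h n)\<^sup>2 \<le> (p n 3)\<^sup>2 / (p n 2) ^ 3"
    using eventually_ge_m
  proof eventually_elim
    case (elim n)
    have "p n 2 ^ 2 \<le> h n * p n 3"
      using moments[of n] Suc_relations(1)[of n] elim by (simp add: moment_inequalities_def)
    hence "(p n 2 ^ 2) ^ 2 \<le> (h n * p n 3) ^ 2" by (intro power_mono) auto
    hence "p n 2 * p n 2 ^ 3 \<le> (p n 3)\<^sup>2 * (h n)\<^sup>2"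
      by (simp add: power2_eq_square power3_eq_cube mult_ac)
    thus ?case using elim by (simp add: divide_simps mult_ac)
  qed
qed

lemma h_Suc_ratio: "(\<lambda>n. h (Suc n) / h n) \<longlonglongrightarrow> 1"
proof -
  have "(\<lambda>n. 1 - p n 2 / (h n)\<^sup>2) \<longlonglongrightarrow> 1"
    using tendsto_diff[OF tendsto_const p_2_over_h, of 1] by simp
  moreover have "\<forall>\<^sub>F n in sequentially. 1 - p n 2 / (h n)\<^sup>2 = h (Suc n) / h n"
    using eventually_ge_m by eventually_elim (simp add: Suc_relations(2) field_simps power2_eq_square)
  ultimately show ?thesis by (rule Lim_transform_eventually)
qed

lemma p_2_Suc_ratio: "(\<lambda>n. p (Suc n) 2 / p n 2) \<longlonglongrightarrow> 1"
proof -
  have "(\<lambda>n. sqrt ((p n 3)\<^sup>2 / (p n 2) ^ 3 * (p n 2 / (h n)\<^sup>2))) \<longlonglongrightarrow> 0"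
    using tendsto_real_sqrt[OF tendsto_mult[OF p_3_small p_2_over_h]] by simp
  moreover have "\<forall>\<^sub>F n in sequentially.
      sqrt ((p n 3)\<^sup>2 / (p n 2) ^ 3 * (p n 2 / (h n)\<^sup>2)) = p n 3 / (h n * p n 2)"
    using eventually_ge_m
  proof eventually_elim
    case (elim n)
    have "(p n 3)\<^sup>2 / (p n 2) ^ 3 * (p n 2 / (h n)\<^sup>2) = (p n 3 / (h n * p n 2))\<^sup>2"
      using elim by (simp add: field_simps power2_eq_square power3_eq_cube)
    moreover have "p n 3 / (h n * p n 2) \<ge> 0" using elim p_nonneg by simp
    ultimately show ?case by (simp only: real_sqrt_abs abs_of_nonneg)
  qed
  ultimately have lim3: "(\<lambda>n. p n 3 / (h n * p n 2)) \<longlonglongrightarrow> 0"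
    by (rule Lim_transform_eventually)
  have "(\<lambda>n. 1 - 2 * (p n 3 / (h n * p n 2)) + p n 2 / (h n)\<^sup>2) \<longlonglongrightarrow> 1"
    using tendsto_add[OF tendsto_diff[OF tendsto_const tendsto_mult[OF tendsto_const lim3]] p_2_over_h, of 1 2]
    by simp
  moreover have "\<forall>\<^sub>F n in sequentially.
      1 - 2 * (p n 3 / (h n * p n 2)) + p n 2 / (h n)\<^sup>2 = p (Suc n) 2 / p n 2"
    using eventually_ge_m
    by eventually_elim (simp add: Suc_relations(3) field_simps power2_eq_square)
  ultimately show ?thesis by (rule Lim_transform_eventually)
qed

text \<open>The inequality \<open>p\<^sub>k^3 \<le> p\<^sub>3^k\<close> becomes \<open>(p\<^sub>k / \<sigma>^k)^6 \<le> (p\<^sub>3\<^sup>2 / p\<^sub>2^3)^k\<close>.\<close>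
lemma p_over_\<sigma>: assumes k: "k \<ge> 3" shows "(\<lambda>n. p n k / \<sigma> n ^ k) \<longlonglongrightarrow> 0"
proof -
  have ev: "\<forall>\<^sub>F n in sequentially. 0 \<le> (p n k / \<sigma> n ^ k) ^ 6 \<and>
      (p n k / \<sigma> n ^ k) ^ 6 \<le> ((p n 3)\<^sup>2 / (p n 2) ^ 3) ^ k"
    using eventually_ge_m
  proof eventually_elim
    case (elim n)
    have "p n k ^ 3 \<le> p n 3 ^ k" using moments[of n] elim k by (simp add: moment_inequalities_def)
    hence "(p n k ^ 3)\<^sup>2 \<le> (p n 3 ^ k)\<^sup>2" using elim p_nonneg k by (intro power_mono) auto
    hence "p n k ^ 6 \<le> (p n 3)\<^sup>2 ^ k"
      by (simp flip: power_mult add: mult.commute)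
    moreover have "(\<sigma> n ^ k) ^ 6 = ((p n 2) ^ 3) ^ k"
    proof -
      have "(\<sigma> n ^ k) ^ 6 = ((\<sigma> n)\<^sup>2 ^ 3) ^ k" by (simp flip: power_mult add: mult.commute)
      thus ?thesis using elim by (simp add: \<sigma>_sq)
    qed
    ultimately show ?case
      using elim by (auto simp: power_divide intro!: divide_right_mono)
  qed
  have "(\<lambda>n. ((p n 3)\<^sup>2 / (p n 2) ^ 3) ^ k) \<longlonglongrightarrow> 0 ^ k"
    by (intro tendsto_intros p_3_small)
  hence lim: "(\<lambda>n. ((p n 3)\<^sup>2 / (p n 2) ^ 3) ^ k) \<longlonglongrightarrow> 0" using k by (simp add: power_0_left)
  have "(\<lambda>n. (p n k / \<sigma> n ^ k) ^ 6) \<longlonglongrightarrow> 0"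
    by (rule tendsto_sandwich[OF _ _ tendsto_const lim]) (use ev in \<open>auto elim: eventually_mono\<close>)
  from tendsto_real_root[OF this, of 6]
  have "(\<lambda>n. root 6 ((p n k / \<sigma> n ^ k) ^ 6)) \<longlonglongrightarrow> 0" by simp
  moreover have "\<forall>\<^sub>F n in sequentially. root 6 ((p n k / \<sigma> n ^ k) ^ 6) = p n k / \<sigma> n ^ k"
    using eventually_ge_m
  proof eventually_elim
    case (elim n)
    thus ?case using p_nonneg[of n k] k by (intro real_root_power_cancel) (auto simp: \<sigma>_def)
  qed
  ultimately show ?thesis by (rule Lim_transform_eventually)
qed

lemma ratio_shift:
  fixes u :: "nat \<Rightarrow> real"
  assumes u: "(\<lambda>n. u (Suc n) / u n) \<longlonglongrightarrow> 1" "\<forall>\<^sub>F n in sequentially. u n > 0"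
  shows "(\<lambda>n. u (n + i) / u (n + j)) \<longlonglongrightarrow> 1"
proof -
  have *: "(\<lambda>n. u (n + i) / u n) \<longlonglongrightarrow> 1" for i
  proof (induction i)
    case 0
    have "\<forall>\<^sub>F n in sequentially. 1 = u (n + 0) / u n"
      using u(2) by eventually_elim simp
    thus ?case by (rule Lim_transform_eventually[OF tendsto_const])
  next
    case (Suc i)
    have "(\<lambda>n. u (Suc (n + i)) / u (n + i) * (u (n + i) / u n)) \<longlonglongrightarrow> 1"
      using tendsto_mult[OF LIMSEQ_ignore_initial_segment[OF u(1), of i] Suc] by simp
    moreover have "\<forall>\<^sub>F n in sequentially.
        u (Suc (n + i)) / u (n + i) * (u (n + i) / u n) = u (n + Suc i) / u n"
      using sequentially_offset[OF u(2), of i] by eventually_elim simp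
    ultimately show ?case by (rule Lim_transform_eventually)
  qed
  have "(\<lambda>n. (u (n + i) / u n) / (u (n + j) / u n)) \<longlonglongrightarrow> 1 / 1"
    by (intro tendsto_divide *) auto
  hence "(\<lambda>n. (u (n + i) / u n) / (u (n + j) / u n)) \<longlonglongrightarrow> 1" by simp
  moreover have "\<forall>\<^sub>F n in sequentially.
      (u (n + i) / u n) / (u (n + j) / u n) = u (n + i) / u (n + j)"
    using u(2) by eventually_elim simp
  ultimately show ?thesis by (rule Lim_transform_eventually)
qed

lemma h_pos': "\<forall>\<^sub>F n in sequentially. h n > 0"
  using eventually_ge_m by eventually_elim simp

lemma \<sigma>_pos: "\<forall>\<^sub>F n in sequentially. \<sigma> n > 0"
  using p_2_pos by eventually_elim (simp add: \<sigma>_def)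

lemma \<sigma>_Suc_ratio: "(\<lambda>n. \<sigma> (Suc n) / \<sigma> n) \<longlonglongrightarrow> 1"
  using tendsto_real_sqrt[OF p_2_Suc_ratio] by (simp add: \<sigma>_def real_sqrt_divide)

lemma \<sigma>_over_h: "(\<lambda>n. \<sigma> n / h n) \<longlonglongrightarrow> 0"
proof -
  have "(\<lambda>n. sqrt (p n 2 / (h n)\<^sup>2)) \<longlonglongrightarrow> 0"
    using tendsto_real_sqrt[OF p_2_over_h] by simp
  moreover have "\<forall>\<^sub>F n in sequentially. sqrt (p n 2 / (h n)\<^sup>2) = \<sigma> n / h n"
    using h_pos' by eventually_elim (simp add: \<sigma>_def real_sqrt_divide)
  ultimately show ?thesis by (rule Lim_transform_eventually)
qed

lemma h_diff_over_\<sigma>: "(\<lambda>n. (h n - h (n + j)) / \<sigma> n) \<longlonglongrightarrow> 0"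
proof (induction j)
  case (Suc j)
  have "(\<lambda>n. (h n - h (n + j)) / \<sigma> n + \<sigma> (n + j) / h (n + j) * (\<sigma> (n + j) / \<sigma> (n + 0))) \<longlonglongrightarrow> 0"
    using tendsto_add[OF Suc tendsto_mult[OF LIMSEQ_ignore_initial_segment[OF \<sigma>_over_h, of j]
      ratio_shift[OF \<sigma>_Suc_ratio \<sigma>_pos, of j 0]]] by simp
  moreover have "\<forall>\<^sub>F n in sequentially.
      (h n - h (n + j)) / \<sigma> n + \<sigma> (n + j) / h (n + j) * (\<sigma> (n + j) / \<sigma> (n + 0)) =
      (h n - h (n + Suc j)) / \<sigma> n"
    using eventually_ge_m
  proof eventually_elim
    case (elim n)
    have "h (n + Suc j) = h (n + j) - (\<sigma> (n + j))\<^sup>2 / h (n + j)"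
      using elim Suc_relations(2)[of "n + j"] \<sigma>_sq[of "n + j"] by simp
    thus ?case by (simp add: diff_divide_distrib power2_eq_square)
  qed
  ultimately show ?case by (rule Lim_transform_eventually)
qed simp

end

section \<open>Jensen polynomials\<close>

context clustering_power_sums
begin

text \<open>The quotient of the scale \<open>sqrt c\<^sub>n\<close> and the shift \<open>b\<^sub>n\<close>, so that \<open>sqrt c\<^sub>n * w + b\<^sub>n = b\<^sub>n * (1 + slope d n * w)\<close>.
Scale and shift are built from the coefficients with index \<open>n + d\<close>, \<open>n + d - 1\<close> and \<open>n + d - 2\<close>, which explains the index.\<close>
definition slope :: "nat \<Rightarrow> nat \<Rightarrow> real" where
  "slope d n = \<sigma> (n + d - 2) / h (n + d - 2)"

lemma slope_tendsto: "slope d \<longlonglongrightarrow> 0"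
  by (rule LIMSEQ_offset[where k = 2])
     (use LIMSEQ_ignore_initial_segment[OF \<sigma>_over_h, of d] in \<open>simp add: slope_def\<close>)

lemma slope_ratio: "(\<lambda>n. h n * slope d n / \<sigma> n) \<longlonglongrightarrow> 1"
proof (rule LIMSEQ_offset[where k = 2])
  have "(\<lambda>n. h (n + 2) / h (n + d) * (\<sigma> (n + d) / \<sigma> (n + 2))) \<longlonglongrightarrow> 1"
    using tendsto_mult[OF ratio_shift[OF h_Suc_ratio h_pos', of 2 d]
        ratio_shift[OF \<sigma>_Suc_ratio \<sigma>_pos, of d 2]] by simp
  thus "(\<lambda>n. h (n + 2) * slope d (n + 2) / \<sigma> (n + 2)) \<longlonglongrightarrow> 1"
    by (simp add: slope_def)
qed

lemma h_diff_back: "(\<lambda>n. (h (n + d - 1) - h n) / \<sigma> n) \<longlonglongrightarrow> 0"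
proof (rule LIMSEQ_offset[where k = 2])
  have "(\<lambda>n. ((h n - h (n + 2)) / \<sigma> n - (h n - h (n + Suc d)) / \<sigma> n) * (\<sigma> (n + 0) / \<sigma> (n + 2))) \<longlonglongrightarrow> 0"
    using tendsto_mult[OF tendsto_diff[OF h_diff_over_\<sigma>[of 2] h_diff_over_\<sigma>[of "Suc d"]]
        ratio_shift[OF \<sigma>_Suc_ratio \<sigma>_pos, of 0 2]] by simp
  moreover have "\<forall>\<^sub>F n in sequentially.
     ((h n - h (n + 2)) / \<sigma> n - (h n - h (n + Suc d)) / \<sigma> n) * (\<sigma> (n + 0) / \<sigma> (n + 2)) =
     (h (n + 2 + d - 1) - h (n + 2)) / \<sigma> (n + 2)"
    using \<sigma>_pos by eventually_elim (simp flip: diff_divide_distrib)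
  ultimately show "(\<lambda>n. (h (n + 2 + d - 1) - h (n + 2)) / \<sigma> (n + 2)) \<longlonglongrightarrow> 0"
    by (rule Lim_transform_eventually)
qed

lemma g_ratio: "(\<lambda>n. g n * h n ^ d / g (n + d)) \<longlonglongrightarrow> 1"
proof (induction d)
  case 0
  have "\<forall>\<^sub>F n in sequentially. 1 = g n * h n ^ 0 / g (n + 0)"
    using eventually_ge_at_top[of m] by eventually_elim (use g_pos in force)
  thus ?case by (rule Lim_transform_eventually[OF tendsto_const])
next
  case (Suc d)
  have "(\<lambda>n. g n * h n ^ d / g (n + d) * (h (n + 0) / h (n + d))) \<longlonglongrightarrow> 1"
    using tendsto_mult[OF Suc ratio_shift[OF h_Suc_ratio h_pos', of 0 d]] by simp
  moreover have "\<forall>\<^sub>F n in sequentially. g n * h n ^ d / g (n + d) * (h (n + 0) / h (n + d)) =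
      g n * h n ^ Suc d / g (n + Suc d)"
    using eventually_ge_at_top[of m]
  proof eventually_elim
    case (elim n)
    have "g (n + d) > 0" "g (n + Suc d) > 0" using elim by (auto intro: g_pos)
    thus ?case by (simp add: h_def[of "n + d"])
  qed
  ultimately show ?case by (rule Lim_transform_eventually)
qed

text \<open>With \<open>z = \<kappa> * w + b\<close> the Jensen polynomial is \<open>z^d\<close> times a polynomial in \<open>\<zeta> = 1/z\<close> to which \<open>appell_tendsto_He\<close>
applies. Since \<open>b\<close> and \<open>\<kappa>\<close> are formed at index \<open>n + d\<close> instead of \<open>n\<close>, one has to compare \<open>h\<close> and \<open>\<sigma>\<close> at indices of
bounded distance; this changes \<open>h\<close> by less than order \<open>\<sigma>\<close>, hence \<open>\<zeta> = h n + \<sigma> n * Y\<close> with \<open>Y\<close> tending to \<open>-w\<^sub>0\<close>. All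
remaining factors tend to 1, except for the sign \<open>(-1)^d\<close>.\<close>
lemma jensen_tendsto_He:
  fixes \<eta> :: "nat \<Rightarrow> complex" and d :: nat
  assumes \<eta>: "\<And>k. k \<ge> m \<Longrightarrow> \<eta> k = C * (-1) ^ k * of_real (g k)" and C: "C \<noteq> 0"
  defines "b \<equiv> \<lambda>n. 1 / h (n + d - 1)"
  defines "\<kappa> \<equiv> \<lambda>n. b n * slope d n"
  shows "((\<lambda>(n, w). even_jensen \<eta> d n (of_real (\<kappa> n) * w + of_real (b n)) /
            (of_real (\<kappa> n) ^ d * \<eta> (n + d))) \<longlongrightarrow> He d w\<^sub>0) (sequentially \<times>\<^sub>F nhds w\<^sub>0)"
proof -
  let ?F = "sequentially \<times>\<^sub>F nhds w\<^sub>0"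
  define a where "a n k = g (n + k) / (g n * fact k)" for n k
  define S where "S x = 1 + of_real (slope d (fst x)) * snd x" for x :: "nat \<times> complex"
  define Y where "Y x = (of_real ((h (fst x + d - 1) - h (fst x)) / \<sigma> (fst x)) -
     of_real (h (fst x) * slope d (fst x) / \<sigma> (fst x)) * snd x) / S x" for x
  define \<zeta> where "\<zeta> x = of_real (h (fst x + d - 1)) / S x" for x
  have lift: "((\<lambda>x. u (fst x)) \<longlongrightarrow> l) ?F" if "(u \<longlongrightarrow> l) sequentially" for u :: "nat \<Rightarrow> real" and l
    using that by (rule filterlim_compose) (rule filterlim_fst)
  have ev: "\<forall>\<^sub>F x in ?F. P (fst x)" if "eventually P sequentially" for P
    using that filterlim_fst by (auto simp: filterlim_iff)
  have snd: "(snd \<longlongrightarrow> w\<^sub>0) ?F" by (rule filterlim_snd)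
  have S: "(S \<longlongrightarrow> 1) ?F"
    using tendsto_add[OF tendsto_const tendsto_mult[OF tendsto_of_real[OF lift[OF slope_tendsto]] snd], of 1 d]
    unfolding S_def[abs_def] by simp
  have hback: "\<forall>\<^sub>F n in sequentially. h (n + d - 1) > 0"
  proof -
    have "\<forall>\<^sub>F n in sequentially. n \<ge> m + 1" by (rule eventually_ge_at_top)
    thus ?thesis by eventually_elim (auto intro: h_pos)
  qed
  have slope_pos: "\<forall>\<^sub>F n in sequentially. slope d n > 0"
  proof -
    obtain M where M: "\<And>n. n \<ge> M \<Longrightarrow> n \<ge> m \<and> p n 2 > 0 \<and> h n > 0"
      using eventually_ge_m unfolding eventually_sequentially by blast
    have "\<forall>\<^sub>F n in sequentially. n \<ge> M + 2" by (rule eventually_ge_at_top)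
    thus ?thesis by eventually_elim (use M in \<open>auto simp: slope_def \<sigma>_def\<close>)
  qed
  have Y: "(Y \<longlongrightarrow> - w\<^sub>0) ?F"
    using tendsto_divide[OF tendsto_diff[OF tendsto_of_real[OF lift[OF h_diff_back]]
        tendsto_mult[OF tendsto_of_real[OF lift[OF slope_ratio]] snd]] S, of d d]
    unfolding Y_def[abs_def] by simp
  have S0: "\<forall>\<^sub>F x in ?F. S x \<noteq> 0"
    using S by (rule tendsto_imp_eventually_ne) simp
  have "\<forall>\<^sub>F x in ?F. newton_identities (a (fst x)) (p (fst x))"
    by (rule ev[OF eventually_mono[OF eventually_ge_at_top[of m]]]) (use newton in \<open>simp add: a_def[abs_def]\<close>)
  moreover have "\<forall>\<^sub>F x in ?F. \<sigma> (fst x) > 0" by (rule ev[OF \<sigma>_pos])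
  moreover have "\<forall>\<^sub>F x in ?F. p (fst x) 2 = (\<sigma> (fst x))\<^sup>2"
    by (rule ev[OF eventually_mono[OF eventually_ge_at_top[of m]]]) (simp add: \<sigma>_sq)
  ultimately have lim: "((\<lambda>x. fact d * appell (a (fst x)) d
      (of_real (p (fst x) 1) + of_real (\<sigma> (fst x)) * Y x) / of_real (\<sigma> (fst x)) ^ d)
      \<longlongrightarrow> He d (- w\<^sub>0)) ?F"
    by (rule appell_tendsto_He) (use lift[OF p_over_\<sigma>] Y in auto)
  have \<zeta>_eq: "\<forall>\<^sub>F x in ?F. of_real (p (fst x) 1) + of_real (\<sigma> (fst x)) * Y x = \<zeta> x"
    using S0 ev[OF \<sigma>_pos] ev[OF eventually_ge_at_top[of m]]
  proof eventually_elim
    case (elim x)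
    have p1: "p (fst x) 1 = h (fst x)" using elim(3) by (rule Suc_relations(1))
    have aux: "s * (((u - v) / s - v * t / s * w) / D) = (u - v * (1 + t * w)) / D"
      if "s \<noteq> 0" for s t u v w D :: complex
    proof -
      have "s * ((u - v) / s - v * t / s * w) = u - v * (1 + t * w)"
        using that by (simp add: field_simps)
      thus ?thesis by (simp only: times_divide_eq_right)
    qed
    have "of_real (\<sigma> (fst x)) * Y x =
        (of_real (h (fst x + d - 1)) - of_real (h (fst x)) * S x) / S x"
      unfolding Y_def S_def of_real_divide of_real_diff of_real_mult
      by (rule aux) (use elim(2) in simp)
    thus ?case unfolding p1 using elim(1) by (simp add: \<zeta>_def diff_divide_distrib)
  qed
  have "((\<lambda>x. (-1) ^ d * (of_real (g (fst x) * h (fst x) ^ d / g (fst x + d)) /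
        of_real (h (fst x) * slope d (fst x) / \<sigma> (fst x)) ^ d) * S x ^ d *
        (fact d * appell (a (fst x)) d
      (of_real (p (fst x) 1) + of_real (\<sigma> (fst x)) * Y x) / of_real (\<sigma> (fst x)) ^ d))
      \<longlongrightarrow> (-1) ^ d * (of_real 1 / of_real 1 ^ d) * 1 ^ d * He d (- w\<^sub>0)) ?F"
    by (intro tendsto_mult tendsto_const tendsto_divide tendsto_power tendsto_of_real
        lift[OF g_ratio] lift[OF slope_ratio] S lim) auto
  also have "(-1) ^ d * (of_real 1 / of_real 1 ^ d) * 1 ^ d * He d (- w\<^sub>0) = He d w\<^sub>0"
    by (simp add: He_minus mult.assoc[symmetric] power_mult_distrib[symmetric])
  finally show ?thesis
  proof (rule Lim_transform_eventually)
    show "\<forall>\<^sub>F x in ?F. (-1) ^ d * (of_real (g (fst x) * h (fst x) ^ d / g (fst x + d)) /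
        of_real (h (fst x) * slope d (fst x) / \<sigma> (fst x)) ^ d) * S x ^ d *
        (fact d * appell (a (fst x)) d
      (of_real (p (fst x) 1) + of_real (\<sigma> (fst x)) * Y x) / of_real (\<sigma> (fst x)) ^ d) =
      (case x of (n, w) \<Rightarrow> even_jensen \<eta> d n (of_real (\<kappa> n) * w + of_real (b n)) /
            (of_real (\<kappa> n) ^ d * \<eta> (n + d)))"
      using \<zeta>_eq S0 ev[OF \<sigma>_pos] ev[OF eventually_ge_at_top[of m]] ev[OF hback] ev[OF slope_pos]
    proof eventually_elim
      case (elim x)
      obtain n w where x: "x = (n, w)" by (cases x)
      have n: "n \<ge> m" and hb: "h (n + d - 1) > 0" and sl: "slope d n > 0" and sg: "\<sigma> n > 0" and hn: "h n > 0"
        using elim x h_pos by auto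
      have gp: "g n > 0" "g (n + d) > 0" using n by (auto intro: g_pos)
      define z where "z = of_real (b n) * S x"
      have z: "of_real (\<kappa> n) * w + of_real (b n) = z"
        by (simp add: z_def \<kappa>_def S_def x algebra_simps)
      have b0: "b n > 0" using hb by (simp add: b_def)
      have z0: "z \<noteq> 0" using b0 elim(2) by (simp add: z_def)
      have \<zeta>z: "\<zeta> x = 1 / z" using hb by (simp add: \<zeta>_def z_def b_def x)
      have "even_jensen \<eta> d n z = (\<Sum>k\<le>d. C * (-1) ^ n * of_real (g n) * z ^ d * fact d *
          ((-1) ^ k * of_real (a n k) * \<zeta> x ^ (d - k) / fact (d - k)))"
        unfolding even_jensen_def
      proof (intro sum.cong refl)
        fix k assume "k \<in> {..d}"
        hence k: "k \<le> d" by simp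
        have "z ^ d * \<zeta> x ^ (d - k) = z ^ k"
        proof -
          have "z ^ d = z ^ k * z ^ (d - k)" using k by (simp flip: power_add)
          thus ?thesis using z0 by (simp add: \<zeta>z power_divide)
        qed
        moreover have "of_nat (d choose k) = (fact d / (fact k * fact (d - k)) :: complex)"
          using k by (rule binomial_fact)
        moreover have "\<eta> (k + n) = C * ((-1) ^ k * (-1) ^ n) * (of_real (g n) * of_real (a n k) * fact k)"
          using n gp by (subst \<eta>) (auto simp: a_def power_add add.commute)
        ultimately show "of_nat (d choose k) * \<eta> (k + n) * z ^ k = C * (-1) ^ n * of_real (g n) * z ^ d * fact d *
          ((-1) ^ k * of_real (a n k) * \<zeta> x ^ (d - k) / fact (d - k))"
          by (simp add: field_simps)
      qed
      hence J: "even_jensen \<eta> d n z = C * (-1) ^ n * of_real (g n) * z ^ d * fact d * appell (a n) d (\<zeta> x)"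
        by (simp add: appell_def sum_distrib_left)
      have "even_jensen \<eta> d n z / (of_real (\<kappa> n) ^ d * \<eta> (n + d)) =
          (-1) ^ d * (of_real (g n) / of_real (g (n + d))) * (z / of_real (\<kappa> n)) ^ d *
          (fact d * appell (a n) d (\<zeta> x))"
      proof -
        have "\<eta> (n + d) = C * ((-1) ^ n * (-1) ^ d) * of_real (g (n + d))"
          using n by (subst \<eta>) (auto simp: power_add)
        moreover have "(-1) ^ d * (-1) ^ d = (1 :: complex)" by (simp flip: power_mult_distrib)
        ultimately show ?thesis
          unfolding J using C gp b0 sl by (simp add: \<kappa>_def field_simps)
      qed
      also have "z / of_real (\<kappa> n) = S x / of_real (slope d n)"
        using b0 by (simp add: z_def \<kappa>_def)
      also have "(S x / of_real (slope d n)) ^ d = of_real (h n) ^ d /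
          of_real (h n * slope d n / \<sigma> n) ^ d * S x ^ d / of_real (\<sigma> n) ^ d"
        using hn sg sl by (simp add: field_simps)
      finally have main: "even_jensen \<eta> d n z / (of_real (\<kappa> n) ^ d * \<eta> (n + d)) =
          (-1) ^ d * (of_real (g n) / of_real (g (n + d))) * (of_real (h n) ^ d /
          of_real (h n * slope d n / \<sigma> n) ^ d * S x ^ d / of_real (\<sigma> n) ^ d) *
          (fact d * appell (a n) d (\<zeta> x))" .
      show ?case
        unfolding x prod.case z main elim(1)[unfolded x] unfolding x[symmetric]
        by (simp add: x mult_ac)
    qed
  qed
qed

end

section \<open>Partial products over the zeros\<close>

text \<open>The map \<open>v \<mapsto> v / (2 * A - v)\<close> sends the half-plane \<open>Re v < A\<close> into the unit disc and fixes 0, so Schwarz's lemma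
applies after composition with \<open>\<phi>\<close>.\<close>
lemma borel_caratheodory_0:
  assumes holo: "\<phi> holomorphic_on ball 0 R" and R: "R > 0" and \<phi>0: "\<phi> 0 = 0"
    and re: "\<And>w. norm w < R \<Longrightarrow> Re (\<phi> w) < A" and w: "norm w < R"
  shows "norm (\<phi> w) \<le> 2 * A * norm w / (R - norm w)"
proof -
  have A: "A > 0" using re[of 0] R \<phi>0 by simp
  have ne: "of_real (2 * A) - \<phi> w \<noteq> 0" if "norm w < R" for w
  proof
    assume "of_real (2 * A) - \<phi> w = 0"
    hence "Re (\<phi> w) = 2 * A" by (metis Re_complex_of_real eq_iff_diff_eq_0)
    thus False using re[OF that] A by simp
  qed
  define \<psi> where "\<psi> \<xi> = \<phi> (of_real R * \<xi>) / (of_real (2 * A) - \<phi> (of_real R * \<xi>))" for \<xi>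
  have in_ball: "norm (of_real R * \<xi>) < R" if "norm \<xi> < 1" for \<xi> :: complex
    using that R by (simp add: norm_mult)
  have h1: "(\<lambda>\<xi>. \<phi> (of_real R * \<xi>)) holomorphic_on ball 0 1"
    by (rule holomorphic_on_compose_gen[OF _ holo, unfolded o_def])
       (use in_ball in \<open>auto intro!: holomorphic_intros\<close>)
  have "\<psi> holomorphic_on ball 0 1"
    unfolding \<psi>_def by (intro holomorphic_intros h1) (use ne in_ball in auto)
  moreover have "\<psi> 0 = 0" by (simp add: \<psi>_def \<phi>0)
  moreover have "norm (\<psi> \<xi>) < 1" if "norm \<xi> < 1" for \<xi>
  proof -
    let ?v = "\<phi> (of_real R * \<xi>)"
    have v: "Re ?v < A" by (rule re[OF in_ball[OF that]])
    have "norm ?v < norm (of_real (2 * A) - ?v)"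
    proof -
      have "(norm ?v)\<^sup>2 < (norm (of_real (2 * A) - ?v))\<^sup>2"
      proof -
        have "(norm (of_real (2 * A) - ?v))\<^sup>2 - (norm ?v)\<^sup>2 = 4 * A * (A - Re ?v)"
          unfolding cmod_power2 by (simp add: power2_eq_square algebra_simps)
        moreover have "4 * A * (A - Re ?v) > 0" using A v by simp
        ultimately show ?thesis by linarith
      qed
      thus ?thesis by (rule power_less_imp_less_base) simp
    qed
    thus ?thesis using ne[OF in_ball[OF that]] by (simp add: \<psi>_def norm_divide)
  qed
  moreover have "norm (w / of_real R) < 1" using w R by (simp add: norm_divide)
  ultimately have S: "norm (\<psi> (w / of_real R)) \<le> norm (w / of_real R)"
    by (rule Schwarz_Lemma(1))
  let ?d = "norm w / R"
  have d: "?d < 1" "?d \<ge> 0" using w R by auto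
  have "norm (\<phi> w) / norm (of_real (2 * A) - \<phi> w) \<le> ?d"
    using S R by (simp add: \<psi>_def norm_divide)
  hence "norm (\<phi> w) \<le> ?d * norm (of_real (2 * A) - \<phi> w)"
    using ne[OF w] by (simp add: divide_le_eq)
  also have "\<dots> \<le> ?d * (2 * A + norm (\<phi> w))"
    using d A norm_triangle_ineq4[of "of_real (2 * A)" "\<phi> w"]
    by (intro mult_left_mono) (auto simp: norm_mult)
  finally have "norm (\<phi> w) * (1 - ?d) \<le> 2 * A * ?d" by (simp add: algebra_simps)
  hence "norm (\<phi> w) \<le> 2 * A * ?d / (1 - ?d)" 
  proof -
    have "1 - ?d > 0" using d by linarith
    thus "norm (\<phi> w) * (1 - ?d) \<le> 2 * A * ?d \<Longrightarrow> ?thesis" by (simp only: pos_le_divide_eq)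
  qed
  also have "\<dots> = 2 * A * norm w / (R - norm w)"
  proof -
    have "1 - ?d = (R - norm w) / R" using R by (simp add: diff_divide_distrib)
    thus ?thesis using R by simp
  qed
  finally show ?thesis .
qed

text \<open>Allows the zeros in a disc to be divided out with their multiplicities.\<close>
lemma zorder_prod_power:
  assumes "finite Z"
  shows "zorder (\<lambda>w. \<Prod>a\<in>Z. (w - a) ^ k a) z = (if z \<in> Z then int (k z) else 0)"
proof (rule zorder_eqI[where S = UNIV and g = "\<lambda>w. \<Prod>a\<in>Z - {z}. (w - a) ^ k a"])
  fix w show "(\<Prod>a\<in>Z. (w - a) ^ k a) =
      (\<Prod>a\<in>Z - {z}. (w - a) ^ k a) * (w - z) powi (if z \<in> Z then int (k z) else 0)"
    using assms by (auto simp: prod.remove)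
qed (use assms in \<open>auto intro!: holomorphic_intros\<close>)

definition pos_zeros :: "(complex \<Rightarrow> complex) \<Rightarrow> real \<Rightarrow> real set" where
  "pos_zeros F r = {t. 0 < t \<and> t \<le> r \<and> F (of_real t) = 0}"

text \<open>The zeros in \<open>{0<..r}\<close> listed with multiplicity: a zero \<open>t\<close> occurs in the pairs \<open>(t, i)\<close> with \<open>i\<close> below its order.\<close>
definition zero_index :: "(complex \<Rightarrow> complex) \<Rightarrow> real \<Rightarrow> (real \<times> nat) set" where
  "zero_index F r = Sigma (pos_zeros F r) (\<lambda>t. {..<nat (zorder F (of_real t))})"

text \<open>The situation after the zero of \<open>F\<close> at the origin has been divided out.\<close>
locale pos_zeros_small_growth =
  fixes F :: "complex \<Rightarrow> complex" and \<kappa> :: real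
  assumes holo: "F holomorphic_on UNIV" and F0: "F 0 \<noteq> 0"
    and zeros: "\<And>w. F w = 0 \<Longrightarrow> w \<in> \<real> \<and> Re w > 0"
    and growth: "\<kappa> < 1" "\<forall>\<^sub>F r in at_top. \<forall>w. norm w \<le> r \<longrightarrow> norm (F w) \<le> exp (r powr \<kappa>)"
begin

lemma finite_zeros: "finite {z. norm z \<le> r \<and> F z = 0}"
proof (cases "F constant_on UNIV")
  case True
  hence "\<And>z. F z \<noteq> 0" using F0 unfolding constant_on_def by auto
  thus ?thesis by simp
next
  case False
  have "finite {z \<in> cball 0 r. F z = 0}"
    by (rule holomorphic_compact_finite_zeros[OF holo _ _ _ _ False]) auto
  thus ?thesis by simp
qed

lemma finite_pos_zeros: "finite (pos_zeros F r)"
proof -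
  have "of_real ` pos_zeros F r \<subseteq> {z. norm z \<le> r \<and> F z = 0}"
    by (auto simp: pos_zeros_def)
  hence "finite ((of_real :: real \<Rightarrow> complex) ` pos_zeros F r)"
    using finite_zeros finite_subset by blast
  thus ?thesis by (rule finite_imageD) (simp add: inj_on_def)
qed

lemma finite_zero_index: "finite (zero_index F r)"
  unfolding zero_index_def using finite_pos_zeros by blast

lemma zero_eq: "F z = 0 \<Longrightarrow> z = of_real (Re z)"
  using zeros[of z] by (auto simp: Reals_def)

lemma analytic: "F analytic_on {z}"
  using holo by (simp add: analytic_on_open holomorphic_on_imp_analytic_at)

lemma eventually_nonzero: "\<forall>\<^sub>F w in at z. F w \<noteq> 0"
  using non_zero_neighbour_alt[OF holo, of z 0] F0 by (auto elim: eventually_mono)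

lemma zorder_pos_iff: "zorder F z > 0 \<longleftrightarrow> F z = 0"
  by (rule zorder_pos_iff'[OF analytic])
     (use eventually_nonzero in \<open>auto intro: eventually_frequently\<close>)

definition partial_prod :: "real \<Rightarrow> complex \<Rightarrow> complex" where
  "partial_prod R w = (\<Prod>t\<in>pos_zeros F R. (1 - w / of_real t) ^ nat (zorder F (of_real t)))"

text \<open>All zeros of modulus below \<open>4 * R\<close> are divided out, and those of modulus larger than \<open>R\<close> are then multiplied back in. The
quotient is thus holomorphic beyond the circle of radius \<open>2 * R\<close>, where it can be estimated, and has no zeros of modulus
at most \<open>R\<close>.\<close>
lemma partial_prod_quotient:
  assumes R: "R > 0"
  shows "\<exists>G. G holomorphic_on ball 0 (4 * R) \<and> (\<forall>w. norm w < 4 * R \<longrightarrow> F w = G w * partial_prod R w) \<and>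
    (\<forall>w. norm w \<le> R \<longrightarrow> G w \<noteq> 0) \<and> G 0 = F 0"
proof -
  define k where "k a = nat (zorder F a)" for a
  define Z where "Z = {z. norm z < 4 * R \<and> F z = 0}"
  have finZ: "finite Z"
    by (rule finite_subset[OF _ finite_zeros[of "4 * R"]]) (auto simp: Z_def)
  define P where "P w = (\<Prod>a\<in>Z. (w - a) ^ k a)" for w
  have kpos: "k a > 0" if "a \<in> Z" for a
    using that zorder_pos_iff[of a] by (simp add: Z_def k_def)
  have P0: "P z = 0 \<longleftrightarrow> z \<in> Z" for z
    using finZ kpos by (auto simp: P_def)
  obtain h where h: "h holomorphic_on ball 0 (4 * R)" "\<And>z. z \<in> ball 0 (4 * R) \<Longrightarrow> h z \<noteq> 0"
    "\<And>z. z \<in> ball 0 (4 * R) \<Longrightarrow> F z = h z * P z"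
  proof (rule holomorphic_zorder_factorization[of F "ball 0 (4 * R)" P])
    show "F holomorphic_on ball 0 (4 * R)" by (rule holomorphic_on_subset[OF holo]) simp
    show "P holomorphic_on ball 0 (4 * R)" unfolding P_def by (intro holomorphic_intros)
    fix z assume z: "z \<in> ball (0 :: complex) (4 * R)"
    show "P z = 0 \<longleftrightarrow> F z = 0" using z unfolding P0 by (simp add: Z_def)
    show "zorder P z = zorder F z"
    proof (cases "F z = 0")
      case True
      thus ?thesis using z zorder_prod_power[OF finZ, of k z] zorder_pos_iff[of z]
        by (simp add: P_def[abs_def] Z_def k_def)
    next
      case False
      hence "zorder F z = 0" using analytic by (rule zorder_eq_0I[rotated])
      thus ?thesis using False zorder_prod_power[OF finZ, of k z]
        by (simp add: P_def[abs_def] Z_def)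
    qed
  qed auto
  \<comment> \<open>the zeros that stay in the partial product; the other ones are returned to the quotient \<open>G\<close> below\<close>
  define Z1 where "Z1 = (of_real ` pos_zeros F R :: complex set)"
  have Z1: "Z1 = {z\<in>Z. norm z \<le> R}"
  proof
    show "Z1 \<subseteq> {z\<in>Z. norm z \<le> R}" using R by (auto simp: Z1_def Z_def pos_zeros_def)
    show "{z\<in>Z. norm z \<le> R} \<subseteq> Z1"
    proof
      fix z assume z: "z \<in> {z\<in>Z. norm z \<le> R}"
      hence Fz: "F z = 0" by (simp add: Z_def)
      obtain t where t: "z = of_real t" using zero_eq[OF Fz] by blast
      have "t \<in> pos_zeros F R" using zeros[OF Fz] z Fz by (simp add: t pos_zeros_def)
      thus "z \<in> Z1" by (simp add: Z1_def t)
    qed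
  qed
  have Z1_nz: "a \<noteq> 0" if "a \<in> Z1" for a using that F0 by (auto simp: Z1 Z_def)
  define c where "c = (\<Prod>a\<in>Z1. (- a) ^ k a)"
  have c: "c \<noteq> 0" using finZ Z1 Z1_nz by (simp add: c_def)
  have pp: "(\<Prod>a\<in>Z1. (w - a) ^ k a) = c * partial_prod R w" for w
  proof -
    have "partial_prod R w = (\<Prod>a\<in>Z1. (1 - w / a) ^ k a)"
      unfolding Z1_def partial_prod_def k_def by (subst prod.reindex) (auto simp: inj_on_def)
    hence "c * partial_prod R w = (\<Prod>a\<in>Z1. (- a) ^ k a * (1 - w / a) ^ k a)"
      by (simp add: c_def prod.distrib)
    also have "\<dots> = (\<Prod>a\<in>Z1. (w - a) ^ k a)"
    proof (intro prod.cong refl)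
      fix a assume "a \<in> Z1"
      hence "- a * (1 - w / a) = w - a" using Z1_nz by (simp add: field_simps)
      thus "(- a) ^ k a * (1 - w / a) ^ k a = (w - a) ^ k a" by (metis power_mult_distrib)
    qed
    finally show ?thesis by simp
  qed
  define G where "G w = h w * c * (\<Prod>a\<in>Z - Z1. (w - a) ^ k a)" for w
  have FG: "F w = G w * partial_prod R w" if "norm w < 4 * R" for w
  proof -
    have "P w = (\<Prod>a\<in>Z - Z1. (w - a) ^ k a) * (\<Prod>a\<in>Z1. (w - a) ^ k a)"
      unfolding P_def using finZ Z1 by (subst prod.subset_diff[of Z1]) auto
    thus ?thesis using h(3)[of w] that by (simp add: G_def pp mult_ac)
  qed
  show ?thesis
  proof (intro exI[of _ G] conjI allI impI)
    show "G holomorphic_on ball 0 (4 * R)" unfolding G_def by (intro holomorphic_intros h)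
    show "F w = G w * partial_prod R w" if "norm w < 4 * R" for w by (rule FG[OF that])
    show "G w \<noteq> 0" if "norm w \<le> R" for w
      using that R h(2)[of w] c finZ Z1 by (auto simp: G_def)
    show "G 0 = F 0" using FG[of 0] R by (simp add: partial_prod_def)
  qed
qed

end

lemma filterlim_four_power: "filterlim (\<lambda>J. 4 ^ J :: real) at_top sequentially"
proof (rule filterlim_at_top_mono[OF filterlim_real_sequentially])
  have "real J \<le> 4 ^ J" for J
  proof -
    have "J < 2 ^ J" by (rule less_exp)
    hence "real J \<le> 2 ^ J" by (metis less_imp_le of_nat_le_iff of_nat_numeral of_nat_power)
    also have "\<dots> \<le> 4 ^ J" by (intro power_mono) auto
    finally show ?thesis .
  qed
  thus "\<forall>\<^sub>F J in sequentially. real J \<le> 4 ^ J" by simp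
qed

text \<open>For order less than 1 the logarithm of the maximum modulus grows more slowly than the radius; dividing by the radius is
what the Borel-Caratheodory inequality achieves on a fixed disc.\<close>
lemma log_bound_tendsto_0:
  fixes \<kappa> c :: real
  assumes "\<kappa> < 1"
  shows "((\<lambda>R. 2 * ((2 * R) powr \<kappa> + c) / (R - 1)) \<longlongrightarrow> 0) at_top"
proof -
  have 1: "((\<lambda>R::real. R powr (\<kappa> - 1)) \<longlongrightarrow> 0) at_top"
    using assms by (intro tendsto_neg_powr filterlim_ident) simp
  have 2: "((\<lambda>R::real. c / R) \<longlongrightarrow> 0) at_top"
    by (intro real_tendsto_divide_at_top[OF tendsto_const] filterlim_ident)
  have 3: "((\<lambda>R::real. 1 / R) \<longlongrightarrow> 0) at_top"
    by (intro real_tendsto_divide_at_top[OF tendsto_const] filterlim_ident)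
  have "((\<lambda>R::real. 2 * (2 powr \<kappa> * R powr (\<kappa> - 1) + c / R) / (1 - 1 / R)) \<longlongrightarrow>
      2 * (2 powr \<kappa> * 0 + 0) / (1 - 0)) at_top"
    by (intro tendsto_intros 1 2 3) auto
  hence "((\<lambda>R::real. 2 * (2 powr \<kappa> * R powr (\<kappa> - 1) + c / R) / (1 - 1 / R)) \<longlongrightarrow> 0) at_top"
    by simp
  moreover have "\<forall>\<^sub>F R in at_top. 2 * (2 powr \<kappa> * R powr (\<kappa> - 1) + c / R) / (1 - 1 / R) =
      2 * ((2 * R) powr \<kappa> + c) / (R - (1::real))"
    using eventually_gt_at_top[of 1]
  proof eventually_elim
    case (elim R)
    have "2 powr \<kappa> * R powr (\<kappa> - 1) + c / R = ((2 * R) powr \<kappa> + c) / R"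
      using elim by (simp add: powr_diff powr_mult add_divide_distrib)
    moreover have "1 - 1 / R = (R - 1) / R" using elim by (simp add: diff_divide_distrib)
    ultimately show ?case using elim by simp
  qed
  ultimately show ?thesis by (rule Lim_transform_eventually)
qed

context pos_zeros_small_growth
begin

text \<open>On the circle of radius \<open>2 * R\<close> every factor of the partial product has modulus at least 1, so the quotient inherits the
bound for \<open>F\<close>. It has a logarithm on the disc of radius \<open>R\<close>, to which \<open>borel_caratheodory_0\<close> applies.\<close>
lemma partial_prod_log_bound:
  assumes R: "R > 1" and bound: "\<And>w. norm w \<le> 2 * R \<Longrightarrow> norm (F w) \<le> exp B" and B: "B \<ge> 0"
    and w: "norm w < 1"
  shows "\<exists>u. F w = F 0 * partial_prod R w * exp u \<and>
    norm u \<le> 2 * (B + (\<bar>ln (norm (F 0))\<bar> + 1)) / (R - 1)"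
proof -
  obtain G where G: "G holomorphic_on ball 0 (4 * R)"
    "\<And>w. norm w < 4 * R \<Longrightarrow> F w = G w * partial_prod R w"
    "\<And>w. norm w \<le> R \<Longrightarrow> G w \<noteq> 0" "G 0 = F 0"
    using partial_prod_quotient[of R] R by auto
  have G_le: "norm (G z) \<le> exp B" if "norm z \<le> 2 * R" for z
  proof (rule maximum_modulus_frontier[of G "cball 0 (2 * R)"])
    show "G holomorphic_on interior (cball 0 (2 * R))"
      using R by (intro holomorphic_on_subset[OF G(1)]) (auto simp: ball_def)
    show "continuous_on (closure (cball 0 (2 * R))) G"
      using R by (intro continuous_on_subset[OF holomorphic_on_imp_continuous_on[OF G(1)]]) auto
    fix z assume "z \<in> frontier (cball (0 :: complex) (2 * R))"
    hence z: "norm z = 2 * R" using R by (simp add: frontier_cball)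
    have "1 \<le> norm (partial_prod R z)"
      unfolding partial_prod_def prod_norm[symmetric] norm_power
    proof (intro prod_ge_1 one_le_power)
      fix t assume t: "t \<in> pos_zeros F R"
      hence t': "0 < t" "t \<le> R" by (auto simp: pos_zeros_def)
      have "2 \<le> norm (z / of_real t)" using t' z R by (simp add: norm_divide field_simps)
      thus "1 \<le> norm (1 - z / of_real t)"
        using norm_triangle_ineq3[of 1 "z / of_real t"] by simp
    qed
    moreover have "norm (G z) * norm (partial_prod R z) \<le> exp B"
      using bound[of z] G(2)[of z] z R by (simp add: norm_mult)
    moreover have "norm (G z) * 1 \<le> norm (G z) * norm (partial_prod R z)"
      using calculation(1) by (intro mult_left_mono) auto
    ultimately show "norm (G z) \<le> exp B" by linarith
  qed (use that in auto)
  obtain L where L: "L holomorphic_on ball 0 R" "\<And>z. z \<in> ball 0 R \<Longrightarrow> G z = exp (L z)"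
  proof (rule simply_connected_imp_holomorphic_log[of G "ball 0 R"])
    show "G holomorphic_on ball 0 R" using R by (intro holomorphic_on_subset[OF G(1)]) auto
    show "G z \<noteq> 0" if "z \<in> ball 0 R" for z using G(3)[of z] that by simp
  qed (auto simp: convex_imp_simply_connected open_imp_locally_path_connected)
  have Re_L: "Re (L z) = ln (norm (G z))" if "norm z < R" for z
    using L(2)[of z] that by simp
  define \<phi> where "\<phi> z = L z - L 0" for z
  have "norm (\<phi> w) \<le> 2 * (B + (\<bar>ln (norm (F 0))\<bar> + 1)) * norm w / (R - norm w)"
  proof (rule borel_caratheodory_0)
    show "\<phi> holomorphic_on ball 0 R" unfolding \<phi>_def by (intro holomorphic_intros L)
    fix z :: complex assume z: "norm z < R"
    have "ln (norm (G z)) \<le> B"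
      using G_le[of z] G(3)[of z] z R ln_mono[of "norm (G z)" "exp B"] by auto
    thus "Re (\<phi> z) < B + (\<bar>ln (norm (F 0))\<bar> + 1)"
      using Re_L[OF z] Re_L[of 0] R G(4) by (simp add: \<phi>_def)
  qed (use R w in \<open>auto simp: \<phi>_def\<close>)
  also have "\<dots> \<le> 2 * (B + (\<bar>ln (norm (F 0))\<bar> + 1)) / (R - 1)"
  proof -
    have "2 * (B + (\<bar>ln (norm (F 0))\<bar> + 1)) * norm w \<le> 2 * (B + (\<bar>ln (norm (F 0))\<bar> + 1)) * 1"
      using w B by (intro mult_left_mono) auto
    thus ?thesis using R w B by (intro frac_le) auto
  qed
  finally have "norm (\<phi> w) \<le> 2 * (B + (\<bar>ln (norm (F 0))\<bar> + 1)) / (R - 1)" .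
  moreover have "F w = F 0 * partial_prod R w * exp (\<phi> w)"
  proof -
    have "exp (L 0) = F 0" using L(2)[of 0] G(4) R by simp
    hence "exp (L w) = F 0 * exp (\<phi> w)" using F0 by (simp add: \<phi>_def exp_diff)
    thus ?thesis using G(2)[of w] L(2)[of w] R w by simp
  qed
  ultimately show ?thesis by blast
qed

text \<open>The bound for the logarithm of the quotient is of order \<open>R powr \<kappa> / R\<close>. This is Hadamard's factorisation for order
less than 1, obtained without estimating infinite products.\<close>
lemma partial_prod_tendsto:
  "uniform_limit (ball 0 1) (\<lambda>J w. F 0 * partial_prod (4 ^ J) w) F sequentially"
proof -
  define c where "c = \<bar>ln (norm (F 0))\<bar> + 1"
  define \<epsilon> where "\<epsilon> R = 2 * ((2 * R) powr \<kappa> + c) / (R - 1)" for R :: real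
  have "compact (F ` cball 0 1)"
    by (intro compact_continuous_image continuous_on_subset[OF holomorphic_on_imp_continuous_on[OF holo]]) auto
  then obtain M where M: "\<And>w. norm w \<le> 1 \<Longrightarrow> norm (F w) \<le> M"
    using compact_imp_bounded by (fastforce simp: bounded_iff)
  have M0: "M \<ge> 0" using order_trans[OF norm_ge_zero M[of 0]] by simp
  have "((\<lambda>R. M * (\<epsilon> R * exp (\<epsilon> R))) \<longlongrightarrow> M * (0 * exp 0)) at_top"
    unfolding \<epsilon>_def by (intro tendsto_intros log_bound_tendsto_0 growth)
  hence lim: "((\<lambda>R. M * (\<epsilon> R * exp (\<epsilon> R))) \<longlongrightarrow> 0) at_top" by simp
  obtain r0 where r0: "\<And>r w. r \<ge> r0 \<Longrightarrow> norm w \<le> r \<Longrightarrow> norm (F w) \<le> exp (r powr \<kappa>)"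
    using growth(2) unfolding eventually_at_top_linorder by blast
  have diff: "norm (F w - F 0 * partial_prod R w) \<le> M * (\<epsilon> R * exp (\<epsilon> R))"
    if R: "R > 1" "2 * R \<ge> r0" and w: "norm w < 1" for R w
  proof -
    obtain u where u: "F w = F 0 * partial_prod R w * exp u" "norm u \<le> \<epsilon> R"
      using partial_prod_log_bound[OF R(1), of "(2 * R) powr \<kappa>" w] r0[OF R(2)] w
      by (auto simp: \<epsilon>_def c_def)
    have "F w - F 0 * partial_prod R w = F w * (1 - exp (- u))"
      by (simp add: u(1) algebra_simps exp_minus)
    hence "norm (F w - F 0 * partial_prod R w) = norm (F w) * norm (1 - exp (- u))"
      by (simp add: norm_mult)
    also have "norm (1 - exp (- u)) = norm (exp (- u) - 1)" by (simp add: norm_minus_commute)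
    also have "norm (F w) * norm (exp (- u) - 1) \<le> M * (\<epsilon> R * exp (\<epsilon> R))"
    proof (rule mult_mono)
      have "norm (exp (- u) - 1) \<le> norm u * exp (norm u)"
        using Taylor_exp_field[of "- u" 0] by (simp add: mult.commute)
      also have "\<dots> \<le> \<epsilon> R * exp (\<epsilon> R)"
        using u(2) by (intro mult_mono) (auto intro: order_trans[OF norm_ge_zero])
      finally show "norm (exp (- u) - 1) \<le> \<epsilon> R * exp (\<epsilon> R)" .
    qed (use M[of w] w M0 in auto)
    finally show ?thesis .
  qed
  show ?thesis
  proof (rule uniform_limitI)
    fix e :: real assume "e > 0"
    hence "\<forall>\<^sub>F R in at_top. M * (\<epsilon> R * exp (\<epsilon> R)) < e \<and> R > 1 \<and> 2 * R \<ge> r0"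
      using order_tendstoD(2)[OF lim] eventually_gt_at_top[of 1] eventually_ge_at_top[of "r0 / 2"]
      by (auto simp: eventually_conj_iff field_simps)
    hence "\<forall>\<^sub>F J in sequentially. M * (\<epsilon> (4 ^ J) * exp (\<epsilon> (4 ^ J))) < e \<and> (4 ^ J :: real) > 1 \<and> 2 * 4 ^ J \<ge> r0"
      using filterlim_four_power unfolding filterlim_iff by blast
    thus "\<forall>\<^sub>F J in sequentially. \<forall>w\<in>ball 0 1. dist (F 0 * partial_prod (4 ^ J) w) (F w) < e"
    proof eventually_elim
      case (elim J)
      thus ?case using diff[of "4 ^ J"] by (fastforce simp: dist_norm norm_minus_commute)
    qed
  qed
qed

definition root_inv :: "real \<times> nat \<Rightarrow> real" where "root_inv j = 1 / fst j"

lemma partial_prod_eq: "partial_prod R w = (\<Prod>j\<in>zero_index F R. 1 + of_real (- root_inv j) * w)"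
proof -
  have "(\<Prod>j\<in>zero_index F R. 1 + of_real (- root_inv j) * w) =
      (\<Prod>t\<in>pos_zeros F R. \<Prod>i<nat (zorder F (of_real t)). 1 + of_real (- root_inv (t, i)) * w)"
    unfolding zero_index_def using finite_pos_zeros by (subst prod.Sigma) (auto simp: case_prod_unfold)
  thus ?thesis by (simp add: partial_prod_def root_inv_def)
qed

lemma esym_tendsto:
  "(\<lambda>J. of_real (esym (zero_index F (4 ^ J)) root_inv k))
     \<longlonglongrightarrow> (-1) ^ k * ((deriv ^^ k) F 0 / fact k) / F 0"
proof -
  have coeff: "(deriv ^^ k) (\<lambda>w. F 0 * partial_prod R w) 0 = F 0 * (fact k * ((-1) ^ k * of_real (esym (zero_index F R) root_inv k)))" for R
  proof -
    have "(\<lambda>w. F 0 * partial_prod R w) has_fps_expansion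
        fps_const (F 0) * (\<Prod>j\<in>zero_index F R. 1 + fps_const (of_real (- root_inv j)) * fps_X)"
      unfolding partial_prod_eq by (intro fps_expansion_intros)
    from fps_nth_fps_expansion[OF this, of k]
    have "(deriv ^^ k) (\<lambda>w. F 0 * partial_prod R w) 0 / fact k =
       F 0 * esym (zero_index F R) (\<lambda>j. of_real (- root_inv j)) k"
      by (simp only: fps_mult_left_const_nth fps_nth_prod_linear[OF finite_zero_index])
    moreover have "esym (zero_index F R) (\<lambda>j. of_real (- root_inv j)) k =
        ((-1) ^ k * of_real (esym (zero_index F R) root_inv k) :: complex)"
      unfolding esym_def of_real_sum sum_distrib_left
    proof (intro sum.cong refl)
      fix S assume S: "S \<in> {S. S \<subseteq> zero_index F R \<and> card S = k}"
      have "(\<Prod>j\<in>S. of_real (- root_inv j)) = (\<Prod>j\<in>S. (-1) * of_real (root_inv j) :: complex)" by simp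
      also have "\<dots> = (-1) ^ card S * of_real (\<Prod>j\<in>S. root_inv j)" by (simp only: prod.distrib prod_constant of_real_prod)
      finally show "(\<Prod>j\<in>S. of_real (- root_inv j)) = (-1) ^ k * (of_real (\<Prod>j\<in>S. root_inv j) :: complex)"
        using S by simp
    qed
    ultimately show ?thesis by (simp add: field_simps)
  qed
  have "(\<lambda>J. (deriv ^^ k) (\<lambda>w. F 0 * partial_prod (4 ^ J) w) 0) \<longlonglongrightarrow> (deriv ^^ k) F 0"
    by (rule higher_deriv_complex_uniform_limit[OF partial_prod_tendsto])
       (auto simp: partial_prod_def intro!: holomorphic_intros always_eventually)
  hence "(\<lambda>J. (-1) ^ k * ((deriv ^^ k) (\<lambda>w. F 0 * partial_prod (4 ^ J) w) 0 / fact k) / F 0)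
      \<longlonglongrightarrow> (-1) ^ k * ((deriv ^^ k) F 0 / fact k) / F 0"
    by (intro tendsto_intros) (use F0 in auto)
  moreover have "(-1) ^ k * ((-1) ^ k * x) = (x :: complex)" for x
    by (simp add: mult.assoc[symmetric] power_mult_distrib[symmetric])
  ultimately show ?thesis using F0 by (simp add: coeff mult.assoc)
qed

end

section \<open>Zeros of regular growth\<close>

text \<open>The set \<open>I i\<close> indexes the zeros of modulus at most \<open>4^i\<close>, and \<open>x j\<close> is the reciprocal of the \<open>j\<close>-th zero. The number
\<open>\<beta> = 2 powr \<alpha>\<close> is the growth factor of the counting function; \<open>\<beta> < 4\<close> makes the sums of reciprocals converge
geometrically, \<open>1 < \<beta>\<close> makes the counting function grow.\<close>
locale regular_roots =
  fixes I :: "nat \<Rightarrow> 'j set" and x :: "'j \<Rightarrow> real" and e :: "nat \<Rightarrow> real" and \<beta> :: real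
  assumes fin: "finite (I i)" and mono: "I i \<subseteq> I (Suc i)"
    and x_ge: "j \<in> I i \<Longrightarrow> x j \<ge> 1 / 4 ^ i"
    and x_le: "j \<in> I i - I l \<Longrightarrow> x j \<le> 1 / 4 ^ l"
    and e: "(\<lambda>i. esym (I i) x k) \<longlonglongrightarrow> e k"
    and ratio: "(\<lambda>i. real (card (I (Suc i))) / card (I i)) \<longlonglongrightarrow> \<beta>" "1 < \<beta>" "\<beta> < 4"
begin

abbreviation N :: "nat \<Rightarrow> nat" where "N i \<equiv> card (I i)"

lemma I_mono: "i \<le> l \<Longrightarrow> I i \<subseteq> I l"
  using mono by (rule lift_Suc_mono_le)

lemma x_pos: "j \<in> I i \<Longrightarrow> x j > 0"
  using x_ge[of j i] by (auto intro: less_le_trans[of 0 "1 / 4 ^ i"])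

lemma N_mono: "i \<le> l \<Longrightarrow> N i \<le> N l"
  using I_mono fin by (intro card_mono) auto

lemma N_growth:
  fixes b1 b2 :: real
  assumes "1 < b1" "b1 < \<beta>" "\<beta> < b2"
  shows "\<forall>\<^sub>F i in sequentially. N i > 0 \<and> b1 * N i \<le> N (Suc i) \<and> N (Suc i) \<le> b2 * N i"
proof -
  have "\<forall>\<^sub>F i in sequentially. b1 < real (N (Suc i)) / N i \<and> real (N (Suc i)) / N i < b2"
    using order_tendstoD[OF ratio(1)] assms by (simp add: eventually_conj_iff)
  thus ?thesis
  proof eventually_elim
    case (elim i)
    hence "N i > 0" using assms(1) by (cases "N i = 0") auto
    thus ?case using elim by (simp add: field_simps)
  qed
qed

lemma N_unbounded: "filterlim N at_top sequentially"
proof -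
  define b where "b = (1 + \<beta>) / 2"
  have b: "1 < b" "b < \<beta>" using ratio by (auto simp: b_def)
  obtain i0 where i0: "\<And>i. i \<ge> i0 \<Longrightarrow> N i > 0 \<and> b * N i \<le> N (Suc i)"
    using N_growth[OF b, of "\<beta> + 1"] unfolding eventually_sequentially by auto
  have "i \<le> N (i + i0)" for i
  proof (induction i)
    case (Suc i)
    have "1 * real (N (i + i0)) < b * N (i + i0)"
      using i0[of "i + i0"] b by (intro mult_strict_right_mono) auto
    moreover have "b * N (i + i0) \<le> N (Suc (i + i0))"
      using i0[of "i + i0"] by simp
    ultimately have "real (N (i + i0)) < real (N (Suc (i + i0)))" by linarith
    thus ?case using Suc by simp
  qed simp
  hence "Z \<le> N i" if "i \<ge> Z + i0" for Z i
    using N_mono[OF that] le_trans by blast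
  thus ?thesis unfolding filterlim_at_top eventually_sequentially by blast
qed

lemma e_pos: "e k > 0"
proof -
  obtain i where i: "N i \<ge> k"
    using N_unbounded unfolding filterlim_at_top eventually_sequentially by blast
  have "esym (I i) x k > 0" using fin x_pos i by (intro esym_pos) auto
  moreover have "esym (I i) x k \<le> e k"
  proof (rule tendsto_lowerbound[OF e])
    show "\<forall>\<^sub>F l in sequentially. esym (I i) x k \<le> esym (I l) x k"
      using eventually_ge_at_top[of i]
    proof eventually_elim
      case (elim l)
      show ?case using fin I_mono[OF elim] x_pos by (intro esym_mono) (auto intro: less_imp_le)
    qed
  qed simp
  ultimately show ?thesis by simp
qed

lemma tail_ge:
  assumes "i < J"
  shows "(real (N (Suc i)) - N i) / 4 ^ Suc i \<le> (\<Sum>j\<in>I J - I i. x j)"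
proof -
  have "(real (N (Suc i)) - N i) / 4 ^ Suc i = (\<Sum>j\<in>I (Suc i) - I i. 1 / 4 ^ Suc i)"
    using card_Diff_subset[OF fin mono, of i] N_mono[of i "Suc i"] by (simp add: of_nat_diff)
  also have "\<dots> \<le> (\<Sum>j\<in>I (Suc i) - I i. x j)"
    by (intro sum_mono x_ge) auto
  also have "\<dots> \<le> (\<Sum>j\<in>I J - I i. x j)"
    using assms fin I_mono[of "Suc i" J] x_pos by (intro sum_mono2) (auto intro: less_imp_le)
  finally show ?thesis .
qed

text \<open>A shell contributes at most its number of zeros divided by \<open>4^J\<close>, and this is a constant times the decrease of \<open>N J / 4^J\<close>
across the shell, since \<open>N\<close> grows by a factor of at most \<open>b < 4\<close>. The bound is therefore a telescoping sum.\<close>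
lemma tail_le:
  fixes b :: real
  assumes b: "b < 4" and growth: "\<And>l. l \<ge> i \<Longrightarrow> N (Suc l) \<le> b * N l" and "i \<le> J"
  shows "(\<Sum>j\<in>I J - I i. x j) \<le> 3 / (1 - b / 4) * (N i / 4 ^ i - N J / 4 ^ J)"
  using \<open>i \<le> J\<close>
proof (induction J rule: dec_induct)
  case (step J)
  have "(\<Sum>j\<in>I (Suc J) - I i. x j) = (\<Sum>j\<in>I J - I i. x j) + (\<Sum>j\<in>I (Suc J) - I J. x j)"
    using fin mono[of J] I_mono[OF step.hyps(1)]
    by (subst sum.union_disjoint[symmetric]) (auto intro!: sum.cong)
  also have "(\<Sum>j\<in>I (Suc J) - I J. x j) \<le> (\<Sum>j\<in>I (Suc J) - I J. 1 / 4 ^ J)"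
    by (intro sum_mono x_le)
  also have "\<dots> = (real (N (Suc J)) - N J) / 4 ^ J"
    using card_Diff_subset[OF fin mono, of J] N_mono[of J "Suc J"] by (simp add: of_nat_diff)
  also have "\<dots> \<le> 3 / (1 - b / 4) * (N J / 4 ^ J - N (Suc J) / 4 ^ Suc J)"
  proof -
    have g: "N (Suc J) \<le> b * N J" using step.hyps by (intro growth) simp
    have "b * real (N J) \<le> 4 * real (N J)" using b by (intro mult_right_mono) auto
    hence 1: "real (N (Suc J)) - N J \<le> 3 * N J" using g by linarith
    have "(1 - b / 4) * N J \<le> N J - N (Suc J) / 4" using g by (simp add: algebra_simps)
    hence "3 * N J \<le> 3 / (1 - b / 4) * (N J - N (Suc J) / 4)"
      using b by (simp add: field_simps)
    hence "real (N (Suc J)) - N J \<le> 3 / (1 - b / 4) * (N J - N (Suc J) / 4)"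
      using 1 by linarith
    hence "(real (N (Suc J)) - N J) / 4 ^ J \<le> 3 / (1 - b / 4) * (N J - N (Suc J) / 4) / 4 ^ J"
      by (intro divide_right_mono) auto
    also have "\<dots> = 3 / (1 - b / 4) * ((N J - N (Suc J) / 4) / 4 ^ J)"
      by (simp only: times_divide_eq_right)
    also have "(N J - N (Suc J) / 4) / 4 ^ J = N J / 4 ^ J - N (Suc J) / 4 ^ Suc J"
      by (simp add: diff_divide_distrib)
    finally show ?thesis .
  qed
  finally have "(\<Sum>j\<in>I (Suc J) - I i. x j) \<le> (\<Sum>j\<in>I J - I i. x j) +
    3 / (1 - b / 4) * (N J / 4 ^ J - N (Suc J) / 4 ^ Suc J)" by simp
  also have "\<dots> \<le> 3 / (1 - b / 4) * (N i / 4 ^ i - N J / 4 ^ J) +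
    3 / (1 - b / 4) * (N J / 4 ^ J - N (Suc J) / 4 ^ Suc J)" using step.IH by simp
  also have "\<dots> = 3 / (1 - b / 4) * (N i / 4 ^ i - N (Suc J) / 4 ^ Suc J)"
    by (simp add: right_diff_distrib)
  finally show ?case .
qed simp

lemma e_quotient_ge:
  assumes "k \<le> N i"
  shows "(real (N (Suc i)) - N i) / 4 ^ Suc i * e k \<le> Suc k * e (Suc k)"
proof (rule tendsto_le[OF sequentially_bot])
  show "(\<lambda>J. Suc k * esym (I J) x (Suc k)) \<longlonglongrightarrow> Suc k * e (Suc k)"
    by (intro tendsto_intros e)
  show "(\<lambda>J. (real (N (Suc i)) - N i) / 4 ^ Suc i * esym (I J) x k) \<longlonglongrightarrow> (real (N (Suc i)) - N i) / 4 ^ Suc i * e k"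
    by (intro tendsto_intros e)
  show "\<forall>\<^sub>F J in sequentially. (real (N (Suc i)) - N i) / 4 ^ Suc i * esym (I J) x k \<le> Suc k * esym (I J) x (Suc k)"
    using eventually_gt_at_top[of i]
  proof eventually_elim
    case (elim J)
    have "(real (N (Suc i)) - N i) / 4 ^ Suc i * esym (I J) x k \<le> (\<Sum>j\<in>I J - I i. x j) * esym (I J) x k"
      using elim x_pos by (intro mult_right_mono tail_ge esym_nonneg) (auto intro: less_imp_le)
    also have "\<dots> \<le> Suc k * esym (I J) x (Suc k)"
    proof (rule Suc_esym_Suc_ge)
      show "I i \<subseteq> I J" using elim by (intro I_mono) simp
      show "x l \<le> x j" if "j \<in> I i" "l \<in> I J - I i" for j l
        using x_ge[OF that(1)] x_le[OF that(2)] by simp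
    qed (use fin x_pos assms in \<open>auto intro: less_imp_le\<close>)
    finally show ?case .
  qed
qed

lemma e_quotient_le:
  fixes b :: real
  assumes b: "b < 4" and growth: "\<And>l. l \<ge> i \<Longrightarrow> N (Suc l) \<le> b * N l"
  shows "(real (Suc k) - N i) * e (Suc k) \<le> 3 / (1 - b / 4) * (N i / 4 ^ i) * e k"
proof (rule tendsto_le[OF sequentially_bot])
  show "(\<lambda>J. (real (Suc k) - N i) * esym (I J) x (Suc k)) \<longlonglongrightarrow> (real (Suc k) - N i) * e (Suc k)"
    by (intro tendsto_intros e)
  show "(\<lambda>J. 3 / (1 - b / 4) * (N i / 4 ^ i) * esym (I J) x k) \<longlonglongrightarrow> 3 / (1 - b / 4) * (N i / 4 ^ i) * e k"
    by (intro tendsto_intros e)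
  show "\<forall>\<^sub>F J in sequentially. (real (Suc k) - N i) * esym (I J) x (Suc k) \<le> 3 / (1 - b / 4) * (N i / 4 ^ i) * esym (I J) x k"
    using eventually_ge_at_top[of i]
  proof eventually_elim
    case (elim J)
    have "(real (Suc k) - N i) * esym (I J) x (Suc k) \<le> (\<Sum>j\<in>I J - I i. x j) * esym (I J) x k"
      using fin x_pos I_mono[OF elim] by (intro Suc_esym_Suc_le) (auto intro: less_imp_le)
    also have "\<dots> \<le> 3 / (1 - b / 4) * (N i / 4 ^ i) * esym (I J) x k"
    proof (intro mult_right_mono esym_nonneg)
      have "(\<Sum>j\<in>I J - I i. x j) \<le> 3 / (1 - b / 4) * (N i / 4 ^ i - N J / 4 ^ J)"
        using b growth elim by (rule tail_le)
      also have "\<dots> \<le> 3 / (1 - b / 4) * (N i / 4 ^ i)"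
        using b by (intro mult_left_mono) auto
      finally show "(\<Sum>j\<in>I J - I i. x j) \<le> 3 / (1 - b / 4) * (N i / 4 ^ i)" .
    qed (use x_pos in \<open>auto intro: less_imp_le\<close>)
    finally show ?case .
  qed
qed

text \<open>The derivatives at 0 of \<open>w^m * (\<Prod>j. 1 + x j * w)\<close>, where \<open>e\<close> plays the part of the elementary symmetric
functions of the infinite family.\<close>
definition taylor :: "nat \<Rightarrow> nat \<Rightarrow> real" where
  "taylor m n = (if n < m then 0 else fact n * e (n - m))"

lemma taylor_pos: "n \<ge> m \<Longrightarrow> taylor m n > 0"
  by (simp add: taylor_def e_pos)

text \<open>For the partial products \<open>w^m * (\<Prod>j\<in>I i. 1 + x j * w)\<close> this is \<open>newton_identities_derivative\<close>; the assertion is stable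
under limits. The index \<open>i\<close> has to be so large that the \<open>n\<close>-th derivative at 0 does not vanish.\<close>
lemma power_sums_exist:
  assumes n: "n \<ge> m"
  shows "\<exists>p. newton_identities (\<lambda>k. taylor m (n + k) / (taylor m n * fact k)) p \<and> moment_inequalities p"
proof -
  define a where "a i l = (if l < m then 0 else esym (I i) x (l - m))" for i l
  define Q where "Q i = (monom 1 m * (\<Prod>j\<in>I i. [:1, of_real (x j):]) :: complex poly)" for i
  have Q: "nonpos_real_roots (Q i)" for i
    unfolding nonpos_real_roots_def
  proof (intro allI impI)
    fix z assume "poly (Q i) z = 0"
    hence "z = 0 \<or> (\<exists>j\<in>I i. 1 + z * of_real (x j) = 0)"
      using fin by (auto simp: Q_def poly_prod poly_monom)
    moreover have "Im z = 0 \<and> Re z \<le> 0" if j: "j \<in> I i" "1 + z * of_real (x j) = 0" for j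
    proof -
      have "Im z * x j = 0" "1 + Re z * x j = 0"
        using arg_cong[OF j(2), of Im] arg_cong[OF j(2), of Re] by auto
      hence "Im z = 0" "Re z * x j < 0" using x_pos[OF j(1)] by auto
      thus ?thesis using x_pos[OF j(1)] by (auto simp: mult_less_0_iff)
    qed
    ultimately show "Im z = 0 \<and> Re z \<le> 0" by auto
  qed
  have coeff: "coeff (Q i) l = of_real (a i l)" for i l
    by (simp add: Q_def a_def coeff_monom_mult coeff_prod_linear[OF fin] esym_of_real)
  obtain i0 where i0: "\<And>i. i \<ge> i0 \<Longrightarrow> N i \<ge> n - m"
    using N_unbounded unfolding filterlim_at_top eventually_sequentially by blast
  define A where "A i k = fact (n + k) / (fact n * fact k) * a (i + i0) (n + k) / a (i + i0) n" for i k
  have "\<exists>q. newton_identities (A i) q \<and> moment_inequalities q" for i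
  proof -
    have "a (i + i0) n > 0"
      using n fin x_pos i0[of "i + i0"] by (auto simp: a_def intro!: esym_pos)
    hence nz: "coeff (Q (i + i0)) n \<noteq> 0" by (simp add: coeff)
    show ?thesis
      unfolding A_def[abs_def] by (rule newton_identities_derivative[OF Q nz]) (rule coeff)
  qed
  hence "\<forall>i. \<exists>q. newton_identities (A i) q \<and> moment_inequalities q" by blast
  from choice[OF this] obtain P where
    P: "\<And>i. newton_identities (A i) (P i)" "\<And>i. moment_inequalities (P i)"
    by blast
  have lim_a: "(\<lambda>i. a (i + i0) l) \<longlonglongrightarrow> e (l - m)" if "l \<ge> m" for l
    using LIMSEQ_ignore_initial_segment[OF e, of i0 "l - m"] that by (simp add: a_def)
  have lim: "(\<lambda>i. A i k) \<longlonglongrightarrow> taylor m (n + k) / (taylor m n * fact k)" for k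
  proof -
    have "(\<lambda>i. fact (n + k) / (fact n * fact k) * a (i + i0) (n + k) / a (i + i0) n)
        \<longlonglongrightarrow> fact (n + k) / (fact n * fact k) * e (n + k - m) / e (n - m)"
      using n e_pos[of "n - m"] by (intro tendsto_divide tendsto_mult tendsto_const lim_a) auto
    thus ?thesis using n by (simp add: A_def taylor_def mult_ac)
  qed
  from newton_identities_limit[of A P, OF P(1) lim] obtain p where
    "newton_identities (\<lambda>k. taylor m (n + k) / (taylor m n * fact k)) p"
    "\<And>k. k > 0 \<Longrightarrow> (\<lambda>i. P i k) \<longlonglongrightarrow> p k"
    by blast
  thus ?thesis using moment_inequalities_limit[of P p, OF P(2)] by blast
qed

text \<open>The counting lemmas \<open>e_quotient_ge\<close> and \<open>e_quotient_le\<close> supply the two-sided bounds for \<open>h\<close> required by \<open>p_3_over_p_2_tendsto_0\<close>.\<close>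
lemma clustering: "\<exists>p. clustering_power_sums (taylor m) p m"
proof -
  obtain p where p: "\<And>n. n \<ge> m \<Longrightarrow> newton_identities (\<lambda>k. taylor m (n + k) / (taylor m n * fact k)) (p n) \<and> moment_inequalities (p n)"
    
  proof -
    have "\<forall>n. \<exists>q. n \<ge> m \<longrightarrow> newton_identities (\<lambda>k. taylor m (n + k) / (taylor m n * fact k)) q \<and> moment_inequalities q"
      using power_sums_exist by blast
    from choice[OF this] show ?thesis using that by blast
  qed
  interpret root_power_sums "taylor m" p m
    by unfold_locales (use p taylor_pos in auto)
  \<comment> \<open>growth factors with \<open>1 < b1 < \<beta> < b2 < 4\<close>, valid from the level \<open>i0\<close> onwards\<close>
  define b1 where "b1 = (1 + \<beta>) / 2"
  define b2 where "b2 = (4 + \<beta>) / 2"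
  have b: "1 < b1" "b1 < \<beta>" "\<beta> < b2" "b2 < 4" using ratio by (auto simp: b1_def b2_def)
  have "\<forall>\<^sub>F i in sequentially. 2 * m \<le> N i"
    using N_unbounded by (auto simp: filterlim_at_top)
  with N_growth[OF b(1-3)]
  have "\<forall>\<^sub>F i in sequentially. (N i > 0 \<and> b1 * N i \<le> N (Suc i) \<and> N (Suc i) \<le> b2 * N i) \<and> 2 * m \<le> N i"
    by (rule eventually_conj)
  then obtain i0 where i0: "\<And>i. i \<ge> i0 \<Longrightarrow> (N i > 0 \<and> b1 * N i \<le> N (Suc i) \<and> N (Suc i) \<le> b2 * N i) \<and> 2 * m \<le> N i"
    unfolding eventually_sequentially by blast
  define K where "K = 3 / (1 - b2 / 4)"
  have K: "K > 0" using b by (simp add: K_def)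
  have h_eq: "h n = Suc n * e (Suc (n - m)) / e (n - m)" if "n \<ge> m" for n
  proof -
    have "h n = (fact n * (Suc n * e (Suc (n - m)))) / (fact n * e (n - m))"
      using that by (simp add: h_def taylor_def Suc_diff_le del: of_nat_Suc)
    thus ?thesis by (subst (asm) mult_divide_mult_cancel_left) auto
  qed
  have lower: "(b1 - 1) / 4 ^ Suc i0 * (N (i + i0) / 4 ^ i) \<le> h n" if n: "m \<le> n" "n \<le> N (i + i0) + m" for i n
    proof -
      define k where "k = n - m"
      have "(b1 - 1) * N (i + i0) \<le> real (N (Suc (i + i0))) - N (i + i0)"
        using i0[of "i + i0"] by (simp add: algebra_simps)
      hence "(b1 - 1) * N (i + i0) / 4 ^ Suc (i + i0) * e k \<le>
          (real (N (Suc (i + i0))) - N (i + i0)) / 4 ^ Suc (i + i0) * e k"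
        using e_pos[of k] by (intro mult_right_mono divide_right_mono) auto
      also have "\<dots> \<le> Suc k * e (Suc k)"
        using n by (intro e_quotient_ge) (simp add: k_def)
      also have "\<dots> \<le> Suc n * e (Suc k)"
        using e_pos[of "Suc k"] by (intro mult_right_mono) (auto simp: k_def)
      finally have "(b1 - 1) * N (i + i0) / 4 ^ Suc (i + i0) \<le> h n"
        using h_eq[OF n(1)] e_pos[of k] by (simp add: k_def pos_le_divide_eq)
      thus ?thesis by (simp add: power_add mult_ac)
    qed
  have upper: "h n \<le> 2 * K / 4 ^ i0 * (N (i + i0) / 4 ^ i)" if n: "2 * N (i + i0) + 2 * m \<le> n" for i n
    proof -
      define k where "k = n - m"
      \<comment> \<open>as \<open>n\<close> is at least \<open>2 * N + 2 * m\<close>, at least half of it remains after the subtraction of \<open>m\<close> and \<open>N\<close>\<close>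
      have "real (Suc n) \<le> 2 * (real (Suc k) - N (i + i0))" using n by (simp add: k_def of_nat_diff)
      hence "Suc n * e (Suc k) \<le> 2 * (real (Suc k) - N (i + i0)) * e (Suc k)"
        using e_pos[of "Suc k"] by (intro mult_right_mono) auto
      also have "\<dots> = 2 * ((real (Suc k) - N (i + i0)) * e (Suc k))"
        by (simp only: mult.assoc)
      also have "\<dots> \<le> 2 * (K * (N (i + i0) / 4 ^ (i + i0)) * e k)"
        unfolding K_def using i0 by (intro mult_left_mono e_quotient_le b) auto
      finally have "h n \<le> 2 * (K * (N (i + i0) / 4 ^ (i + i0)))"
        using h_eq[of n] n e_pos[of k] by (simp add: k_def pos_divide_le_eq mult.assoc)
      thus ?thesis by (simp add: power_add mult_ac)
    qed
  have c: "(b1 - 1) / 4 ^ Suc i0 > 0" using b by simp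
  have grow: "b1 * N (i + i0) \<le> N (Suc i + i0)" "N (Suc i + i0) \<le> b2 * N (i + i0)" for i
    using i0[of "i + i0"] by auto
  have start: "N (0 + i0) > 0" "2 * m \<le> N (0 + i0)" using i0[of i0] by auto
  note lims = p_3_over_p_2_tendsto_0[where N = "\<lambda>i. N (i + i0)", OF b(1) b(4) c grow start lower upper]
  have "clustering_power_sums (taylor m) p m"
    by unfold_locales (rule lims; assumption)+
  thus ?thesis by blast
qed

end

section \<open>Even entire functions and their zero counts\<close>

lemma power_series_entire:
  fixes F :: "complex \<Rightarrow> complex"
  assumes "\<And>w. (\<lambda>k. a k * w ^ k) sums F w"
  shows "F holomorphic_on UNIV" "(deriv ^^ k) F 0 / fact k = a k"
proof -
  have "F holomorphic_on ball 0 r" for r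
    by (rule power_series_holomorphic[of 0 r a]) (use assms in auto)
  moreover have "(UNIV :: complex set) = (\<Union>n. ball 0 (real n))"
    using reals_Archimedean2 by (auto simp: set_eq_iff)
  ultimately show "F holomorphic_on UNIV"
    by (metis holomorphic_on_UN_open open_ball)
  have "F has_fps_expansion Abs_fps a"
    by (rule has_fps_expansionI) (use assms in auto)
  thus "(deriv ^^ k) F 0 / fact k = a k"
    using fps_nth_fps_expansion[of F "Abs_fps a" k] by simp
qed

lemma power_series_unique:
  fixes F :: "complex \<Rightarrow> complex"
  assumes "\<And>w. (\<lambda>k. a k * w ^ k) sums F w" "\<And>w. (\<lambda>k. b k * w ^ k) sums F w"
  shows "a = b"
proof
  fix k show "a k = b k"
    using power_series_entire(2)[of a F k] power_series_entire(2)[of b F k] assms by simp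
qed

lemma entire_order_less_imp_growth:
  assumes holo: "f holomorphic_on UNIV" and order: "entire_order f < 2"
  shows "\<exists>k<2. \<forall>\<^sub>F r in at_top. \<forall>z. norm z \<le> r \<longrightarrow> norm (f z) \<le> exp (r powr k)"
proof -
  obtain k where k: "ereal k < 2" "\<forall>\<^sub>F r in at_top. max_modulus f r \<le> exp (r powr k)"
    using order unfolding entire_order_def Inf_less_iff by auto
  have "norm (f z) \<le> max_modulus f r" if "norm z \<le> r" for z r
    unfolding max_modulus_def
  proof (rule cSUP_upper)
    show "bdd_above ((\<lambda>z. norm (f z)) ` cball 0 r)"
      by (intro bounded_imp_bdd_above compact_imp_bounded compact_continuous_image continuous_intros
          continuous_on_subset[OF holomorphic_on_imp_continuous_on[OF holo]]) auto
  qed (use that in auto)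
  hence "\<forall>\<^sub>F r in at_top. \<forall>z. norm z \<le> r \<longrightarrow> norm (f z) \<le> exp (r powr k)"
    using k(2) by (auto elim!: eventually_mono intro: order_trans)
  moreover have "k < 2" using k(1) by (metis ereal_less_eq(3) ereal_less(2) less_ereal.simps(1) numeral_eq_ereal)
  ultimately show ?thesis by blast
qed

text \<open>Away from 0 the map \<open>z \<mapsto> z\<^sup>2\<close> is a local homeomorphism and the factor \<open>z^l\<close> does not vanish, so multiplicities agree.\<close>
lemma zorder_even_quotient:
  assumes F: "F holomorphic_on UNIV" "F (of_real (x\<^sup>2)) = 0" "F 0 \<noteq> 0" and x: "x > 0"
    and f: "\<And>z. f z = z ^ l * F (z\<^sup>2)"
  shows "zorder f (of_real x) = zorder F (of_real (x\<^sup>2))"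
proof -
  let ?x = "of_real x :: complex" and ?y = "of_real (x\<^sup>2) :: complex"
  have an: "F analytic_on {z}" for z
    using F(1) by (simp add: analytic_on_open holomorphic_on_imp_analytic_at)
  have nz: "\<forall>\<^sub>F w in at z. F w \<noteq> 0" for z
    using non_zero_neighbour_alt[OF F(1), of z 0] F(3) by (auto elim: eventually_mono)
  have sq: "?x\<^sup>2 = ?y" by simp
  have ne: "\<forall>\<^sub>F w in at ?x. w\<^sup>2 \<noteq> ?x\<^sup>2"
  proof -
    have "\<forall>\<^sub>F w in at ?x. w \<noteq> - ?x"
      using x by (intro tendsto_imp_eventually_ne[OF tendsto_ident_at]) auto
    moreover have "\<forall>\<^sub>F w in at ?x. w \<noteq> ?x" by (rule eventually_neq_at_within)
    ultimately show ?thesis by eventually_elim (simp add: power2_eq_iff)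
  qed
  have z1: "zorder (\<lambda>z. z\<^sup>2 - ?x\<^sup>2) ?x = 1"
  proof (rule zorder_eqI[where S = UNIV and g = "\<lambda>z. z + ?x"])
    fix w show "w\<^sup>2 - ?x\<^sup>2 = (w + ?x) * (w - ?x) powi 1"
      by (simp add: power2_eq_square algebra_simps)
  qed (use x in \<open>auto intro!: holomorphic_intros simp flip: of_real_add\<close>)
  have comp: "zorder (F \<circ> (\<lambda>z. z\<^sup>2)) ?x = zorder F (?x\<^sup>2) * zorder (\<lambda>z. z\<^sup>2 - ?x\<^sup>2) ?x"
    using an nz ne
    by (intro zorder_compose' isolated_singularity_at_analytic not_essential_analytic)
       (auto intro!: analytic_intros)
  have nz2: "\<forall>\<^sub>F z in at ?x. z ^ l * (F \<circ> (\<lambda>z. z\<^sup>2)) z \<noteq> 0"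
  proof -
    have "filterlim (\<lambda>z. z\<^sup>2) (at (?x\<^sup>2)) (at ?x)"
      using ne by (auto simp: filterlim_at intro!: tendsto_intros)
    hence "\<forall>\<^sub>F z in at ?x. F (z\<^sup>2) \<noteq> 0" using nz[of "?x\<^sup>2"] unfolding filterlim_iff by blast
    moreover have "\<forall>\<^sub>F z in at ?x. z \<noteq> 0"
      using x by (intro tendsto_imp_eventually_ne[OF tendsto_ident_at]) auto
    ultimately show ?thesis by eventually_elim simp
  qed
  have "zorder (\<lambda>z. z ^ l * (F \<circ> (\<lambda>z. z\<^sup>2)) z) ?x = zorder (\<lambda>z. z ^ l) ?x + zorder (F \<circ> (\<lambda>z. z\<^sup>2)) ?x"
  proof (rule zorder_times_analytic[OF _ _ nz2])
    show "(F \<circ> (\<lambda>z. z\<^sup>2)) analytic_on {?x}"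
      by (rule analytic_on_compose) (use an in \<open>auto intro!: analytic_intros\<close>)
  qed (auto intro!: analytic_intros)
  moreover have "zorder (\<lambda>z. z ^ l) ?x = 0"
    using x by (intro zorder_eq_0I) (auto intro!: analytic_intros)
  moreover have "(\<lambda>z. z ^ l * (F \<circ> (\<lambda>z. z\<^sup>2)) z) = f" by (rule ext) (simp add: f)
  ultimately have "zorder f ?x = 0 + zorder F (?x\<^sup>2) * 1" by (simp only: comp z1)
  thus ?thesis unfolding sq by simp
qed

lemma (in pos_zeros_small_growth) n_plus_eq:
  assumes f: "\<And>z. f z = z ^ l * F (z\<^sup>2)" and r: "r \<ge> 0"
  shows "n_plus f r = (if f 0 = 0 then nat (zorder f 0) else 0) + card (zero_index F (r\<^sup>2))"
proof -
  let ?X = "{x. 0 < x \<and> x \<le> r \<and> f (complex_of_real x) = 0}"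
  have X: "?X = sqrt ` pos_zeros F (r\<^sup>2)"
  proof
    show "?X \<subseteq> sqrt ` pos_zeros F (r\<^sup>2)"
    proof
      fix x assume x: "x \<in> ?X"
      hence "x\<^sup>2 \<in> pos_zeros F (r\<^sup>2)" by (auto simp: pos_zeros_def f intro: power_mono)
      moreover have "x = sqrt (x\<^sup>2)" using x by simp
      ultimately show "x \<in> sqrt ` pos_zeros F (r\<^sup>2)" by blast
    qed
    show "sqrt ` pos_zeros F (r\<^sup>2) \<subseteq> ?X"
      using r by (auto simp: pos_zeros_def f real_le_lsqrt simp flip: of_real_power)
  qed
  have finX: "finite ?X" unfolding X using finite_pos_zeros by blast
  have "(\<Sum>x\<in>?X. nat (zorder f (of_real x))) = (\<Sum>t\<in>pos_zeros F (r\<^sup>2). nat (zorder f (of_real (sqrt t))))"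
    unfolding X by (subst sum.reindex) (auto simp: inj_on_def)
  also have "\<dots> = (\<Sum>t\<in>pos_zeros F (r\<^sup>2). nat (zorder F (of_real t)))"
  proof (intro sum.cong refl)
    fix t assume t: "t \<in> pos_zeros F (r\<^sup>2)"
    hence "(sqrt t)\<^sup>2 = t" "F (of_real t) = 0" "sqrt t > 0" by (auto simp: pos_zeros_def)
    thus "nat (zorder f (of_real (sqrt t))) = nat (zorder F (of_real t))"
      using zorder_even_quotient[OF holo _ F0 _ f, of "sqrt t"] by simp
  qed
  also have "\<dots> = card (zero_index F (r\<^sup>2))"
    unfolding zero_index_def using finite_pos_zeros by (subst card_SigmaI) auto
  finally have pos: "(\<Sum>x\<in>?X. nat (zorder f (of_real x))) = card (zero_index F (r\<^sup>2))" .
  have "{x. 0 \<le> x \<and> x \<le> r \<and> f (complex_of_real x) = 0} = ?X \<union> (if f 0 = 0 then {0} else {})"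
    using r by (auto simp: order_le_less)
  hence "n_plus f r = (\<Sum>x\<in>?X \<union> (if f 0 = 0 then {0} else {}). nat (zorder f (of_real x)))"
    by (simp add: n_plus_def)
  also have "\<dots> = (\<Sum>x\<in>?X. nat (zorder f (of_real x))) + (if f 0 = 0 then nat (zorder f 0) else 0)"
    using finX by (subst sum.union_disjoint) auto
  finally show ?thesis using pos by simp
qed

text \<open>The zero of \<open>f\<close> at the origin adds a constant to the counting function. It does not affect the limit because \<open>\<beta> > 1\<close>
forces the counting function to be unbounded. A denominator 0 would give the quotient 0, which is excluded eventually.\<close>
lemma ratio_tendsto_minus_const:
  fixes N :: "nat \<Rightarrow> nat" and c :: nat
  assumes lim: "(\<lambda>i. real (c + N (Suc i)) / real (c + N i)) \<longlonglongrightarrow> \<beta>" and \<beta>: "\<beta> > 1"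
  shows "(\<lambda>i. real (N (Suc i)) / real (N i)) \<longlonglongrightarrow> \<beta>"
proof -
  define M where "M i = c + N i" for i
  define b where "b = (1 + \<beta>) / 2"
  have b: "1 < b" "b < \<beta>" using \<beta> by (auto simp: b_def)
  obtain i0 where i0: "\<And>i. i \<ge> i0 \<Longrightarrow> b < real (M (Suc i)) / M i"
    using order_tendstoD(1)[OF lim b(2)] unfolding eventually_sequentially M_def by blast
  have increase: "M i < M (Suc i)" if i: "i \<ge> i0" for i
  proof (cases "M i = 0")
    case True
    thus ?thesis using i0[OF i] b by simp
  next
    case False
    hence "b * M i < M (Suc i)" using i0[OF i] by (simp add: field_simps)
    moreover have "1 * real (M i) < b * M i" using b False by (intro mult_strict_right_mono) auto
    ultimately show ?thesis by linarith
  qed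
  have "i \<le> M (i + i0)" for i
  proof (induction i)
    case (Suc i)
    thus ?case using increase[of "i + i0"] by simp
  qed simp
  hence "filterlim (\<lambda>i. M (i + i0)) at_top sequentially"
    by (intro filterlim_at_top_mono[OF filterlim_ident]) auto
  hence "filterlim (\<lambda>i. real (M (i + i0))) at_top sequentially"
    by (rule filterlim_compose[OF filterlim_real_sequentially])
  hence c0: "(\<lambda>i. c / real (M (i + i0))) \<longlonglongrightarrow> 0"
    by (rule real_tendsto_divide_at_top[OF tendsto_const])
  have "(\<lambda>i. (real (M (Suc (i + i0))) / M (i + i0) - c / M (i + i0)) / (1 - c / M (i + i0))) \<longlonglongrightarrow> (\<beta> - 0) / (1 - 0)"
    by (intro tendsto_divide tendsto_diff tendsto_const c0 LIMSEQ_ignore_initial_segment[OF lim[folded M_def]]) auto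
  moreover have "\<forall>\<^sub>F i in sequentially. (real (M (Suc (i + i0))) / M (i + i0) - c / M (i + i0)) / (1 - c / M (i + i0)) =
      real (N (Suc (i + i0))) / N (i + i0)"
    using eventually_gt_at_top[of 0]
  proof eventually_elim
    case (elim i)
    have "M (i + i0) > 0" using \<open>i \<le> M (i + i0)\<close> elim by simp
    hence "real (M (i + i0)) > 0" by simp
    moreover have "real (N (Suc (i + i0))) = M (Suc (i + i0)) - real c" "real (N (i + i0)) = M (i + i0) - real c"
      by (auto simp: M_def)
    moreover from calculation(1) have "1 - c / M (i + i0) = (M (i + i0) - real c) / M (i + i0)"
      by (simp add: diff_divide_distrib)
    ultimately show ?case by (simp add: diff_divide_distrib[symmetric])
  qed
  ultimately have "(\<lambda>i. real (N (Suc (i + i0))) / N (i + i0)) \<longlonglongrightarrow> (\<beta> - 0) / (1 - 0)"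
    by (rule Lim_transform_eventually)
  hence "(\<lambda>i. real (N (Suc (i + i0))) / N (i + i0)) \<longlonglongrightarrow> \<beta>" by simp
  thus ?thesis by (rule LIMSEQ_offset)
qed

lemma gamma_ratio:
  fixes \<gamma> \<eta> :: "nat \<Rightarrow> complex"
  assumes \<gamma>: "\<And>k. \<gamma> (2 * k) = \<eta> k * fact (2 * k) / fact k"
  shows "\<gamma> (2 * k) / \<gamma> (2 * Suc k) = \<eta> k / \<eta> (Suc k) / (2 * of_nat (2 * k + 1))"
proof -
  define A :: complex where "A = of_nat (2 * k + 1)"
  define B :: complex where "B = of_nat (Suc k)"
  have B: "B \<noteq> 0" unfolding B_def of_nat_eq_0_iff by simp
  have "fact (2 * Suc k) = (of_nat (2 * Suc k) * (of_nat (2 * k + 1) * fact (2 * k)) :: complex)"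
    by simp
  also have "of_nat (2 * Suc k) = 2 * B" by (simp add: B_def)
  finally have 1: "fact (2 * Suc k) = 2 * B * A * fact (2 * k)" by (simp only: A_def mult.assoc)
  have 2: "fact (Suc k) = B * fact k" by (simp add: B_def)
  have "\<gamma> (2 * k) / \<gamma> (2 * Suc k) = \<eta> k / \<eta> (Suc k) / (2 * A)"
    unfolding \<gamma> 1 2 using B by simp
  thus ?thesis by (simp only: A_def)
qed

text \<open>In terms of \<open>\<eta>\<close> all factorials cancel. With \<open>u\<^sub>j = \<eta> (n + d - j) / \<eta> (n + d)\<close> the shift is \<open>- u\<^sub>1\<close> and the scale
is \<open>u\<^sub>1\<^sup>2 - u\<^sub>2\<close>.\<close>
lemma b_shift_eq:
  fixes \<gamma> \<eta> :: "nat \<Rightarrow> complex"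
  assumes \<gamma>: "\<And>k. \<gamma> (2 * k) = \<eta> k * fact (2 * k) / fact k" and nd: "n + d = Suc (Suc k)"
  shows "b_shift \<gamma> d n = - (\<eta> (Suc k) / \<eta> (Suc (Suc k)))"
proof -
  define A :: complex where "A = of_nat (2 * Suc k + 1)"
  have A: "A \<noteq> 0" unfolding A_def of_nat_eq_0_iff by simp
  have A_eq: "2 * of_nat (Suc (Suc k)) - 1 = A" by (simp add: A_def)
  have "Suc (Suc k) - 1 = Suc k" by simp
  hence "b_shift \<gamma> d n = - 2 * A * (\<gamma> (2 * Suc k) / \<gamma> (2 * Suc (Suc k)))"
    unfolding b_shift_def nd A_eq by (simp only:)
  also have "\<dots> = - (\<eta> (Suc k) / \<eta> (Suc (Suc k)))"
    unfolding gamma_ratio[OF \<gamma>] A_def[symmetric] using A by simp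
  finally show ?thesis .
qed

lemma c_scale_eq:
  fixes \<gamma> \<eta> :: "nat \<Rightarrow> complex"
  assumes \<gamma>: "\<And>k. \<gamma> (2 * k) = \<eta> k * fact (2 * k) / fact k" and nd: "n + d = Suc (Suc k)"
    and nz: "\<eta> (Suc k) \<noteq> 0"
  shows "c_scale \<gamma> d n = (\<eta> (Suc k) / \<eta> (Suc (Suc k)))\<^sup>2 - \<eta> k / \<eta> (Suc (Suc k))"
proof -
  define A :: complex where "A = of_nat (2 * Suc k + 1)"
  define B :: complex where "B = of_nat (2 * k + 1)"
  have nz': "A \<noteq> 0" "B \<noteq> 0" unfolding A_def B_def of_nat_eq_0_iff by simp_all
  have A_eq: "2 * of_nat (Suc (Suc k)) - 1 = A" and B_eq: "2 * of_nat (Suc (Suc k)) - 3 = B"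
    by (simp_all add: A_def B_def)
  have idx: "2 * Suc (Suc k) - 2 = 2 * Suc k" "2 * Suc (Suc k) - 4 = 2 * k" by simp_all
  have g1: "\<gamma> (2 * Suc k) / \<gamma> (2 * Suc (Suc k)) = \<eta> (Suc k) / \<eta> (Suc (Suc k)) / (2 * A)"
    unfolding gamma_ratio[OF \<gamma>] A_def ..
  have "\<gamma> (2 * Suc k) \<noteq> 0" 
    unfolding \<gamma> divide_eq_0_iff mult_eq_0_iff using nz fact_nonzero by blast
  hence "\<gamma> (2 * k) / \<gamma> (2 * Suc (Suc k)) =
      (\<gamma> (2 * k) / \<gamma> (2 * Suc k)) * (\<gamma> (2 * Suc k) / \<gamma> (2 * Suc (Suc k)))"
    by (simp del: mult_Suc_right)
  also have "\<dots> = (\<eta> k / \<eta> (Suc k) / (2 * B)) * (\<eta> (Suc k) / \<eta> (Suc (Suc k)) / (2 * A))"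
    unfolding gamma_ratio[OF \<gamma>] A_def B_def ..
  also have "\<dots> = \<eta> k / \<eta> (Suc (Suc k)) / (4 * A * B)"
    using nz by simp
  finally have g2: "\<gamma> (2 * k) / \<gamma> (2 * Suc (Suc k)) = \<eta> k / \<eta> (Suc (Suc k)) / (4 * A * B)" .
  have "4 * A\<^sup>2 * ((u / (2 * A))\<^sup>2 - B / A * (v / (4 * A * B))) = u\<^sup>2 - v" for u v
    using nz' by (simp add: field_simps power2_eq_square)
  thus ?thesis unfolding c_scale_def nd A_eq B_eq idx g1 g2 .
qed

theorem theorem2p6:
  fixes f :: "complex \<Rightarrow> complex" and \<gamma> \<eta> :: "nat \<Rightarrow> complex" and d :: nat
  assumes entire: "f holomorphic_on UNIV"
    and even_f: "\<And>z. f (- z) = f z"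
    and order_less_2: "entire_order f < 2"
    and real_on_real: "\<And>x. x \<in> \<real> \<Longrightarrow> f x \<in> \<real>"
    and real_roots: "\<And>z. f z = 0 \<Longrightarrow> z \<in> \<real>"
    and gamma_series: "\<And>z. (\<lambda>k. \<gamma> (2 * k) * (z ^ (2 * k) / fact (2 * k))) sums f z"
    and eta_series: "\<And>z. (\<lambda>k. \<eta> k * (z ^ (2 * k) / fact k)) sums f z"
    and regular_variation: "\<exists>\<alpha>\<in>{0<..<2::real}. \<forall>x>0.
          ((\<lambda>r. real (n_plus f (x * r)) / real (n_plus f r)) \<longlongrightarrow> x powr \<alpha>) at_top"
  shows "\<forall>K. compact K \<longrightarrow>
           uniform_limit K
             (\<lambda>n z. c_scale \<gamma> d n powr (- of_nat d / 2) / \<eta> (n + d)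
                     * even_jensen \<eta> d n (csqrt (c_scale \<gamma> d n) * z + b_shift \<gamma> d n))
             (He d) sequentially"
proof -
  \<comment> \<open>by evenness it does not matter which square root is chosen\<close>
  define F where "F w = f (csqrt w)" for w
  have F_series: "(\<lambda>k. \<eta> k / fact k * w ^ k) sums F w" for w
    using eta_series[of "csqrt w"] by (simp add: F_def power_mult)
  have f_eq_F: "f z = F (z\<^sup>2)" for z
  proof -
    have "(csqrt (z\<^sup>2))\<^sup>2 = z\<^sup>2" by simp
    hence "csqrt (z\<^sup>2) = z \<or> csqrt (z\<^sup>2) = - z" by (simp only: power2_eq_iff)
    thus ?thesis using even_f[of z] by (auto simp: F_def)
  qed
  have \<gamma>: "\<gamma> (2 * k) = \<eta> k * fact (2 * k) / fact k" for k
  proof -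
    have "(\<lambda>k. \<gamma> (2 * k) / fact (2 * k) * w ^ k) sums F w" for w
      using gamma_series[of "csqrt w"] by (simp add: F_def power_mult)
    from fun_cong[OF power_series_unique[OF this F_series], of k] show ?thesis
      by (simp add: field_simps)
  qed
  obtain m where m: "\<eta> m \<noteq> 0" "\<And>k. k < m \<Longrightarrow> \<eta> k = 0"
  proof -
    have "\<exists>k. \<eta> k \<noteq> 0"
    proof (rule ccontr)
      assume "\<nexists>k. \<eta> k \<noteq> 0"
      hence "(\<lambda>k. 0) sums f \<i>" using eta_series[of \<i>] by simp
      hence "f \<i> = 0" using sums_unique2[OF sums_zero] by simp
      thus False using real_roots[of \<i>] by (simp add: complex_is_Real_iff)
    qed
    hence "\<eta> (LEAST k. \<eta> k \<noteq> 0) \<noteq> 0" by (rule LeastI_ex)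
    moreover have "\<eta> k = 0" if "k < (LEAST k. \<eta> k \<noteq> 0)" for k
      using not_less_Least[OF that] by simp
    ultimately show ?thesis by (rule that)
  qed
  \<comment> \<open>\<open>G\<close> is \<open>F\<close> with the zero of order \<open>m\<close> at the origin divided out\<close>
  define G where "G w = (if w = 0 then \<eta> m / fact m else F w / w ^ m)" for w
  have G_series: "(\<lambda>k. \<eta> (k + m) / fact (k + m) * w ^ k) sums G w" for w
  proof (cases "w = 0")
    case True
    have "(\<lambda>k. \<eta> (k + m) / fact (k + m) * 0 ^ k) sums (\<eta> (0 + m) / fact (0 + m))"
      using powser_sums_zero[of "\<lambda>k. \<eta> (k + m) / fact (k + m)"] by simp
    thus ?thesis using True by (simp add: G_def)
  next
    case False
    have "(\<Sum>k<m. \<eta> k / fact k * w ^ k) = 0" using m(2) by simp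
    hence "(\<lambda>k. \<eta> (k + m) / fact (k + m) * w ^ (k + m)) sums F w"
      using sums_split_initial_segment[OF F_series[of w], of m] by simp
    hence "(\<lambda>k. \<eta> (k + m) / fact (k + m) * w ^ (k + m) / w ^ m) sums (F w / w ^ m)"
      by (rule sums_divide)
    thus ?thesis using False by (simp add: G_def power_add)
  qed
  have F_eq_G: "F w = w ^ m * G w" for w
  proof (cases "w = 0")
    case True
    have "F 0 = \<eta> 0"
      using power_series_entire(2)[OF F_series, of 0] by simp
    thus ?thesis using True m(2)[of 0] by (cases "m = 0") (auto simp: G_def)
  qed (simp add: G_def)
  have f_eq_G: "f z = z ^ (2 * m) * G (z\<^sup>2)" for z
    by (simp add: f_eq_F F_eq_G power_mult)
  have G_coeff: "(deriv ^^ k) G 0 / fact k = \<eta> (k + m) / fact (k + m)" for k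
    by (rule power_series_entire(2)[OF G_series])
  have G_holo: "G holomorphic_on UNIV" by (rule power_series_entire(1)[OF G_series])
  have G0: "G 0 \<noteq> 0" using m by (simp add: G_def)
  obtain \<kappa> where \<kappa>: "\<kappa> < 2" "\<forall>\<^sub>F r in at_top. \<forall>z. norm z \<le> r \<longrightarrow> norm (f z) \<le> exp (r powr \<kappa>)"
    using entire_order_less_imp_growth[OF entire order_less_2] by blast
  interpret G: pos_zeros_small_growth G "\<kappa> / 2"
  proof
    show "w \<in> \<real> \<and> Re w > 0" if "G w = 0" for w
    proof -
      have "w \<noteq> 0" using that G0 by auto
      have "f (csqrt w) = 0" using that by (simp add: f_eq_G)
      then obtain t where t: "csqrt w = of_real t" using real_roots Reals_cases by blast
      have w: "w = of_real (t\<^sup>2)" using power2_csqrt[of w] by (simp add: t)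
      moreover have "t \<noteq> 0" using \<open>w \<noteq> 0\<close> w by auto
      ultimately show ?thesis by simp
    qed
    have "filterlim sqrt at_top at_top" by (rule sqrt_at_top)
    hence "\<forall>\<^sub>F r in at_top. \<forall>z. norm z \<le> sqrt r \<longrightarrow> norm (f z) \<le> exp (sqrt r powr \<kappa>)"
      using \<kappa>(2) unfolding filterlim_iff by blast
    thus "\<forall>\<^sub>F r in at_top. \<forall>w. norm w \<le> r \<longrightarrow> norm (G w) \<le> exp (r powr (\<kappa> / 2))"
      using eventually_ge_at_top[of 1]
    proof eventually_elim
      case (elim r)
      have sqrt_powr: "sqrt r powr \<kappa> = r powr (\<kappa> / 2)"
        using elim(2) by (simp add: powr_half_sqrt[symmetric] powr_powr)
      show ?case
      proof (intro allI impI)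
        fix w :: complex assume w: "norm w \<le> r"
        \<comment> \<open>on the circle of radius \<open>r \<ge> 1\<close> division by \<open>w^m\<close> does not increase the modulus\<close>
        show "norm (G w) \<le> exp (r powr (\<kappa> / 2))"
        proof (rule maximum_modulus_frontier[of G "cball 0 r"])
          show "G holomorphic_on interior (cball 0 r)" using G_holo by (rule holomorphic_on_subset) simp
          show "continuous_on (closure (cball 0 r)) G"
            using G_holo by (intro holomorphic_on_imp_continuous_on) (rule holomorphic_on_subset, auto)
          fix z assume "z \<in> frontier (cball (0 :: complex) r)"
          hence z: "norm z = r" using elim(2) by (simp add: frontier_cball)
          have "norm (csqrt z) \<le> sqrt r" using z by (simp add: norm_csqrt)
          hence "norm (F z) \<le> exp (r powr (\<kappa> / 2))" using elim(1) by (simp add: F_def sqrt_powr)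
          hence "norm z ^ m * norm (G z) \<le> exp (r powr (\<kappa> / 2))"
            by (simp add: F_eq_G norm_mult norm_power)
          moreover have "1 * norm (G z) \<le> norm z ^ m * norm (G z)"
            using z elim(2) by (intro mult_right_mono one_le_power) auto
          ultimately show "norm (G z) \<le> exp (r powr (\<kappa> / 2))" by linarith
        qed (use w in auto)
      qed
    qed
  qed (use G_holo G0 \<kappa> in auto)
  obtain \<alpha> where \<alpha>: "0 < \<alpha>" "\<alpha> < 2"
    "\<And>x. x > 0 \<Longrightarrow> ((\<lambda>r. real (n_plus f (x * r)) / real (n_plus f r)) \<longlongrightarrow> x powr \<alpha>) at_top"
    using regular_variation by auto
  define c where "c = (if f 0 = 0 then nat (zorder f 0) else 0)"
  have n_plus: "n_plus f (2 ^ i) = c + card (zero_index G (4 ^ i))" for i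
    using G.n_plus_eq[OF f_eq_G, of "2 ^ i"] by (simp add: c_def power2_eq_square flip: power_mult_distrib)
  have "filterlim (\<lambda>i. 2 ^ i :: real) at_top sequentially"
    by (rule filterlim_at_top_mono[OF filterlim_real_sequentially])
       (auto intro!: always_eventually less_imp_le of_nat_less_two_power)
  from filterlim_compose[OF \<alpha>(3)[of 2] this]
  have "(\<lambda>i. real (n_plus f (2 ^ Suc i)) / real (n_plus f (2 ^ i))) \<longlonglongrightarrow> 2 powr \<alpha>" by simp
  hence ratio: "(\<lambda>i. real (card (zero_index G (4 ^ Suc i))) / real (card (zero_index G (4 ^ i)))) \<longlonglongrightarrow> 2 powr \<alpha>"
    unfolding n_plus by (rule ratio_tendsto_minus_const) (use \<alpha> in auto)
  \<comment> \<open>the limits are real because the partial products have real roots\<close>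
  define e where "e k = lim (\<lambda>i. esym (zero_index G (4 ^ i)) G.root_inv k)" for k
  have e: "(\<lambda>i. esym (zero_index G (4 ^ i)) G.root_inv k) \<longlonglongrightarrow> e k \<and>
      of_real (e k) = (-1) ^ k * (\<eta> (k + m) / fact (k + m)) / G 0" for k
  proof -
    note lim = G.esym_tendsto[of k, unfolded G_coeff]
    have "(\<lambda>i. Re (of_real (esym (zero_index G (4 ^ i)) G.root_inv k))) \<longlonglongrightarrow>
        Re ((-1) ^ k * (\<eta> (k + m) / fact (k + m)) / G 0)"
      by (intro tendsto_Re lim)
    hence "(\<lambda>i. esym (zero_index G (4 ^ i)) G.root_inv k) \<longlonglongrightarrow> e k"
      unfolding e_def by (simp add: convergentI convergent_LIMSEQ_iff[symmetric])
    thus ?thesis using LIMSEQ_unique[OF lim tendsto_of_real] by auto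
  qed
  interpret R: regular_roots "\<lambda>i. zero_index G (4 ^ i)" G.root_inv e "2 powr \<alpha>"
  proof
    show "finite (zero_index G (4 ^ i))" for i by (rule G.finite_zero_index)
    show "zero_index G (4 ^ i) \<subseteq> zero_index G (4 ^ Suc i)" for i
      using power_increasing[of i "Suc i" "4 :: real"]
      by (auto simp: zero_index_def pos_zeros_def intro: order_trans)
    show "G.root_inv j \<ge> 1 / 4 ^ i" if "j \<in> zero_index G (4 ^ i)" for j i
      using that by (auto simp: zero_index_def pos_zeros_def G.root_inv_def intro!: divide_left_mono)
    show "G.root_inv j \<le> 1 / 4 ^ l" if "j \<in> zero_index G (4 ^ i) - zero_index G (4 ^ l)" for j i l
      using that by (auto simp: zero_index_def pos_zeros_def G.root_inv_def intro!: divide_left_mono)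
    show "2 powr \<alpha> < 4" using \<alpha> powr_less_mono[of \<alpha> 2 2] by simp
  qed (use e ratio \<alpha> in auto)
  obtain p where "clustering_power_sums (R.taylor m) p m" using R.clustering by blast
  then interpret P: clustering_power_sums "R.taylor m" p m .
  define C where "C = (-1) ^ m * G 0"
  have C: "C \<noteq> 0" using G0 by (simp add: C_def)
  have \<eta>: "\<eta> k = C * (-1) ^ k * of_real (R.taylor m k)" if k: "k \<ge> m" for k
  proof -
    have "of_real (R.taylor m k) = fact k * ((-1) ^ (k - m) * (\<eta> k / fact k) / G 0)"
      using e[of "k - m"] k by (simp add: R.taylor_def)
    moreover have "(-1) ^ m * (-1) ^ k * (-1) ^ (k - m) = (1 :: complex)"
    proof -
      have "(-1) ^ m * (-1) ^ k * (-1) ^ (k - m) = ((-1) ^ (k + k) :: complex)"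
        using k by (simp flip: power_add)
      thus ?thesis by (simp flip: mult_2)
    qed
    ultimately show ?thesis using G0 by (simp add: C_def mult_ac)
  qed
  have \<eta>_ratio: "\<eta> k / \<eta> (Suc k) = - of_real (1 / P.h k)" if k: "k \<ge> m" for k
  proof -
    have "R.taylor m k > 0" "R.taylor m (Suc k) > 0" using k by (auto intro: P.g_pos)
    thus ?thesis using \<eta>[of k] \<eta>[of "Suc k"] k C by (simp add: P.h_def)
  qed
  have scale: "\<forall>\<^sub>F n in sequentially. b_shift \<gamma> d n = of_real (1 / P.h (n + d - 1)) \<and>
      csqrt (c_scale \<gamma> d n) = of_real (1 / P.h (n + d - 1) * P.slope d n) \<and>
      c_scale \<gamma> d n powr (- of_nat d / 2) = 1 / of_real (1 / P.h (n + d - 1) * P.slope d n) ^ d"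
  proof -
    have ev: "\<forall>\<^sub>F n in sequentially. n \<ge> m \<and> P.\<sigma> n > 0"
      using P.\<sigma>_pos eventually_ge_at_top[of m] by (simp add: eventually_conj_iff)
    then obtain M\<^sub>0 where M\<^sub>0: "\<And>n. n \<ge> M\<^sub>0 \<Longrightarrow> n \<ge> m \<and> P.\<sigma> n > 0"
      unfolding eventually_sequentially by blast
    have "\<forall>\<^sub>F n in sequentially. n \<ge> M\<^sub>0 + 2" by (rule eventually_ge_at_top)
    thus ?thesis
    proof eventually_elim
      case (elim n)
      define k where "k = n + d - 2"
      have nd: "n + d = Suc (Suc k)" using elim by (simp add: k_def)
      have k: "k \<ge> m" "P.\<sigma> k > 0" using M\<^sub>0[of k] elim by (auto simp: k_def)
      have h: "P.h k > 0" "P.h (Suc k) > 0" using k by (auto intro: P.h_pos)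
      \<comment> \<open>the positive square root of the scale\<close>
      define \<tau> where "\<tau> = 1 / P.h (Suc k) * (P.\<sigma> k / P.h k)"
      have \<tau>: "\<tau> > 0" using k h by (simp add: \<tau>_def)
      have \<eta>_nz: "\<eta> (Suc k) \<noteq> 0"
        using \<eta>[of "Suc k"] C P.g_pos[of "Suc k"] k by simp
      have b: "b_shift \<gamma> d n = of_real (1 / P.h (Suc k))"
        unfolding b_shift_eq[OF \<gamma> nd] using \<eta>_ratio[of "Suc k"] k by simp
      have c: "c_scale \<gamma> d n = of_real (\<tau>\<^sup>2)"
      proof -
        have "\<eta> k / \<eta> (Suc (Suc k)) = \<eta> k / \<eta> (Suc k) * (\<eta> (Suc k) / \<eta> (Suc (Suc k)))"
          using \<eta>_nz by simp
        hence "c_scale \<gamma> d n = (- of_real (1 / P.h (Suc k)))\<^sup>2 - (- of_real (1 / P.h k)) * (- of_real (1 / P.h (Suc k)))"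
          unfolding c_scale_eq[OF \<gamma> nd \<eta>_nz] using \<eta>_ratio[of k] \<eta>_ratio[of "Suc k"] k by simp
        also have "\<dots> = of_real ((1 / P.h (Suc k)) ^ 2 - 1 / P.h k * (1 / P.h (Suc k)))" by simp
        also have "(1 / P.h (Suc k)) ^ 2 - 1 / P.h k * (1 / P.h (Suc k)) = \<tau>\<^sup>2"
        proof -
          have "(P.\<sigma> k)\<^sup>2 = P.h k * (P.h k - P.h (Suc k))" using k by (simp add: P.\<sigma>_sq P.p_2_eq)
          hence "\<tau>\<^sup>2 = (1 / P.h (Suc k))\<^sup>2 * (P.h k * (P.h k - P.h (Suc k)) / (P.h k)\<^sup>2)"
            by (simp add: \<tau>_def power_mult_distrib power_divide)
          also have "P.h k * (P.h k - P.h (Suc k)) / (P.h k)\<^sup>2 = 1 - P.h (Suc k) / P.h k"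
            using h by (simp add: field_simps power2_eq_square)
          finally show ?thesis using h by (simp add: field_simps power2_eq_square)
        qed
        finally show ?thesis .
      qed
      have "csqrt (c_scale \<gamma> d n) = of_real \<tau>"
        unfolding c using \<tau> by (simp add: csqrt_of_real_nonneg del: of_real_power)
      moreover have "c_scale \<gamma> d n powr (- of_nat d / 2) = 1 / of_real \<tau> ^ d"
      proof -
        have "c_scale \<gamma> d n powr (- of_nat d / 2) = of_real (\<tau>\<^sup>2) powr of_real (- real d / 2)"
          by (simp add: c)
        also have "\<dots> = of_real (\<tau>\<^sup>2 powr (- real d / 2))"
          by (rule powr_of_real) simp
        also have "\<tau>\<^sup>2 powr (- real d / 2) = \<tau> powr (- real d)"
        proof -
          have "\<tau>\<^sup>2 = \<tau> powr 2" using \<tau> by simp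
          thus ?thesis by (simp add: powr_powr)
        qed
        also have "\<dots> = 1 / \<tau> ^ d" using \<tau> by (simp add: powr_minus_divide powr_realpow)
        finally show ?thesis by simp
      qed
      moreover have "n + d - 1 = Suc k" using nd by simp
      moreover have "P.slope d n = P.\<sigma> k / P.h k" by (simp add: P.slope_def k_def)
      ultimately show ?case using b by (simp add: \<tau>_def)
    qed
  qed
  show ?thesis
  proof (intro allI impI uniform_limit_compactI)
    fix w
    show "(He d \<longlongrightarrow> He d w) (nhds w)"
      unfolding He_def[abs_def] by (intro tendsto_intros) (auto intro: filterlim_ident)
    have "\<forall>\<^sub>F x in sequentially \<times>\<^sub>F nhds w. b_shift \<gamma> d (fst x) = of_real (1 / P.h (fst x + d - 1)) \<and>
      csqrt (c_scale \<gamma> d (fst x)) = of_real (1 / P.h (fst x + d - 1) * P.slope d (fst x)) \<and>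
      c_scale \<gamma> d (fst x) powr (- of_nat d / 2) = 1 / of_real (1 / P.h (fst x + d - 1) * P.slope d (fst x)) ^ d"
      using scale filterlim_fst unfolding filterlim_iff by blast
    hence "\<forall>\<^sub>F x in sequentially \<times>\<^sub>F nhds w.
       (case x of (n, w) \<Rightarrow> even_jensen \<eta> d n (of_real (1 / P.h (n + d - 1) * P.slope d n) * w + of_real (1 / P.h (n + d - 1))) /
            (of_real (1 / P.h (n + d - 1) * P.slope d n) ^ d * \<eta> (n + d))) =
       (case x of (n, z) \<Rightarrow> c_scale \<gamma> d n powr (- of_nat d / 2) / \<eta> (n + d)
                     * even_jensen \<eta> d n (csqrt (c_scale \<gamma> d n) * z + b_shift \<gamma> d n))"
    proof eventually_elim
      case (elim x)
      thus ?case by (cases x) (simp only: fst_conv prod.case, simp)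
    qed
    with P.jensen_tendsto_He[OF \<eta> C]
    show "((\<lambda>(n, z). c_scale \<gamma> d n powr (- of_nat d / 2) / \<eta> (n + d)
                     * even_jensen \<eta> d n (csqrt (c_scale \<gamma> d n) * z + b_shift \<gamma> d n)) \<longlongrightarrow> He d w)
      (sequentially \<times>\<^sub>F nhds w)"
      by (rule Lim_transform_eventually)
  qed
qed

end
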